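(* (1) The Gromov-Hausdorff distance $\rho_{GH}$ on $\mathcal{M}$ (and therefore every analytic pseudometric which is Borel-uniformly continuous bi-reducible with $\rho_{GH}$) is Borel-uniformly continuous bi-reducible with a CTR orbit pseudometric. (2) For every CTR orbit pseudometric $\rho$, the equivalence relation $E_1$ is not Borel reducible to the equivalence relation $E_{\rho}$.
   Context: $\mathcal{M}$ is the set of all metrics on $\mathbb{N}$, with the Polish topology inherited from $\mathbb{R}^{\mathbb{N}\times\mathbb{N}}$. The Gromov-Hausdorff distance $\rho_{GH}(M,N)\in[0,\infty]$ of metric spaces $M,N$ is the infimum of the Hausdorff distances of $\iota_M(M)$ and $\iota_N(N)$ over all isometric embeddings $\iota_M:M\to X$, $\iota_N:N\to X$ into a common metric space $X$. For $f,g\in\mathcal{M}$, $\rho_{GH}(f,g)$ is the Gromov-Hausdorff distance between $(\mathbb{N},f)$ and $(\mathbb{N},g)$. A pseudometric $\rho:X\times X\to[0,\infty]$ on a standard Borel space $X$ (the value $\infty$ is allowed) is analytic if $\{(x,y)\in X^2:\rho(x,y)<r\}$ is analytic for every $r>0$. For a pseudometric $\rho$ on $X$, $E_\rho=\{(x,y)\in X^2:\rho(x,y)=0\}$. For analytic pseudometrics $\rho_X$ on $X$ and $\rho_Y$ on $Y$, write $\rho_X\leq_{B,u}\rho_Y$ if there is a Borel function $f:X\to Y$ such that for every $\varepsilon>0$ there are $\delta_X,\delta_Y>0$ such that for all $x,y\in X$: $\rho_X(x,y)<\delta_X\Rightarrow\rho_Y(f(x),f(y))<\varepsilon$, and $\rho_Y(f(x),f(y))<\delta_Y\Rightarrow\rho_X(x,y)<\varepsilon$.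 They are Borel-uniformly continuous bi-reducible if $\rho_X\leq_{B,u}\rho_Y$ and $\rho_Y\leq_{B,u}\rho_X$. An equivalence relation $E$ on a standard Borel space $X$ is Borel reducible to an equivalence relation $F$ on a standard Borel space $Y$ if there is a Borel $f:X\to Y$ with $xEy\Leftrightarrow f(x)Ff(y)$ for all $x,y\in X$. Orbit pseudometrics: let $G$ be a Polish group and $X$ a standard Borel $G$-space (i.e. $G$ acts on $X$ in a Borel way) equipped with an analytic pseudometric $d$ for which $G$ acts by isometries. The orbit pseudometric $\rho_{G,d}$ on $X$ is $\rho_{G,d}(x,y)=\inf\{d(gx,hy):g,h\in G\}$. It is called CTR if moreover $d$ is a complete metric and there is a Polish topology on $X$ which induces the given Borel structure of $X$, makes the action of $G$ on $X$ continuous, and is refined by the topology of $d$. $E_1$ is the equivalence relation on $(2^{\mathbb{N}})^{\mathbb{N}}$ given by $xE_1y\Leftrightarrow\exists N\,\forall n\geq N:\ x(n)=y(n)$. *)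

theory Defs
  imports "HOL-Analysis.Analysis" "HOL-Algebra.Group_Action"
begin

section \<open>Polish spaces, standard Borel spaces and analytic sets\<close>

definition polish_topology :: "'a topology \<Rightarrow> bool" where
  "polish_topology T \<longleftrightarrow> completely_metrizable_space T \<and> separable_space T"

definition borel_of :: "'a topology \<Rightarrow> 'a measure" where
  "borel_of T = sigma (topspace T) {U. openin T U}"

text \<open>
  Borel spaces are represented by values of type \<^typ>\<open>'a measure\<close>, of which only the
  underlying set and the sigma-algebra are used.
\<close>

definition standard_borel :: "'a measure \<Rightarrow> bool" where
  "standard_borel X \<longleftrightarrow>
    (\<exists>T. polish_topology T \<and> topspace T = space X \<and> sets (borel_of T) = sets X)"

text \<open>
  A set is analytic if it is the image of a standard Borel space under a Borel map. A standard
  Borel space has at most continuum many points, so up to isomorphism all of them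
  (the empty one included) live on subsets of the type \<^typ>\<open>nat \<Rightarrow> nat\<close>.
\<close>

definition analytic_in :: "'a measure \<Rightarrow> 'a set \<Rightarrow> bool" where
  "analytic_in X A \<longleftrightarrow>
    (\<exists>(S :: (nat \<Rightarrow> nat) measure) f. standard_borel S \<and> f \<in> S \<rightarrow>\<^sub>M X \<and> f ` space S = A)"

section \<open>Analytic pseudometrics and reductions\<close>

definition pseudometric_on :: "'a set \<Rightarrow> ('a \<Rightarrow> 'a \<Rightarrow> ennreal) \<Rightarrow> bool" where
  "pseudometric_on S \<rho> \<longleftrightarrow>
    (\<forall>x\<in>S. \<rho> x x = 0) \<and>
    (\<forall>x\<in>S. \<forall>y\<in>S. \<rho> x y = \<rho> y x) \<and>
    (\<forall>x\<in>S. \<forall>y\<in>S. \<forall>z\<in>S. \<rho> x z \<le> \<rho> x y + \<rho> y z)"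

definition analytic_pseudometric :: "'a measure \<Rightarrow> ('a \<Rightarrow> 'a \<Rightarrow> ennreal) \<Rightarrow> bool" where
  "analytic_pseudometric X \<rho> \<longleftrightarrow>
    standard_borel X \<and> pseudometric_on (space X) \<rho> \<and>
    (\<forall>r::real. r > 0 \<longrightarrow>
      analytic_in (X \<Otimes>\<^sub>M X) {(x, y). x \<in> space X \<and> y \<in> space X \<and> \<rho> x y < ennreal r})"

definition zero_relation :: "'a measure \<Rightarrow> ('a \<Rightarrow> 'a \<Rightarrow> ennreal) \<Rightarrow> ('a \<times> 'a) set" where
  "zero_relation X \<rho> = {(x, y). x \<in> space X \<and> y \<in> space X \<and> \<rho> x y = 0}"

definition Bu_reducible ::
  "'a measure \<Rightarrow> ('a \<Rightarrow> 'a \<Rightarrow> ennreal) \<Rightarrow> 'b measure \<Rightarrow> ('b \<Rightarrow> 'b \<Rightarrow> ennreal) \<Rightarrow> bool" where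
  "Bu_reducible X \<rho>X Y \<rho>Y \<longleftrightarrow>
    analytic_pseudometric X \<rho>X \<and> analytic_pseudometric Y \<rho>Y \<and>
    (\<exists>f \<in> X \<rightarrow>\<^sub>M Y. \<forall>\<epsilon>::real. \<epsilon> > 0 \<longrightarrow>
      (\<exists>\<delta>X \<delta>Y :: real. \<delta>X > 0 \<and> \<delta>Y > 0 \<and>
        (\<forall>x\<in>space X. \<forall>y\<in>space X.
          (\<rho>X x y < ennreal \<delta>X \<longrightarrow> \<rho>Y (f x) (f y) < ennreal \<epsilon>) \<and>
          (\<rho>Y (f x) (f y) < ennreal \<delta>Y \<longrightarrow> \<rho>X x y < ennreal \<epsilon>))))"

definition Bu_bireducible ::
  "'a measure \<Rightarrow> ('a \<Rightarrow> 'a \<Rightarrow> ennreal) \<Rightarrow> 'b measure \<Rightarrow> ('b \<Rightarrow> 'b \<Rightarrow> ennreal) \<Rightarrow> bool" where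
  "Bu_bireducible X \<rho>X Y \<rho>Y \<longleftrightarrow> Bu_reducible X \<rho>X Y \<rho>Y \<and> Bu_reducible Y \<rho>Y X \<rho>X"

definition borel_reducible ::
  "'a measure \<Rightarrow> ('a \<times> 'a) set \<Rightarrow> 'b measure \<Rightarrow> ('b \<times> 'b) set \<Rightarrow> bool" where
  "borel_reducible X E Y F \<longleftrightarrow>
    (\<exists>f \<in> X \<rightarrow>\<^sub>M Y. \<forall>x\<in>space X. \<forall>y\<in>space X. (x, y) \<in> E \<longleftrightarrow> (f x, f y) \<in> F)"

section \<open>The Gromov-Hausdorff distance\<close>

definition Hausdorff_distance :: "('a \<Rightarrow> 'a \<Rightarrow> real) \<Rightarrow> 'a set \<Rightarrow> 'a set \<Rightarrow> ennreal" where
  "Hausdorff_distance d A B =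
    max (SUP a\<in>A. INF b\<in>B. ennreal (d a b)) (SUP b\<in>B. INF a\<in>A. ennreal (d a b))"

definition isometric_embedding ::
  "'a set \<Rightarrow> ('a \<Rightarrow> 'a \<Rightarrow> real) \<Rightarrow> 'b set \<Rightarrow> ('b \<Rightarrow> 'b \<Rightarrow> real) \<Rightarrow> ('a \<Rightarrow> 'b) \<Rightarrow> bool" where
  "isometric_embedding M dM N dN i \<longleftrightarrow>
    i ` M \<subseteq> N \<and> (\<forall>x\<in>M. \<forall>y\<in>M. dN (i x) (i y) = dM x y)"

text \<open>
  The common metric space \<open>(Z, d)\<close> may be shrunk to the union of the two images without
  changing the Hausdorff distance; that union embeds into the sum type, so taking \<open>Z\<close> there
  loses no generality.
\<close>

definition Gromov_Hausdorff_distance ::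
  "'a set \<Rightarrow> ('a \<Rightarrow> 'a \<Rightarrow> real) \<Rightarrow> 'b set \<Rightarrow> ('b \<Rightarrow> 'b \<Rightarrow> real) \<Rightarrow> ennreal" where
  "Gromov_Hausdorff_distance M dM N dN =
    Inf {Hausdorff_distance d (i ` M) (j ` N) | (Z :: ('a + 'b) set) d i j.
      Metric_space Z d \<and> isometric_embedding M dM Z d i \<and> isometric_embedding N dN Z d j}"

definition metrics_on_nat :: "(nat \<times> nat \<Rightarrow> real) set" where
  "metrics_on_nat = {f. Metric_space UNIV (curry f)}"

definition metrics_space :: "(nat \<times> nat \<Rightarrow> real) measure" where
  "metrics_space = borel_of (subtopology (product_topology (\<lambda>_. euclideanreal) UNIV) metrics_on_nat)"

definition \<rho>GH :: "(nat \<times> nat \<Rightarrow> real) \<Rightarrow> (nat \<times> nat \<Rightarrow> real) \<Rightarrow> ennreal" where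
  "\<rho>GH f g = Gromov_Hausdorff_distance UNIV (curry f) UNIV (curry g)"

section \<open>Orbit pseudometrics\<close>

definition polish_group :: "('g, 'm) monoid_scheme \<Rightarrow> 'g topology \<Rightarrow> bool" where
  "polish_group G T \<longleftrightarrow>
    group G \<and> topspace T = carrier G \<and> polish_topology T \<and>
    continuous_map (prod_topology T T) T (\<lambda>(g, h). g \<otimes>\<^bsub>G\<^esub> h) \<and>
    continuous_map T T (\<lambda>g. inv\<^bsub>G\<^esub> g)"

definition standard_borel_G_space ::
  "('g, 'm) monoid_scheme \<Rightarrow> 'g topology \<Rightarrow> 'x measure \<Rightarrow> ('g \<Rightarrow> 'x \<Rightarrow> 'x) \<Rightarrow> bool" where
  "standard_borel_G_space G T X \<phi> \<longleftrightarrow>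
    polish_group G T \<and> standard_borel X \<and> group_action G (space X) \<phi> \<and>
    (\<lambda>(g, x). \<phi> g x) \<in> borel_of T \<Otimes>\<^sub>M X \<rightarrow>\<^sub>M X"

definition orbit_pseudometric ::
  "('g, 'm) monoid_scheme \<Rightarrow> ('g \<Rightarrow> 'x \<Rightarrow> 'x) \<Rightarrow> ('x \<Rightarrow> 'x \<Rightarrow> ennreal) \<Rightarrow> 'x \<Rightarrow> 'x \<Rightarrow> ennreal" where
  "orbit_pseudometric G \<phi> d x y = (INF g\<in>carrier G. INF h\<in>carrier G. d (\<phi> g x) (\<phi> h y))"

definition orbit_setting ::
  "('g, 'm) monoid_scheme \<Rightarrow> 'g topology \<Rightarrow> 'x measure \<Rightarrow> ('g \<Rightarrow> 'x \<Rightarrow> 'x) \<Rightarrow>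
    ('x \<Rightarrow> 'x \<Rightarrow> ennreal) \<Rightarrow> bool" where
  "orbit_setting G T X \<phi> d \<longleftrightarrow>
    standard_borel_G_space G T X \<phi> \<and> analytic_pseudometric X d \<and>
    (\<forall>g\<in>carrier G. \<forall>x\<in>space X. \<forall>y\<in>space X. d (\<phi> g x) (\<phi> g y) = d x y)"

text \<open>
  As for pseudometrics, a metric may take the value \<open>\<infinity>\<close>; hence the real-valued metric spaces of
  the library do not apply here.
\<close>

definition complete_metric_on :: "'a set \<Rightarrow> ('a \<Rightarrow> 'a \<Rightarrow> ennreal) \<Rightarrow> bool" where
  "complete_metric_on S d \<longleftrightarrow>
    pseudometric_on S d \<and>
    (\<forall>x\<in>S. \<forall>y\<in>S. d x y = 0 \<longrightarrow> x = y) \<and>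
    (\<forall>s :: nat \<Rightarrow> 'a. range s \<subseteq> S \<and>
        (\<forall>\<epsilon>::real. \<epsilon> > 0 \<longrightarrow> (\<exists>N. \<forall>m\<ge>N. \<forall>n\<ge>N. d (s m) (s n) < ennreal \<epsilon>)) \<longrightarrow>
      (\<exists>x\<in>S. (\<lambda>n. d (s n) x) \<longlonglongrightarrow> 0))"

definition emetric_topology :: "'a set \<Rightarrow> ('a \<Rightarrow> 'a \<Rightarrow> ennreal) \<Rightarrow> 'a topology" where
  "emetric_topology S d =
    topology (\<lambda>U. U \<subseteq> S \<and> (\<forall>x\<in>U. \<exists>\<epsilon>::real. \<epsilon> > 0 \<and> (\<forall>y\<in>S. d x y < ennreal \<epsilon> \<longrightarrow> y \<in> U)))"

lemma openin_emetric_topology: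
  "openin (emetric_topology S d) U \<longleftrightarrow>
    U \<subseteq> S \<and> (\<forall>x\<in>U. \<exists>\<epsilon>::real. \<epsilon> > 0 \<and> (\<forall>y\<in>S. d x y < ennreal \<epsilon> \<longrightarrow> y \<in> U))"
proof -
  let ?P = "\<lambda>U. U \<subseteq> S \<and> (\<forall>x\<in>U. \<exists>\<epsilon>::real. \<epsilon> > 0 \<and> (\<forall>y\<in>S. d x y < ennreal \<epsilon> \<longrightarrow> y \<in> U))"
  have "?P (U \<inter> V)" if U: "?P U" and V: "?P V" for U V
  proof (intro conjI ballI)
    show "U \<inter> V \<subseteq> S" using U by blast
  next
    fix x assume x: "x \<in> U \<inter> V"
    obtain a :: real where a: "a > 0" "\<forall>y\<in>S. d x y < ennreal a \<longrightarrow> y \<in> U"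
      using U x by blast
    obtain b :: real where b: "b > 0" "\<forall>y\<in>S. d x y < ennreal b \<longrightarrow> y \<in> V"
      using V x by blast
    have "ennreal (min a b) \<le> ennreal a" "ennreal (min a b) \<le> ennreal b"
      by (simp_all add: ennreal_leI)
    then have "\<forall>y\<in>S. d x y < ennreal (min a b) \<longrightarrow> y \<in> U \<inter> V"
      using a(2) b(2) by (meson IntI order_less_le_trans)
    then show "\<exists>\<epsilon>::real. \<epsilon> > 0 \<and> (\<forall>y\<in>S. d x y < ennreal \<epsilon> \<longrightarrow> y \<in> U \<inter> V)"
      using a(1) b(1) by (intro exI[of _ "min a b"]) simp
  qed
  moreover have "?P (\<Union>K)" if "\<forall>U\<in>K. ?P U" for K
    using that by (auto; meson)
  ultimately have "istopology ?P"
    unfolding istopology_def by blast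
  then show ?thesis
    by (simp add: emetric_topology_def topology_inverse')
qed

definition CTR_setting ::
  "('g, 'm) monoid_scheme \<Rightarrow> 'g topology \<Rightarrow> 'x measure \<Rightarrow> ('g \<Rightarrow> 'x \<Rightarrow> 'x) \<Rightarrow>
    ('x \<Rightarrow> 'x \<Rightarrow> ennreal) \<Rightarrow> bool" where
  "CTR_setting G T X \<phi> d \<longleftrightarrow>
    orbit_setting G T X \<phi> d \<and> complete_metric_on (space X) d \<and>
    (\<exists>\<tau>. polish_topology \<tau> \<and> topspace \<tau> = space X \<and> sets (borel_of \<tau>) = sets X \<and>
      continuous_map (prod_topology T \<tau>) \<tau> (\<lambda>(g, x). \<phi> g x) \<and>
      (\<forall>U. openin \<tau> U \<longrightarrow> openin (emetric_topology (space X) d) U))"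

text \<open>
  That some CTR orbit pseudometric exists with a given property has to be stated with fixed
  types for the group and for the space. Polish groups and standard Borel spaces have at most
  continuum many points, so they can be copied to subsets of the types below, both of which
  have the cardinality of the continuum.
\<close>

definition bireducible_with_CTR_orbit_pseudometric ::
  "'a measure \<Rightarrow> ('a \<Rightarrow> 'a \<Rightarrow> ennreal) \<Rightarrow> bool" where
  "bireducible_with_CTR_orbit_pseudometric Y \<sigma> \<longleftrightarrow>
    (\<exists>(G :: (nat \<Rightarrow> nat) monoid) T (X :: (nat \<times> nat \<Rightarrow> real) measure) \<phi> d.
      CTR_setting G T X \<phi> d \<and> Bu_bireducible Y \<sigma> X (orbit_pseudometric G \<phi> d))"

section \<open>The equivalence relation \<open>E1\<close>\<close>

definition E1_space :: "(nat \<Rightarrow> nat \<Rightarrow> bool) measure" where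
  "E1_space = borel_of
    (product_topology (\<lambda>_. product_topology (\<lambda>_. discrete_topology UNIV) UNIV) UNIV)"

definition E1 :: "((nat \<Rightarrow> nat \<Rightarrow> bool) \<times> (nat \<Rightarrow> nat \<Rightarrow> bool)) set" where
  "E1 = {(x, y). \<exists>N. \<forall>n\<ge>N. x n = y n}"

end

theory Submission
  imports Defs
begin

text \<open>
  The two parts have independent proofs.

  \<^emph>\<open>The Gromov-Hausdorff distance is bi-reducible with a CTR orbit pseudometric.\<close> The
  Gromov-Hausdorff distance of two metrics on \<open>\<nat>\<close> is half the infimum of the distortions of
  the correspondences between them, that is, of the relations that are total on both sides
  (\<open>Gromov_Hausdorff_distance_less_iff\<close>). If only bijections were admitted as correspondences,
  this would be an orbit pseudometric: the permutations of \<open>\<nat>\<close> act by relabelling, and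
  \<open>d f g = sup |f - g|\<close> is invariant. Two Borel maps bridge the gap. Repeating each point
  infinitely often, which creates distances \<open>0\<close> and so leads from metrics to pseudometrics, makes
  every correspondence contain a bijection (\<open>bij_in_correspondence\<close>). Adding \<open>1\<close> to all distances
  between different points leads back from pseudometrics to metrics, and there a correspondence of
  distortion less than \<open>1\<close> is a bijection (\<open>bij_of_separated_correspondence\<close>). The
  pseudometrics on \<open>\<nat>\<close> form a closed set of functions. Hence they are a Polish space on which \<open>d\<close>
  is complete, and \<open>d\<close> refines the topology of pointwise convergence: the action is a CTR setting
  (\<open>CTR_setting_relabel\<close>).

  \<^emph>\<open>\<open>E1\<close> is not reducible to a CTR orbit pseudometric.\<close> As the reals embed into \<open>2\<^sup>\<nat>\<close>, one
  may take sequences \<open>x\<close> of reals. Suppose that a Borel map \<open>F\<close> takes them to a CTR space such that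
  \<open>F x\<close> and \<open>F y\<close> have orbit distance \<open>0\<close> just when \<open>x\<close> and \<open>y\<close> are eventually equal. All values of
  \<open>F\<close> on a line, where a single coordinate varies, have orbit distance \<open>0\<close> from each other. As the
  group is separable, a pigeonhole argument (\<open>orbit_pigeonhole\<close>) shows that, for most \<open>z\<close> on the
  line, many \<open>z'\<close> arbitrarily near \<open>z\<close> satisfy \<open>d (g \<cdot> F z) (F z') < \<epsilon>\<close> for some \<open>g\<close> near the
  identity. This relation is analytic, so it has the Baire property, and the theorem of
  Kuratowski and Ulam turns the observation about lines into one about a comeager set of sequences
  (\<open>comeager_directional_density\<close>), which can be shrunk to a comeager set \<open>D\<close> that is closed
  under most changes of one coordinate (\<open>comeager_hereditary_core\<close>).

  Inside \<open>D\<close> one changes the coordinates \<open>0, 1, 2, \<dots>\<close> one after the other, each time by a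
  little. This gives \<open>x\<^sub>n \<longlonglongrightarrow> y\<close> and group elements \<open>h\<^sub>n \<longlonglongrightarrow> h\<close> such that the points
  \<open>w\<^sub>n = h\<^sub>n\<^sup>-\<^sup>1 \<cdot> F x\<^sub>n\<close> form a Cauchy sequence for \<open>d\<close>. By completeness it has a limit \<open>w\<close>, and as
  \<open>d\<close> refines a topology with continuous action, in which \<open>F\<close> is continuous on a comeager
  set, \<open>F y = h \<cdot> w\<close>. So the orbit distance from \<open>F x\<^sub>n\<close> to \<open>F y\<close> tends to \<open>0\<close>. But
  \<open>x\<^sub>n\<close> and \<open>x\<^sub>0\<close> are eventually equal, so the orbit distance of \<open>F x\<^sub>0\<close> and \<open>F y\<close> is \<open>0\<close>, although
  \<open>x\<^sub>0\<close> and \<open>y\<close> differ in all coordinates.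
\<close>

section \<open>Meager sets and the Baire property\<close>

definition meager :: "'a::topological_space set \<Rightarrow> bool" where
  "meager A \<longleftrightarrow> (\<exists>N::nat \<Rightarrow> 'a set. (\<forall>n. closed (N n) \<and> interior (N n) = {}) \<and> A \<subseteq> (\<Union>n. N n))"

lemma meagerE:
  assumes "meager A"
  obtains N :: "nat \<Rightarrow> 'a::topological_space set"
  where "\<And>n. closed (N n)" "\<And>n. interior (N n) = {}" "A \<subseteq> (\<Union>n. N n)"
  using assms unfolding meager_def by blast

lemma meager_subset: "meager B \<Longrightarrow> A \<subseteq> B \<Longrightarrow> meager A"
  unfolding meager_def by (meson subset_trans)

lemma meager_nowhere_dense:
  assumes "closed N" "interior N = {}"
  shows "meager N"
  unfolding meager_def using assms by (intro exI[of _ "\<lambda>_. N"]) auto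

lemma meager_empty [simp]: "meager {}"
  by (rule meager_nowhere_dense) auto

lemma meager_UN_nat:
  assumes "\<And>n::nat. meager (A n)"
  shows "meager (\<Union>n. A n)"
proof -
  have "\<forall>n. \<exists>N::nat \<Rightarrow> 'a set. (\<forall>i. closed (N i) \<and> interior (N i) = {}) \<and> A n \<subseteq> (\<Union>i. N i)"
    using assms unfolding meager_def by blast
  then obtain N :: "nat \<Rightarrow> nat \<Rightarrow> 'a set"
    where N: "\<And>n i. closed (N n i)" "\<And>n i. interior (N n i) = {}" "\<And>n. A n \<subseteq> (\<Union>i. N n i)"
    by metis
  let ?K = "\<lambda>k. N (fst (prod_decode k)) (snd (prod_decode k))"
  have "(\<Union>n. A n) \<subseteq> (\<Union>k. ?K k)"
  proof
    fix x assume "x \<in> (\<Union>n. A n)"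
    then obtain n i where "x \<in> N n i"
      using N(3) by blast
    then have "x \<in> ?K (prod_encode (n, i))"
      by simp
    then show "x \<in> (\<Union>k. ?K k)"
      by blast
  qed
  then show ?thesis
    unfolding meager_def using N(1,2) by (intro exI[of _ ?K]) auto
qed

lemma meager_UN:
  assumes "countable I" "\<And>i. i \<in> I \<Longrightarrow> meager (A i)"
  shows "meager (\<Union>i\<in>I. A i)"
proof (cases "I = {}")
  case False
  then have "(\<Union>i\<in>I. A i) = (\<Union>n. A (from_nat_into I n))"
    using assms(1) by (metis UN_extend_simps(10) range_from_nat_into)
  then show ?thesis
    using assms(2) False by (simp add: meager_UN_nat from_nat_into)
qed simp

lemma meager_Un: "meager A \<Longrightarrow> meager B \<Longrightarrow> meager (A \<union> B)"
  using meager_UN[of "{A, B}" id] by auto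

lemma meager_closed_minus_interior: "closed S \<Longrightarrow> meager (S - interior S)"
proof (rule meager_nowhere_dense)
  assume "closed S"
  then show "closed (S - interior S)"
    by (simp add: closed_Diff)
  show "interior (S - interior S) = {}"
    using interior_mono[of "S - interior S" S] interior_subset[of "S - interior S"] by blast
qed

lemma meager_closure_minus_open: "open U \<Longrightarrow> meager (closure U - U)"
  using meager_closed_minus_interior[of "- U"]
  by (simp add: interior_complement Diff_eq Int_commute closed_Compl)

lemma meager_singleton: "meager {x :: 'a :: {perfect_space, t1_space}}"
  by (rule meager_nowhere_dense) auto

text \<open>
  The Baire category theorem.
\<close>

lemma nonmeager_open:
  fixes U :: "'a::complete_space set"
  assumes "open U" "U \<noteq> {}"
  shows "\<not> meager U"
proof
  assume "meager U"
  then obtain N :: "nat \<Rightarrow> 'a set"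
    where N: "\<And>n. closed (N n)" "\<And>n. interior (N n) = {}" "U \<subseteq> (\<Union>n. N n)"
    unfolding meager_def by blast
  have "euclidean interior_of (\<Union>(range N)) = {}"
    by (rule Baire_category_alt) (use N in \<open>auto simp: completely_metrizable_space_euclidean\<close>)
  then show False
    using N(3) assms by (metis interior_eq interior_mono euclidean_interior_of subset_empty)
qed

definition baire_property :: "'a::topological_space set \<Rightarrow> bool" where
  "baire_property A \<longleftrightarrow> (\<exists>U. open U \<and> meager ((A - U) \<union> (U - A)))"

text \<open>
  The points at which \<open>A\<close> is nowhere locally meager: up to a meager set, the least closed set that
  contains \<open>A\<close>.
\<close>

definition category_hull :: "'a::topological_space set \<Rightarrow> 'a set" where
  "category_hull A = {x. \<forall>V. open V \<and> x \<in> V \<longrightarrow> \<not> meager (A \<inter> V)}"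

lemma closed_category_hull: "closed (category_hull A)"
proof -
  have "- category_hull A = \<Union>{V. open V \<and> meager (A \<inter> V)}"
    by (auto simp: category_hull_def)
  then show ?thesis
    unfolding closed_def by auto
qed

lemma meager_minus_category_hull:
  fixes A :: "'a::second_countable_topology set"
  shows "meager (A - category_hull A)"
proof -
  obtain B :: "'a set set" where B: "countable B" "topological_basis B"
    using ex_countable_basis by blast
  have "A - category_hull A \<subseteq> (\<Union>V\<in>{V\<in>B. meager (A \<inter> V)}. A \<inter> V)"
  proof
    fix x assume x: "x \<in> A - category_hull A"
    then obtain V where V: "open V" "x \<in> V" "meager (A \<inter> V)"
      by (auto simp: category_hull_def)
    then obtain V' where "V' \<in> B" "x \<in> V'" "V' \<subseteq> V"
      using B(2) by (meson topological_basisE)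
    then show "x \<in> (\<Union>V\<in>{V\<in>B. meager (A \<inter> V)}. A \<inter> V)"
      using x V(3) meager_subset[of "A \<inter> V" "A \<inter> V'"] by blast
  qed
  moreover have "meager (\<Union>V\<in>{V\<in>B. meager (A \<inter> V)}. A \<inter> V)"
    using B(1) by (intro meager_UN) auto
  ultimately show ?thesis
    using meager_subset by blast
qed

text \<open>
  An open set in which \<open>A\<close> is everywhere nonmeager contains a smaller one in which some \<open>B n\<close> is
  everywhere nonmeager, since otherwise all \<open>B n\<close>, and with them \<open>A\<close>, would be meager in it. So the
  interiors of the hulls of the \<open>B n\<close> are dense in the interior of the hull of \<open>A\<close>, and what is
  missing lies in the boundaries of an open and of a closed set.
\<close>

lemma category_hull_Union:
  fixes A :: "'a::second_countable_topology set"
  assumes "A = (\<Union>n::nat. B n)"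
  shows "meager (category_hull A - (\<Union>n. category_hull (B n)))"
proof -
  let ?H = "category_hull A"
  let ?O = "\<Union>n. interior (category_hull (B n))"
  have dense: "interior ?H \<subseteq> closure ?O"
  proof
    fix x assume x: "x \<in> interior ?H"
    show "x \<in> closure ?O"
    proof (rule ccontr)
      assume nx: "x \<notin> closure ?O"
      define V where "V = interior ?H \<inter> - closure ?O"
      have V: "open V" "x \<in> V"
        using x nx by (auto simp: V_def)
      have "\<not> meager (A \<inter> V)"
        using V x interior_subset[of ?H] by (auto simp: category_hull_def)
      then obtain n where n: "\<not> meager (B n \<inter> V)"
        using meager_UN_nat[of "\<lambda>n. B n \<inter> V"] assms by (metis Int_commute UN_extend_simps(4))
      have "B n \<inter> V \<subseteq> (B n - category_hull (B n)) \<union> (category_hull (B n) - interior (category_hull (B n)))"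
        using closure_subset[of ?O] by (auto simp: V_def)
      then show False
        using n meager_Un[OF meager_minus_category_hull[of "B n"]
            meager_closed_minus_interior[OF closed_category_hull[of "B n"]]] meager_subset by blast
    qed
  qed
  have "open ?O"
    by auto
  then have "meager (closure ?O - ?O)"
    by (rule meager_closure_minus_open)
  moreover have "meager (?H - interior ?H)"
    by (simp add: closed_category_hull meager_closed_minus_interior)
  moreover have "?H - (\<Union>n. category_hull (B n)) \<subseteq> (?H - interior ?H) \<union> (closure ?O - ?O)"
  proof -
    have "?O \<subseteq> (\<Union>n. category_hull (B n))"
      using interior_subset by blast
    then show ?thesis
      using dense by blast
  qed
  ultimately show ?thesis
    using meager_Un meager_subset by metis
qed

lemma (in Metric_space) dense_sequence:
  assumes "separable_space mtopology" "M \<noteq> {}"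
  obtains p :: "nat \<Rightarrow> 'a" where "\<And>i. p i \<in> M" "\<And>x e. x \<in> M \<Longrightarrow> e > 0 \<Longrightarrow> \<exists>i. d (p i) x < e"
proof -
  obtain D where D: "countable D" "D \<subseteq> M" "mtopology closure_of D = M"
    using assms(1) unfolding separable_space_def by auto
  then have "D \<noteq> {}"
    using assms(2) by auto
  then have ran: "range (from_nat_into D) = D"
    using D(1) by simp
  show ?thesis
  proof
    show "from_nat_into D i \<in> M" for i
      using ran D(2) by blast
    show "\<exists>i. d (from_nat_into D i) x < e" if x: "x \<in> M" "e > 0" for x e
    proof -
      obtain y where "y \<in> D" "y \<in> mball x e"
        using D(3) x unfolding metric_closure_of by blast
      moreover obtain i where "from_nat_into D i = y"
        using ran \<open>y \<in> D\<close> by (metis imageE)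
      ultimately show ?thesis
        by (auto simp: commute)
    qed
  qed
qed

text \<open>
  Nikodym's theorem that analytic sets have the Baire property, for projections along a Polish
  space \<open>P\<close>. Cut \<open>P\<close> into countably many small pieces, each of them into countably many smaller
  ones, and so on; \<open>A s\<close> is the projection of the part of \<open>C\<close> above the piece with index sequence
  \<open>s\<close>. By \<open>category_hull_Union\<close>, a point of the hull of \<open>A []\<close> outside a fixed meager set lies
  in the hulls along a whole branch of pieces. Hence it is a limit of projections of points of \<open>C\<close>
  whose \<open>P\<close>-coordinates form a Cauchy sequence, and as \<open>C\<close> is closed it lies in the projection
  itself. So the projection agrees with its hull up to a meager set.
\<close>

theorem baire_property_projection:
  fixes C :: "('a::{metric_space, second_countable_topology} \<times> 'p) set"
  assumes P: "polish_topology P" and C: "closedin (prod_topology euclidean P) C"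
  shows "baire_property (fst ` C)"
proof (cases "topspace P = {}")
  case True
  then have "C = {}"
    using closedin_subset[OF C] by auto
  then show ?thesis
    unfolding baire_property_def by (intro exI[of _ "{}"]) auto
next
  case False
  obtain M m where Mm: "Metric_space M m" "Metric_space.mcomplete M m" "P = Metric_space.mtopology M m"
    using P unfolding polish_topology_def completely_metrizable_space_def by blast
  interpret Metric_space M m
    by (rule Mm(1))
  obtain p where p: "\<And>i::nat. p i \<in> M" "\<And>x e. x \<in> M \<Longrightarrow> e > 0 \<Longrightarrow> \<exists>i. m (p i) x < e"
    using dense_sequence False P Mm(3) unfolding polish_topology_def by auto
  \<comment> \<open>index sequences grow at the front, so that \<open>length s\<close> is the level of the next piece\<close>
  define Q where "Q = rec_list M (\<lambda>n s Qs. Qs \<inter> mball (p n) ((1/2) ^ length s))"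
  have Q_simps: "Q [] = M" "\<And>n s. Q (n # s) = Q s \<inter> mball (p n) ((1/2) ^ length s)"
    by (simp_all add: Q_def)
  define A where "A s = {x. \<exists>q\<in>Q s. (x, q) \<in> C}" for s
  have CM: "q \<in> M" if "(x, q) \<in> C" for x q
    using closedin_subset[OF C] that Mm(3) by auto
  have A_Nil: "A [] = fst ` C"
    using CM by (force simp: A_def Q_simps)
  have A_Cons: "A s = (\<Union>n. A (n # s))" for s
  proof -
    have "\<exists>n. q \<in> Q (n # s)" if q: "q \<in> Q s" "(x, q) \<in> C" for x q
      using p(2)[of q "(1/2) ^ length s"] CM[OF q(2)] q(1) p(1) by (auto simp: Q_simps)
    then show ?thesis
      by (fastforce simp: A_def Q_simps(2))
  qed
  define E where "E = (\<Union>s. category_hull (A s) - (\<Union>n. category_hull (A (n # s))))"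
  have "meager E"
    unfolding E_def by (intro meager_UN category_hull_Union A_Cons) auto
  have main: "category_hull (A []) - E \<subseteq> A []"
  proof
    fix x assume x: "x \<in> category_hull (A []) - E"
    have "\<exists>s. \<forall>k. (x \<in> category_hull (A (s k)) \<and> length (s k) = k) \<and> (\<exists>n. s (Suc k) = n # s k)"
    proof (rule dependent_nat_choice)
      show "\<exists>s. x \<in> category_hull (A s) \<and> length s = 0"
        using x by auto
      show "\<exists>t. (x \<in> category_hull (A t) \<and> length t = Suc k) \<and> (\<exists>n. t = n # s)"
        if s: "x \<in> category_hull (A s) \<and> length s = k" for s k
      proof -
        obtain n where "x \<in> category_hull (A (n # s))"
          using s x unfolding E_def by blast
        then show ?thesis
          using s by (intro exI[of _ "n # s"]) auto
      qed
    qed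
    then obtain s where s: "\<And>k. x \<in> category_hull (A (s k))" "\<And>k. length (s k) = k"
        "\<And>k. \<exists>n. s (Suc k) = n # s k"
      by blast
    have "\<exists>y q. dist x y < 1 / Suc k \<and> q \<in> Q (s k) \<and> (y, q) \<in> C" for k
    proof -
      have "\<not> meager (A (s k) \<inter> ball x (1 / Suc k))"
        using s(1)[of k] unfolding category_hull_def by auto
      then have "A (s k) \<inter> ball x (1 / Suc k) \<noteq> {}"
        by auto
      then show ?thesis
        by (auto simp: A_def)
    qed
    then obtain y q where yq: "\<And>k. dist x (y k) < 1 / Suc k" "\<And>k. q k \<in> Q (s k)" "\<And>k. (y k, q k) \<in> C"
      by metis
    have anti: "Q (s j) \<subseteq> Q (s k)" if "k \<le> j" for j k
    proof (rule lift_Suc_antimono_le[of "\<lambda>i. Q (s i)", OF _ that])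
      show "Q (s (Suc i)) \<subseteq> Q (s i)" for i
        using s(3)[of i] by (auto simp: Q_simps)
    qed
    have "MCauchy q"
      unfolding MCauchy_def
    proof (intro conjI allI impI)
      show "range q \<subseteq> M"
        using CM yq(3) by blast
      fix e :: real assume "e > 0"
      then obtain k where k: "(1/2) ^ k < e / 2"
        using real_arch_pow_inv[of "e/2" "1/2"] by auto
      obtain n where n: "s (Suc k) = n # s k"
        using s(3) by blast
      have near: "m (p n) (q j) < e / 2" if "Suc k \<le> j" for j
        using anti[OF that] yq(2)[of j] k n by (auto simp: Q_simps s(2))
      have "m (q i) (q j) < e" if ij: "Suc k \<le> i" "Suc k \<le> j" for i j
        using near[OF ij(1)] near[OF ij(2)] triangle[of "q i" "p n" "q j"] commute[of "q i" "p n"] p(1) CM yq(3)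
        by fastforce
      then show "\<exists>N. \<forall>n n'. N \<le> n \<longrightarrow> N \<le> n' \<longrightarrow> m (q n) (q n') < e"
        by blast
    qed
    then obtain r where r: "limitin mtopology q r sequentially"
      using Mm(2) unfolding mcomplete_def by blast
    have "y \<longlonglongrightarrow> x"
    proof (rule metric_LIMSEQ_I)
      fix e :: real assume "e > 0"
      then obtain N where N: "1 / Suc N < e"
        using nat_approx_posE by blast
      have "dist (y k) x < e" if "N \<le> k" for k
      proof -
        have "1 / Suc k \<le> (1 / Suc N :: real)"
          using that by (simp add: frac_le)
        then show ?thesis
          using yq(1)[of k] N by (simp add: dist_commute)
      qed
      then show "\<exists>N. \<forall>n\<ge>N. dist (y n) x < e"
        by blast
    qed
    then have "limitin (prod_topology euclidean P) (\<lambda>k. (y k, q k)) (x, r) sequentially"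
      using r by (simp add: limitin_pairwise o_def Mm(3))
    then have "(x, r) \<in> C"
      by (rule limitin_closedin[OF _ C]) (use yq(3) in auto)
    then show "x \<in> A []"
      by (force simp: A_Nil)
  qed
  let ?U = "interior (category_hull (A []))"
  have "(A [] - ?U) \<union> (?U - A []) \<subseteq>
      (A [] - category_hull (A [])) \<union> (category_hull (A []) - ?U) \<union> E"
    using main interior_subset by blast
  then have "meager ((A [] - ?U) \<union> (?U - A []))"
    using \<open>meager E\<close> meager_subset meager_Un meager_minus_category_hull
      meager_closed_minus_interior[OF closed_category_hull] by metis
  then show ?thesis
    unfolding baire_property_def A_Nil[symmetric] by blast
qed

section \<open>Borel sets as projections of closed sets\<close>

lemma space_borel_of [simp]: "space (borel_of T) = topspace T"
  by (simp add: borel_of_def space_measure_of_conv)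

lemma sets_borel_of: "sets (borel_of T) = sigma_sets (topspace T) {U. openin T U}"
  unfolding borel_of_def by (intro sets_measure_of) (auto dest: openin_subset)

lemma openin_sets_borel_of: "openin T U \<Longrightarrow> U \<in> sets (borel_of T)"
  by (simp add: sets_borel_of)

lemma measurable_into_borel_of:
  assumes "\<And>x. x \<in> space M \<Longrightarrow> f x \<in> topspace T"
    and "\<And>U. openin T U \<Longrightarrow> f -` U \<inter> space M \<in> sets M"
  shows "f \<in> M \<rightarrow>\<^sub>M borel_of T"
  unfolding borel_of_def
  by (rule measurable_measure_of) (use assms in \<open>auto dest: openin_subset\<close>)

lemma continuous_map_measurable:
  assumes "continuous_map S T f"
  shows "f \<in> borel_of S \<rightarrow>\<^sub>M borel_of T"
proof (rule measurable_into_borel_of)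
  show "f x \<in> topspace T" if "x \<in> space (borel_of S)" for x
    using assms that by (auto simp: continuous_map_def)
  show "f -` U \<inter> space (borel_of S) \<in> sets (borel_of S)" if "openin T U" for U
  proof -
    have "f -` U \<inter> space (borel_of S) = {x \<in> topspace S. f x \<in> U}"
      by auto
    then show ?thesis
      using assms that by (simp add: continuous_map_def openin_sets_borel_of)
  qed
qed

lemma continuous_map_fst_comp:
  "continuous_map Z (prod_topology X Y) f \<Longrightarrow> continuous_map Z X (\<lambda>x. fst (f x))"
  using continuous_map_fst_of[of Z X Y f] by (simp add: o_def)

lemma continuous_map_snd_comp:
  "continuous_map Z (prod_topology X Y) f \<Longrightarrow> continuous_map Z Y (\<lambda>x. snd (f x))"
  using continuous_map_snd_of[of Z X Y f] by (simp add: o_def)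

lemma borel_of_euclidean: "sets (borel_of euclidean) = sets borel"
  by (simp add: sets_borel_of borel_def)

text \<open>
  Analytic sets, as projections of closed sets along the Baire space. In this form they contain
  the Borel sets of any metrizable space, complete or not.
\<close>

definition suslin_in :: "'a topology \<Rightarrow> 'a set \<Rightarrow> bool" where
  "suslin_in Z A \<longleftrightarrow>
    (\<exists>C. closedin (prod_topology Z (euclidean :: (nat \<Rightarrow> nat) topology)) C \<and> A = fst ` C)"

lemma suslin_in_closedin: "closedin Z A \<Longrightarrow> suslin_in Z A"
  unfolding suslin_in_def by (intro exI[of _ "A \<times> UNIV"]) (auto simp: closedin_prod_Times_iff)

lemma continuous_map_reindex:
  "continuous_map (prod_topology Z (euclidean :: (nat \<Rightarrow> nat) topology))
     (prod_topology Z (euclidean :: (nat \<Rightarrow> nat) topology)) (\<lambda>(z, a). (z, \<lambda>k. a (r k)))"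
proof -
  have "continuous_map (prod_topology Z euclidean) euclidean (\<lambda>p. \<lambda>k. (snd p :: nat \<Rightarrow> nat) (r k))"
  proof -
    have "continuous_on UNIV (\<lambda>a :: nat \<Rightarrow> nat. \<lambda>k. a (r k))"
      by (intro continuous_on_coordinatewise_then_product) (auto intro: continuous_on_product_coordinates)
    then show ?thesis
      using continuous_map_compose[OF continuous_map_snd, of euclidean euclidean "\<lambda>a. \<lambda>k. a (r k)" Z]
      by (simp add: o_def)
  qed
  then show ?thesis
    by (simp add: case_prod_unfold continuous_map_pairwise o_def continuous_map_fst)
qed

text \<open>
  A point of the Baire space codes its tail, or even a sequence of points of the Baire space;
  decoding is a reindexing and hence continuous.
\<close>

lemma closedin_reindex:
  assumes "closedin (prod_topology Z (euclidean :: (nat \<Rightarrow> nat) topology)) C"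
  shows "closedin (prod_topology Z (euclidean :: (nat \<Rightarrow> nat) topology))
     {(z, a). (z, \<lambda>k. a (r k)) \<in> C}"
proof -
  have "{(z, a). (z, \<lambda>k. a (r k)) \<in> C} =
      {p \<in> topspace (prod_topology Z (euclidean :: (nat \<Rightarrow> nat) topology)).
         (case p of (z, a) \<Rightarrow> (z, \<lambda>k. a (r k))) \<in> C}"
    using closedin_subset[OF assms] by auto
  then show ?thesis
    by (simp only: closedin_continuous_map_preimage[OF continuous_map_reindex assms])
qed

text \<open>
  The first entry of the witness chooses the set, its tail is a witness for that set.
\<close>

lemma suslin_in_UN:
  assumes "\<And>n::nat. suslin_in Z (A n)"
  shows "suslin_in Z (\<Union>n. A n)"
proof -
  let ?P = "prod_topology Z (euclidean :: (nat \<Rightarrow> nat) topology)"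
  obtain C where C: "\<And>n. closedin ?P (C n)" "\<And>n. A n = fst ` C n"
    using assms unfolding suslin_in_def by metis
  define D where
    "D = (\<Inter>n. topspace Z \<times> {a. a 0 \<noteq> n} \<union> {(z, a). (z, \<lambda>k. a (Suc k)) \<in> C n})"
  have "closed {a :: nat \<Rightarrow> nat. a 0 \<noteq> n}" for n
    using open_vimage[of "{n}" "\<lambda>a :: nat \<Rightarrow> nat. a 0"]
    by (intro closed_Collect_neg) (simp add: vimage_def open_discrete)
  then have "closedin ?P D"
    unfolding D_def
    by (intro closedin_INT closedin_Un closedin_reindex C) (auto simp: closedin_prod_Times_iff)
  moreover have "(\<Union>n. A n) = fst ` D"
  proof (intro equalityI subsetI)
    fix z assume "z \<in> (\<Union>n. A n)"
    then obtain n a where na: "(z, a) \<in> C n"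
      using C(2) by auto
    then have "(z, case_nat n a) \<in> D"
      using closedin_subset[OF C(1)[of n]] by (auto simp: D_def)
    then show "z \<in> fst ` D"
      by force
  next
    fix z assume "z \<in> fst ` D"
    then obtain a where a: "(z, a) \<in> D"
      by auto
    then have "(z, \<lambda>k. a (Suc k)) \<in> C (a 0)"
      by (auto simp: D_def)
    then show "z \<in> (\<Union>n. A n)"
      using C(2) by force
  qed
  ultimately show ?thesis
    unfolding suslin_in_def by blast
qed

text \<open>
  One witness codes witnesses for all the sets.
\<close>

lemma suslin_in_INT:
  assumes "\<And>n::nat. suslin_in Z (A n)"
  shows "suslin_in Z (\<Inter>n. A n)"
proof -
  let ?P = "prod_topology Z (euclidean :: (nat \<Rightarrow> nat) topology)"
  obtain C where C: "\<And>n. closedin ?P (C n)" "\<And>n. A n = fst ` C n"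
    using assms unfolding suslin_in_def by metis
  define D where
    "D = (\<Inter>n. {(z, a). (z, \<lambda>k. a (prod_encode (n, k))) \<in> C n})"
  have "closedin ?P D"
    unfolding D_def by (intro closedin_INT closedin_reindex C) auto
  moreover have "(\<Inter>n. A n) = fst ` D"
  proof (intro equalityI subsetI)
    fix z assume "z \<in> (\<Inter>n. A n)"
    then have "\<forall>n. \<exists>a. (z, a) \<in> C n"
      using C(2) by force
    then obtain b where b: "\<And>n. (z, b n) \<in> C n"
      by metis
    have "(z, \<lambda>m. b (fst (prod_decode m)) (snd (prod_decode m))) \<in> D"
      using b by (simp add: D_def)
    then show "z \<in> fst ` D"
      by force
  next
    fix z assume "z \<in> fst ` D"
    then show "z \<in> (\<Inter>n. A n)"
      using C(2) by (force simp: D_def)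
  qed
  ultimately show ?thesis
    unfolding suslin_in_def by blast
qed

text \<open>
  The sets that are analytic together with their complements form a \<open>\<sigma>\<close>-algebra. It contains the
  open sets, because these are countable unions of closed sets.
\<close>

theorem borel_imp_suslin_in:
  assumes "metrizable_space Z" "B \<in> sets (borel_of Z)"
  shows "suslin_in Z B"
proof -
  have op: "suslin_in Z U" if "openin Z U" for U
  proof -
    have "fsigma_in Z U"
      using assms(1) that open_imp_fsigma_in by blast
    then obtain F where "\<And>n::nat. closedin Z (F n)" "(\<Union>n. F n) = U"
      unfolding fsigma_in_ascending by blast
    then show ?thesis
      using suslin_in_UN suslin_in_closedin by metis
  qed
  have "B \<in> sigma_sets (topspace Z) {U. openin Z U}"
    using assms(2) by (simp add: sets_borel_of)
  then have "B \<subseteq> topspace Z \<and> suslin_in Z B \<and> suslin_in Z (topspace Z - B)"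
  proof induction
    case (Basic U)
    then have "openin Z U" "closedin Z (topspace Z - U)"
      by auto
    then show ?case
      using op suslin_in_closedin openin_subset by blast
  next
    case Empty
    then show ?case
      by (simp add: suslin_in_closedin)
  next
    case (Compl A)
    then show ?case
      by (simp add: double_diff)
  next
    case (Union A)
    have "topspace Z - (\<Union>i. A i) = (\<Inter>i. topspace Z - A i)"
      by auto
    moreover have "suslin_in Z (\<Inter>i. topspace Z - A i)"
      using Union.IH by (intro suslin_in_INT) blast
    ultimately show ?case
      using Union.IH by (auto intro: suslin_in_UN)
  qed
  then show ?thesis
    by blast
qed

lemma polish_prod_topology:
  assumes "polish_topology S" "polish_topology T"
  shows "polish_topology (prod_topology S T)"
proof -
  obtain C where C: "countable C" "C \<subseteq> topspace S" "S closure_of C = topspace S"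
    using assms(1) unfolding polish_topology_def separable_space_def by blast
  obtain D where D: "countable D" "D \<subseteq> topspace T" "T closure_of D = topspace T"
    using assms(2) unfolding polish_topology_def separable_space_def by blast
  have "separable_space (prod_topology S T)"
    unfolding separable_space_def
    by (intro exI[of _ "C \<times> D"]) (use C D in \<open>auto simp: closure_of_Times\<close>)
  then show ?thesis
    using assms by (simp add: polish_topology_def completely_metrizable_space_prod_topology)
qed

lemma polish_imp_second_countable:
  assumes "polish_topology T"
  shows "second_countable T"
proof (cases "topspace T = {}")
  case True
  then show ?thesis
    unfolding second_countable_def by (intro exI[of _ "{}"]) (auto dest: openin_subset)
next
  case False
  obtain M m where Mm: "Metric_space M m" "T = Metric_space.mtopology M m"
    using assms unfolding polish_topology_def completely_metrizable_space_def by blast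
  interpret Metric_space M m
    by (rule Mm(1))
  obtain p where p: "\<And>i::nat. p i \<in> M" "\<And>x e. x \<in> M \<Longrightarrow> e > 0 \<Longrightarrow> \<exists>i. m (p i) x < e"
    using dense_sequence False assms Mm(2) unfolding polish_topology_def by auto
  let ?B = "(\<lambda>(i, n). mball (p i) (1 / Suc n)) ` UNIV"
  have "\<exists>V\<in>?B. x \<in> V \<and> V \<subseteq> U" if U: "openin mtopology U" "x \<in> U" for U x
  proof -
    obtain r where r: "r > 0" "mball x r \<subseteq> U"
      using U unfolding openin_mtopology by blast
    have x: "x \<in> M"
      using U openin_subset by force
    obtain n where n: "1 / Suc n < r / 2"
      using nat_approx_posE[of "r/2"] r by auto
    obtain i where i: "m (p i) x < 1 / Suc n"
      using p(2)[OF x, of "1 / Suc n"] by auto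
    have "mball (p i) (1 / Suc n) \<subseteq> mball x r"
    proof
      fix y assume y: "y \<in> mball (p i) (1 / Suc n)"
      then have "m x y \<le> m (p i) x + m (p i) y"
        using triangle[of x "p i" y] x p(1) commute[of x "p i"] by auto
      then show "y \<in> mball x r"
        using y i n x by auto
    qed
    then show ?thesis
      using r(2) i p(1) x by (intro bexI[of _ "mball (p i) (1 / Suc n)"]) auto
  qed
  then show ?thesis
    unfolding second_countable_def Mm(2) by (intro exI[of _ ?B]) auto
qed

lemma second_countable_euclidean: "second_countable (euclidean :: 'a::second_countable_topology topology)"
proof -
  obtain B :: "'a set set" where B: "countable B" "topological_basis B"
    using ex_countable_basis by blast
  have "\<exists>V\<in>B. x \<in> V \<and> V \<subseteq> U" if "open U" "x \<in> U" for U x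
    using topological_basisE[OF B(2) that] by metis
  then show ?thesis
    unfolding second_countable_def
    by (intro exI[of _ B]) (auto simp: B(1) topological_basis_open[OF B(2)])
qed

lemma polish_euclidean: "polish_topology (euclidean :: 'a::polish_space topology)"
  by (simp add: polish_topology_def completely_metrizable_space_euclidean
      second_countable_imp_separable_space second_countable_euclidean)

lemma polish_baire_space: "polish_topology (euclidean :: (nat \<Rightarrow> nat) topology)"
proof -
  have "completely_metrizable_space (euclidean :: nat topology)"
    by (metis completely_metrizable_space_discrete_topology discrete_topology_unique open_discrete
        open_openin topspace_euclidean)
  then have "completely_metrizable_space (product_topology (\<lambda>_. euclidean :: nat topology) (UNIV :: nat set))"
    by (simp add: completely_metrizable_space_product_topology)
  then show ?thesis
    by (simp add: polish_topology_def euclidean_product_topology second_countable_imp_separable_space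
        second_countable_euclidean)
qed

lemma baire_property_borel:
  fixes A :: "'a::{metric_space, second_countable_topology} set"
  assumes "A \<in> sets borel"
  shows "baire_property A"
proof -
  have "suslin_in euclidean A"
    using assms by (intro borel_imp_suslin_in) (auto simp: metrizable_space_euclidean borel_of_euclidean)
  then show ?thesis
    unfolding suslin_in_def using baire_property_projection[OF polish_baire_space] by blast
qed

theorem baire_property_borel_projection:
  fixes B :: "('a::{metric_space, second_countable_topology} \<times> 'z) set"
  assumes Z: "polish_topology Z" and B: "B \<in> sets (borel_of (prod_topology euclidean Z))"
  shows "baire_property (fst ` B)"
proof -
  let ?N = "euclidean :: (nat \<Rightarrow> nat) topology"
  have "metrizable_space (prod_topology (euclidean :: 'a topology) Z)"
    using Z by (simp add: polish_topology_def metrizable_space_prod_topology metrizable_space_euclidean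
        completely_metrizable_imp_metrizable_space)
  from borel_imp_suslin_in[OF this B] obtain C
    where C: "closedin (prod_topology (prod_topology euclidean Z) ?N) C" "B = fst ` C"
    unfolding suslin_in_def by blast
  define D where "D = {p \<in> topspace (prod_topology (euclidean :: 'a topology) (prod_topology Z ?N)).
      (case p of (x, z, a) \<Rightarrow> ((x, z), a)) \<in> C}"
  have "closedin (prod_topology euclidean (prod_topology Z ?N)) D"
    unfolding D_def
    by (rule closedin_continuous_map_preimage[OF _ C(1)])
       (auto simp: case_prod_unfold intro!: continuous_map_pairedI continuous_map_fst_comp
          continuous_map_snd_comp continuous_map_id[unfolded id_def])
  moreover have "fst ` B = fst ` D"
    using closedin_subset[OF C(1)] by (force simp: C(2) D_def)
  moreover have "polish_topology (prod_topology Z ?N)"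
    by (intro polish_prod_topology Z polish_baire_space)
  ultimately show ?thesis
    using baire_property_projection by metis
qed

section \<open>Category on products\<close>

text \<open>
  One direction of the theorem of Kuratowski and Ulam. A dense open set \<open>W\<close> has dense sections over
  all \<open>x\<close> that lie in the projections of \<open>W \<inter> (UNIV \<times> V)\<close> for all basic open \<open>V\<close>, and these
  countably many projections are dense and open.
\<close>

lemma meager_sections:
  fixes M :: "('a::topological_space \<times> 'b::second_countable_topology) set"
  assumes "meager M"
  shows "meager {x. \<not> meager {z. (x, z) \<in> M}}"
proof -
  obtain N :: "nat \<Rightarrow> ('a \<times> 'b) set"
    where N: "\<And>i. closed (N i)" "\<And>i. interior (N i) = {}" "M \<subseteq> (\<Union>i. N i)"
    using assms unfolding meager_def by blast
  obtain B :: "'b set set" where B: "countable B" "topological_basis B"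
    using ex_countable_basis by blast
  define P where "P i V = fst ` (- N i \<inter> (UNIV \<times> V))" for i V
  have P_meager: "meager (- P i V)" if V: "open V" "V \<noteq> {}" for i V
  proof (rule meager_nowhere_dense)
    show "closed (- P i V)"
      unfolding P_def using N(1) V(1) by (intro closed_Compl open_image_fst open_Int open_Times open_Compl) auto
    show "interior (- P i V) = {}"
    proof (rule ccontr)
      assume "interior (- P i V) \<noteq> {}"
      then have "interior (- P i V) \<times> V \<noteq> {}" "open (interior (- P i V) \<times> V)"
        using V by (auto intro: open_Times)
      moreover have "interior (- P i V) \<times> V \<subseteq> N i"
        using interior_subset[of "- P i V"] unfolding P_def by force
      ultimately have "interior (N i) \<noteq> {}"
        using interior_maximal by blast
      then show False
        using N(2) by simp
    qed
  qed
  have "{x. \<not> meager {z. (x, z) \<in> M}} \<subseteq> (\<Union>i. \<Union>V\<in>B - {{}}. - P i V)"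
  proof (rule ccontr)
    assume "\<not> ?thesis"
    then obtain x where x: "\<not> meager {z. (x, z) \<in> M}" "\<And>i V. V \<in> B \<Longrightarrow> V \<noteq> {} \<Longrightarrow> x \<in> P i V"
      by blast
    have "closed {z. (x, z) \<in> N i}" for i
    proof -
      have "closed (Pair x -` N i)"
        by (intro closed_vimage N continuous_on_Pair continuous_on_const continuous_on_id)
      then show ?thesis
        by (simp add: vimage_def)
    qed
    moreover have "interior {z. (x, z) \<in> N i} = {}" for i
    proof (rule ccontr)
      assume "interior {z. (x, z) \<in> N i} \<noteq> {}"
      then obtain y where y: "y \<in> interior {z. (x, z) \<in> N i}"
        by auto
      obtain V where V: "V \<in> B" "y \<in> V" "V \<subseteq> interior {z. (x, z) \<in> N i}"
        using topological_basisE[OF B(2) open_interior y] by metis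
      then have "x \<in> P i V"
        using x(2) by blast
      then show False
        using V(3) interior_subset[of "{z. (x, z) \<in> N i}"] unfolding P_def by auto
    qed
    ultimately have "meager {z. (x, z) \<in> M}"
      unfolding meager_def using N(3) by (intro exI[of _ "\<lambda>i. {z. (x, z) \<in> N i}"]) auto
    with x(1) show False
      by simp
  qed
  moreover have "meager (\<Union>i. \<Union>V\<in>B - {{}}. - P i V)"
    using B P_meager by (intro meager_UN_nat meager_UN) (auto simp: topological_basis_open)
  ultimately show ?thesis
    using meager_subset by blast
qed

lemma meager_vimage:
  assumes "continuous_on UNIV f" "\<And>U. open U \<Longrightarrow> open (f ` U)" "meager M"
  shows "meager (f -` M)"
proof -
  obtain N where N: "\<And>i::nat. closed (N i)" "\<And>i. interior (N i) = {}" "M \<subseteq> (\<Union>i. N i)"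
    using assms(3) unfolding meager_def by blast
  have "interior (f -` N i) = {}" for i
  proof -
    have "f ` interior (f -` N i) \<subseteq> interior (N i)"
      using interior_subset[of "f -` N i"] assms(2) by (intro interior_maximal) auto
    then show ?thesis
      using N(2) by auto
  qed
  moreover have "closed (f -` N i)" for i
    using N(1) assms(1) by (simp add: closed_vimage)
  moreover have "f -` M \<subseteq> (\<Union>i. f -` N i)"
    using N(3) by blast
  ultimately show ?thesis
    unfolding meager_def by (intro exI[of _ "\<lambda>i. f -` N i"]) simp
qed

lemma continuous_on_fun_upd:
  "continuous_on S x \<Longrightarrow> continuous_on S z \<Longrightarrow> continuous_on S (\<lambda>p. (x p)(n := z p))"
proof (rule continuous_on_coordinatewise_then_product)
  show "continuous_on S (\<lambda>p. ((x p)(n := z p)) i)"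
    if "continuous_on S x" "continuous_on S z" for i
    using that by (cases "i = n") (auto intro: continuous_on_product_then_coordinatewise)
qed

text \<open>
  Through each of its values this map has the continuous section \<open>y \<mapsto> (y(n := x n), y n)\<close>.
\<close>

lemma open_map_fun_upd:
  fixes U :: "(('i \<Rightarrow> 'b::topological_space) \<times> 'b) set"
  assumes "open U"
  shows "open ((\<lambda>(x, z). x(n := z)) ` U)"
proof -
  have "\<exists>T. open T \<and> x(n := z) \<in> T \<and> T \<subseteq> (\<lambda>(x, z). x(n := z)) ` U" if xz: "(x, z) \<in> U" for x z
  proof (intro exI[of _ "(\<lambda>y. (y(n := x n), y n)) -` U"] conjI)
    show "open ((\<lambda>y. (y(n := x n), y n)) -` U)"
      by (intro open_vimage assms continuous_on_Pair continuous_on_fun_upd continuous_on_id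
          continuous_on_const continuous_on_product_coordinates)
    show "x(n := z) \<in> (\<lambda>y. (y(n := x n), y n)) -` U"
      using xz by simp
    show "(\<lambda>y. (y(n := x n), y n)) -` U \<subseteq> (\<lambda>(x, z). x(n := z)) ` U"
    proof
      fix y assume "y \<in> (\<lambda>y. (y(n := x n), y n)) -` U"
      then show "y \<in> (\<lambda>(x, z). x(n := z)) ` U"
        by (intro image_eqI[of _ _ "(y(n := x n), y n)"]) auto
    qed
  qed
  then show ?thesis
    by (subst open_subopen) auto
qed

text \<open>
  The theorem of Kuratowski and Ulam for the lines in direction \<open>n\<close>: the set is pulled back to
  pairs of a line, given by any of its points, and a position on it.
\<close>

lemma meager_lines:
  fixes M :: "('i \<Rightarrow> 'b::second_countable_topology) set"
  assumes "meager M"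
  shows "meager {x. \<not> meager {z. x(n := z) \<in> M}}"
proof -
  have "meager ((\<lambda>(x, z). x(n := z)) -` M)"
    by (rule meager_vimage[OF _ open_map_fun_upd assms])
       (auto simp: case_prod_unfold intro!: continuous_on_fun_upd continuous_on_fst continuous_on_snd continuous_on_id)
  from meager_sections[OF this] show ?thesis
    by simp
qed

text \<open>
  Removing the points with too many bad neighbours in some coordinate direction may create new bad
  neighbours. As meager sets are closed under countable unions, it suffices to repeat the removal
  \<open>\<omega>\<close> times.
\<close>

lemma comeager_hereditary_core:
  fixes D0 :: "('i::countable \<Rightarrow> 'b::second_countable_topology) set"
  assumes "meager (- D0)"
  obtains D where "D \<subseteq> D0" "meager (- D)" "\<And>x n. x \<in> D \<Longrightarrow> meager {z. x(n := z) \<notin> D}"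
proof -
  define E where "E = rec_nat D0 (\<lambda>_ S. S \<inter> {x. \<forall>n. meager {z. x(n := z) \<notin> S}})"
  have E: "E 0 = D0" "\<And>i. E (Suc i) = E i \<inter> {x. \<forall>n. meager {z. x(n := z) \<notin> E i}}"
    by (simp_all add: E_def)
  have mE: "meager (- E i)" for i
  proof (induction i)
    case 0
    then show ?case
      using assms by (simp add: E)
  next
    case (Suc i)
    have "- E (Suc i) = - E i \<union> (\<Union>n. {x. \<not> meager {z. x(n := z) \<in> - E i}})"
      by (auto simp: E)
    then show ?case
      using Suc meager_lines[OF Suc] by (auto intro!: meager_Un meager_UN)
  qed
  show ?thesis
  proof
    show "(\<Inter>i. E i) \<subseteq> D0"
      using E(1) by blast
    have "- (\<Inter>i. E i) = (\<Union>i. - E i)"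
      by auto
    then show "meager (- (\<Inter>i. E i))"
      using mE by (simp add: meager_UN_nat)
    show "meager {z. x(n := z) \<notin> (\<Inter>i. E i)}" if "x \<in> (\<Inter>i. E i)" for x n
    proof -
      have "meager {z. x(n := z) \<notin> E i}" for i
        using that E(2)[of i] by blast
      moreover have "{z. x(n := z) \<notin> (\<Inter>i. E i)} = (\<Union>i. {z. x(n := z) \<notin> E i})"
        by auto
      ultimately show ?thesis
        by (simp add: meager_UN_nat)
    qed
  qed
qed

text \<open>
  The preimage of each basic open set differs from an open set by a meager set; \<open>F\<close> is continuous on
  the complement of the union of these countably many errors.
\<close>

lemma measurable_continuous_on_comeager:
  fixes F :: "'a::{metric_space, second_countable_topology} \<Rightarrow> 'x"
  assumes F: "F \<in> borel \<rightarrow>\<^sub>M borel_of \<tau>" and \<tau>: "second_countable \<tau>"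
  obtains U :: "nat \<Rightarrow> 'a set" where "\<And>i. open (U i)" "meager (- (\<Inter>i. U i))"
    "continuous_map (subtopology euclidean (\<Inter>i. U i)) \<tau> F"
proof -
  obtain B where B0: "countable B" "\<forall>V\<in>B. openin \<tau> V"
    "\<forall>U x. openin \<tau> U \<and> x \<in> U \<longrightarrow> (\<exists>V\<in>B. x \<in> V \<and> V \<subseteq> U)"
    using \<tau> unfolding second_countable_def by (elim exE conjE)
  then have B: "countable B" "\<And>V. V \<in> B \<Longrightarrow> openin \<tau> V"
    "\<And>U x. openin \<tau> U \<Longrightarrow> x \<in> U \<Longrightarrow> \<exists>V\<in>B. x \<in> V \<and> V \<subseteq> U"
    by simp_all
  have "\<exists>W. open W \<and> meager ((F -` V - W) \<union> (W - F -` V))" if "V \<in> B" for V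
  proof -
    have "F -` V \<in> sets borel"
      using measurable_sets[OF F openin_sets_borel_of[OF B(2)[OF that]]] by simp
    then show ?thesis
      using baire_property_borel unfolding baire_property_def by blast
  qed
  then obtain W where W: "\<And>V. V \<in> B \<Longrightarrow> open (W V)"
    "\<And>V. V \<in> B \<Longrightarrow> meager ((F -` V - W V) \<union> (W V - F -` V))"
    by metis
  have "meager (\<Union>V\<in>B. (F -` V - W V) \<union> (W V - F -` V))"
    using B(1) W(2) by (intro meager_UN)
  then obtain N :: "nat \<Rightarrow> 'a set" where N: "\<And>i. closed (N i)" "\<And>i. interior (N i) = {}"
    "(\<Union>V\<in>B. (F -` V - W V) \<union> (W V - F -` V)) \<subseteq> (\<Union>i. N i)"
    by (rule meagerE) blast
  let ?C = "\<Inter>i. - N i"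
  show ?thesis
  proof
    show "open (- N i)" for i
      using N(1) by auto
    show "meager (- ?C)"
      unfolding meager_def by (intro exI[of _ N]) (use N in auto)
    have same: "F x \<in> V \<longleftrightarrow> x \<in> W V" if "V \<in> B" "x \<in> ?C" for V x
      using that N(3) by blast
    show "continuous_map (subtopology euclidean ?C) \<tau> F"
      unfolding continuous_map_def
    proof (intro conjI allI impI)
      show "F \<in> topspace (subtopology euclidean ?C) \<rightarrow> topspace \<tau>"
        using measurable_space[OF F] by auto
      fix O' assume O': "openin \<tau> O'"
      have "{x \<in> ?C. F x \<in> O'} = ?C \<inter> (\<Union>V\<in>{V\<in>B. V \<subseteq> O'}. W V)"
      proof (intro equalityI subsetI)
        fix x assume x: "x \<in> {x \<in> ?C. F x \<in> O'}"
        then obtain V where "V \<in> B" "F x \<in> V" "V \<subseteq> O'"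
          using B(3)[OF O'] by blast
        then show "x \<in> ?C \<inter> (\<Union>V\<in>{V\<in>B. V \<subseteq> O'}. W V)"
          using x same by blast
      qed (use same in blast)
      then show "openin (subtopology euclidean ?C) {x \<in> topspace (subtopology euclidean ?C). F x \<in> O'}"
        using W(1) by (auto simp: openin_open intro!: exI[of _ "\<Union>V\<in>{V\<in>B. V \<subseteq> O'}. W V"])
    qed
  qed
qed

text \<open>
  Let \<open>S\<close> relate a point to positions on the line through it in direction \<open>n\<close>. The hypothesis
  \<open>pigeonhole\<close> says on each single line that most points in \<open>U\<close> are related to many positions
  in \<open>U\<close>. Without definability of \<open>S\<close> this would say nothing about most points of the whole
  space. But up to meager sets \<open>S\<close> is an open set \<open>W\<close>, so that the set \<open>bad U\<close> of counterexamples is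
  also the intersection of an open and a closed set up to meager sets. If it were nonmeager, it would contain
  most of an open box, hence most of a segment of some line, which contradicts the hypothesis.
\<close>

theorem comeager_directional_density:
  fixes S :: "(('i::countable \<Rightarrow> 'b::polish_space) \<times> 'b) set"
  assumes S: "baire_property S"
    and pigeonhole: "\<And>x U. open U \<Longrightarrow> meager {z \<in> U. meager {z' \<in> U. (x(n := z), z') \<in> S}}"
  shows "meager {x. \<exists>U. open U \<and> x n \<in> U \<and> meager {z \<in> U. (x, z) \<in> S}}"
proof -
  obtain W where W: "open W" "meager ((S - W) \<union> (W - S))"
    using S unfolding baire_property_def by blast
  obtain B :: "'b set set" where B: "countable B" "topological_basis B"
    using ex_countable_basis by blast
  define E where "E = {x. \<not> meager {z. (x, z) \<in> (S - W) \<union> (W - S)}}"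
  have E: "meager E"
    unfolding E_def by (rule meager_sections[OF W(2)])
  define bad where "bad U = {x. x n \<in> U \<and> meager {z \<in> U. (x, z) \<in> S}}" for U
  have bad_iff: "x \<in> bad U \<longleftrightarrow> x n \<in> U \<and> {z \<in> U. (x, z) \<in> W} = {}" if U: "open U" and x: "x \<notin> E" for U x
  proof -
    let ?D = "{z. (x, z) \<in> (S - W) \<union> (W - S)}"
    have D: "meager ?D"
      using x by (simp add: E_def)
    have "open (Pair x -` W \<inter> U)"
      using W(1) U by (intro open_Int open_vimage continuous_on_Pair continuous_on_const continuous_on_id)
    then have "open {z \<in> U. (x, z) \<in> W}"
      by (simp add: vimage_def Int_def conj_commute)
    moreover have "meager {z \<in> U. (x, z) \<in> S} \<longleftrightarrow> meager {z \<in> U. (x, z) \<in> W}"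
    proof
      assume "meager {z \<in> U. (x, z) \<in> S}"
      then show "meager {z \<in> U. (x, z) \<in> W}"
        by (rule meager_subset[OF meager_Un[OF _ D]]) auto
    next
      assume "meager {z \<in> U. (x, z) \<in> W}"
      then show "meager {z \<in> U. (x, z) \<in> S}"
        by (rule meager_subset[OF meager_Un[OF _ D]]) auto
    qed
    ultimately show ?thesis
      using nonmeager_open[of "{z \<in> U. (x, z) \<in> W}"] meager_empty unfolding bad_def by (metis (no_types, lifting) mem_Collect_eq)
  qed
  have bad_meager: "meager (bad U)" if U: "open U" for U
  proof -
    let ?A = "{x. x n \<in> U}"
    let ?C = "- fst ` (W \<inter> (UNIV \<times> U))"
    have "open ((\<lambda>x. x n) -` U :: ('i \<Rightarrow> 'b) set)"
      using U by (intro open_vimage) auto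
    then have A: "open (?A :: ('i \<Rightarrow> 'b) set)"
      by (simp add: vimage_def)
    have C: "closed ?C"
      using W(1) U by (intro closed_Compl open_image_fst open_Int open_Times) auto
    have C_iff: "x \<in> ?C \<longleftrightarrow> {z \<in> U. (x, z) \<in> W} = {}" for x
      by force
    have bad_sub: "bad U - E \<subseteq> ?A \<inter> ?C" and sub_bad: "?A \<inter> ?C - E \<subseteq> bad U"
      using bad_iff[OF U] C_iff by blast+
    have "?A \<inter> interior ?C = {}"
    proof (rule ccontr)
      let ?V = "?A \<inter> interior ?C"
      assume ne: "?V \<noteq> {}"
      have V: "open ?V"
        using A by blast
      have "\<not> ?V \<subseteq> {x. \<not> meager {z. x(n := z) \<in> E}}"
        using nonmeager_open[OF V ne] meager_lines[OF E, of n] meager_subset by blast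
      then obtain x where x: "x \<in> ?V" "meager {z. x(n := z) \<in> E}"
        by blast
      let ?I = "{z. x(n := z) \<in> ?V}"
      have "open ((\<lambda>z. x(n := z)) -` ?V)"
        using V by (intro open_vimage continuous_on_fun_upd continuous_on_const continuous_on_id)
      then have "open ?I"
        by (simp add: vimage_def)
      moreover have "x n \<in> ?I"
        using x(1) by simp
      moreover have "?I \<subseteq> {z. x(n := z) \<in> E} \<union> {z \<in> U. meager {z' \<in> U. (x(n := z), z') \<in> S}}"
      proof
        fix z assume z: "z \<in> ?I"
        show "z \<in> {z. x(n := z) \<in> E} \<union> {z \<in> U. meager {z' \<in> U. (x(n := z), z') \<in> S}}"
        proof (cases "x(n := z) \<in> E")
          case False
          then have "x(n := z) \<in> bad U"
            using z sub_bad interior_subset[of ?C] by blast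
          then show ?thesis
            by (simp add: bad_def)
        qed simp
      qed
      ultimately show False
        using nonmeager_open[of ?I] meager_Un[OF x(2) pigeonhole[OF U, of x]] meager_subset by blast
    qed
    then have "bad U \<subseteq> E \<union> (?C - interior ?C)"
      using bad_sub by blast
    then show ?thesis
      using meager_subset[OF meager_Un[OF E meager_closed_minus_interior[OF C]]] by blast
  qed
  have "{x. \<exists>U. open U \<and> x n \<in> U \<and> meager {z \<in> U. (x, z) \<in> S}} \<subseteq> (\<Union>U\<in>B. bad U)"
  proof
    fix x assume "x \<in> {x. \<exists>U. open U \<and> x n \<in> U \<and> meager {z \<in> U. (x, z) \<in> S}}"
    then obtain U where U: "open U" "x n \<in> U" "meager {z \<in> U. (x, z) \<in> S}"
      by blast
    obtain V where V: "V \<in> B" "x n \<in> V" "V \<subseteq> U"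
      using topological_basisE[OF B(2) U(1,2)] by metis
    have "meager {z \<in> V. (x, z) \<in> S}"
      by (rule meager_subset[OF U(3)]) (use V(3) in auto)
    then show "x \<in> (\<Union>U\<in>B. bad U)"
      using V by (auto simp: bad_def)
  qed
  moreover have "meager (\<Union>U\<in>B. bad U)"
    using B bad_meager by (intro meager_UN) (auto simp: topological_basis_open)
  ultimately show ?thesis
    using meager_subset by blast
qed

section \<open>Isometric group actions and orbit pseudometrics\<close>

text \<open>
  For distances that are defined as infima, it is the strict upper bounds that are easy to handle.
\<close>

lemma pseudometric_onI:
  assumes refl: "\<And>x r::real. x \<in> S \<Longrightarrow> 0 < r \<Longrightarrow> \<rho> x x < ennreal r"
    and sym: "\<And>x y r::real. x \<in> S \<Longrightarrow> y \<in> S \<Longrightarrow> \<rho> x y < ennreal r \<Longrightarrow> \<rho> y x < ennreal r"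
    and triangle: "\<And>x y z a b::real. x \<in> S \<Longrightarrow> y \<in> S \<Longrightarrow> z \<in> S \<Longrightarrow> 0 < a \<Longrightarrow> 0 < b \<Longrightarrow>
      \<rho> x y < ennreal a \<Longrightarrow> \<rho> y z < ennreal b \<Longrightarrow> \<rho> x z < ennreal (a + b)"
  shows "pseudometric_on S \<rho>"
proof -
  have leI: "u \<le> v" if less: "\<And>r::real. v < ennreal r \<Longrightarrow> u < ennreal r" for u v :: ennreal
  proof (rule ennreal_le_epsilon)
    fix e :: real assume "v < Orderings.top" and e: "0 < e"
    then obtain c where c: "v = ennreal c" "0 \<le> c"
      by (cases v) auto
    then show "u \<le> v + ennreal e"
      using less[of "c + e"] e by (simp add: ennreal_plus ennreal_lessI less_imp_le)
  qed
  have "\<rho> x x = 0" if "x \<in> S" for x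
    using leI[of 0 "\<rho> x x"] refl[OF that] by simp
  moreover have "\<rho> x y = \<rho> y x" if "x \<in> S" "y \<in> S" for x y
    by (rule antisym; rule leI) (use that sym in blast)+
  moreover have "\<rho> x z \<le> \<rho> x y + \<rho> y z" if S: "x \<in> S" "y \<in> S" "z \<in> S" for x y z
  proof (rule ennreal_le_epsilon)
    fix e :: real assume fin: "\<rho> x y + \<rho> y z < Orderings.top" and e: "0 < e"
    obtain a where a: "\<rho> x y = ennreal a" "0 \<le> a"
      using fin by (cases "\<rho> x y") auto
    obtain b where b: "\<rho> y z = ennreal b" "0 \<le> b"
      using fin by (cases "\<rho> y z") auto
    have "\<rho> x z < ennreal ((a + e / 2) + (b + e / 2))"
      by (rule triangle[OF S]) (use a b e in \<open>auto simp: ennreal_lessI\<close>)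
    also have "(a + e / 2) + (b + e / 2) = a + b + e"
      by simp
    finally show "\<rho> x z \<le> \<rho> x y + \<rho> y z + ennreal e"
      using a b e by (simp add: ennreal_plus)
  qed
  ultimately show ?thesis
    unfolding pseudometric_on_def by blast
qed

lemma pseudometric_on_geometric_Cauchy:
  assumes \<rho>: "pseudometric_on S \<rho>" and w: "\<And>n. w n \<in> S"
    and step: "\<And>n. \<rho> (w n) (w (Suc n)) < ennreal ((1/2) ^ n)" and e: "0 < (\<epsilon> :: real)"
  shows "\<exists>N. \<forall>i\<ge>N. \<forall>j\<ge>N. \<rho> (w i) (w j) < ennreal \<epsilon>"
proof -
  have tri: "\<rho> (w i) (w k) \<le> \<rho> (w i) (w j) + \<rho> (w j) (w k)" and sym: "\<rho> (w i) (w j) = \<rho> (w j) (w i)"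
    and refl: "\<rho> (w i) (w i) = 0" for i j k
    using \<rho> w unfolding pseudometric_on_def by blast+
  have tail: "\<rho> (w i) (w (i + k)) \<le> ennreal (2 * (1/2) ^ i)" for i k
  proof (induction k arbitrary: i)
    case (Suc k)
    have "\<rho> (w i) (w (i + Suc k)) \<le> \<rho> (w i) (w (Suc i)) + \<rho> (w (Suc i)) (w (Suc i + k))"
      using tri by simp
    also have "\<dots> \<le> ennreal ((1/2) ^ i) + ennreal (2 * (1/2) ^ Suc i)"
      using Suc.IH[of "Suc i"] by (intro add_mono less_imp_le[OF step])
    also have "\<dots> = ennreal (2 * (1/2) ^ i)"
      by (simp flip: ennreal_plus)
    finally show ?case .
  qed (simp add: refl)
  obtain N where "(1/2) ^ N < \<epsilon> / 4"
    using real_arch_pow_inv[of "\<epsilon>/4" "1/2"] e by auto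
  then have N: "2 * (1/2) ^ N + 2 * (1/2) ^ N < \<epsilon>"
    by simp
  have "\<rho> (w i) (w j) < ennreal \<epsilon>" if ij: "N \<le> i" "N \<le> j" for i j
  proof -
    have "\<rho> (w i) (w j) \<le> \<rho> (w N) (w i) + \<rho> (w N) (w j)"
      using tri[of i j N] sym[of i N] by simp
    also have "\<dots> \<le> ennreal (2 * (1/2) ^ N) + ennreal (2 * (1/2) ^ N)"
      using tail[of N "i - N"] tail[of N "j - N"] ij by (intro add_mono) auto
    also have "\<dots> < ennreal \<epsilon>"
      using N e by (simp flip: ennreal_plus add: ennreal_lessI)
    finally show ?thesis .
  qed
  then show ?thesis
    by blast
qed

locale isometric_action = group_action G E \<phi> for G (structure) and E and \<phi> +
  fixes d :: "'b \<Rightarrow> 'b \<Rightarrow> ennreal"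
  assumes pseudometric: "pseudometric_on E d"
    and isometric: "\<And>g x y. g \<in> carrier G \<Longrightarrow> x \<in> E \<Longrightarrow> y \<in> E \<Longrightarrow> d (\<phi> g x) (\<phi> g y) = d x y"
begin

sublocale group G
  using group_hom by (rule group_hom.axioms(1))

lemma act_closed: "g \<in> carrier G \<Longrightarrow> x \<in> E \<Longrightarrow> \<phi> g x \<in> E"
  using element_image by blast

lemma act_inv: "g \<in> carrier G \<Longrightarrow> x \<in> E \<Longrightarrow> \<phi> (inv g) (\<phi> g x) = x"
  using orbit_sym_aux by blast

lemma act_inv': "g \<in> carrier G \<Longrightarrow> x \<in> E \<Longrightarrow> \<phi> g (\<phi> (inv g) x) = x"
  using act_inv[of "inv g" x] by simp

lemma d_sym: "x \<in> E \<Longrightarrow> y \<in> E \<Longrightarrow> d x y = d y x"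
  and d_triangle: "x \<in> E \<Longrightarrow> y \<in> E \<Longrightarrow> z \<in> E \<Longrightarrow> d x z \<le> d x y + d y z"
  and d_refl: "x \<in> E \<Longrightarrow> d x x = 0"
  using pseudometric unfolding pseudometric_on_def by blast+

lemma d_act_left:
  assumes "g \<in> carrier G" "x \<in> E" "y \<in> E"
  shows "d (\<phi> g x) y = d x (\<phi> (inv g) y)"
  using isometric[of "inv g" "\<phi> g x" y] assms by (simp add: act_closed act_inv)

text \<open>
  As the action is isometric, one of the two group elements can be moved to the other side.
\<close>

lemma orbit_pseudometric_less_iff:
  assumes "x \<in> E" "y \<in> E"
  shows "orbit_pseudometric G \<phi> d x y < r \<longleftrightarrow> (\<exists>g\<in>carrier G. d x (\<phi> g y) < r)"
proof
  assume "orbit_pseudometric G \<phi> d x y < r"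
  then obtain g h where gh: "g \<in> carrier G" "h \<in> carrier G" "d (\<phi> g x) (\<phi> h y) < r"
    unfolding orbit_pseudometric_def INF_less_iff by blast
  then have "d x (\<phi> (inv g \<otimes> h) y) < r"
    using assms by (simp add: d_act_left composition_rule act_closed)
  then show "\<exists>g\<in>carrier G. d x (\<phi> g y) < r"
    using gh by blast
next
  assume "\<exists>g\<in>carrier G. d x (\<phi> g y) < r"
  then obtain h where h: "h \<in> carrier G" "d x (\<phi> h y) < r"
    by blast
  have "\<phi> \<one> x = x"
    using assms(1) id_eq_one by (metis restrict_apply')
  with h show "orbit_pseudometric G \<phi> d x y < r"
    unfolding orbit_pseudometric_def INF_less_iff by (metis one_closed)
qed

lemma pseudometric_on_orbit_pseudometric: "pseudometric_on E (orbit_pseudometric G \<phi> d)"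
proof (rule pseudometric_onI)
  fix x and r :: real assume x: "x \<in> E" and r: "0 < r"
  have "d x (\<phi> \<one> x) = 0"
    using x id_eq_one d_refl by (metis restrict_apply')
  then show "orbit_pseudometric G \<phi> d x x < ennreal r"
    unfolding orbit_pseudometric_less_iff[OF x x] using r by (intro bexI[of _ \<one>]) auto
next
  fix x y and r :: real assume xy: "x \<in> E" "y \<in> E" and "orbit_pseudometric G \<phi> d x y < ennreal r"
  then obtain g where g: "g \<in> carrier G" "d x (\<phi> g y) < ennreal r"
    using orbit_pseudometric_less_iff by blast
  then have "d y (\<phi> (inv g) x) < ennreal r"
    using xy by (metis act_closed d_act_left d_sym inv_closed)
  then show "orbit_pseudometric G \<phi> d y x < ennreal r"
    unfolding orbit_pseudometric_less_iff[OF xy(2,1)] using g(1) by blast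
next
  fix x y z and a b :: real
  assume xyz: "x \<in> E" "y \<in> E" "z \<in> E" and ab: "0 < a" "0 < b"
    and "orbit_pseudometric G \<phi> d x y < ennreal a" "orbit_pseudometric G \<phi> d y z < ennreal b"
  then obtain g h where gh: "g \<in> carrier G" "d x (\<phi> g y) < ennreal a" "h \<in> carrier G" "d y (\<phi> h z) < ennreal b"
    using orbit_pseudometric_less_iff by meson
  have "d x (\<phi> (g \<otimes> h) z) \<le> d x (\<phi> g y) + d (\<phi> g y) (\<phi> (g \<otimes> h) z)"
    using xyz gh by (intro d_triangle act_closed) auto
  also have "d (\<phi> g y) (\<phi> (g \<otimes> h) z) = d y (\<phi> h z)"
    using xyz gh by (simp add: composition_rule isometric act_closed)
  also have "d x (\<phi> g y) + d y (\<phi> h z) < ennreal a + ennreal b"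
    using gh by (intro add_strict_mono)
  finally show "orbit_pseudometric G \<phi> d x z < ennreal (a + b)"
    unfolding orbit_pseudometric_less_iff[OF xyz(1,3)] using gh ab by (intro bexI[of _ "g \<otimes> h"]) auto
qed

lemma orbit_pseudometric_eq_0_iff:
  assumes "x \<in> E" "y \<in> E"
  shows "orbit_pseudometric G \<phi> d x y = 0 \<longleftrightarrow>
    (\<forall>\<epsilon>::real. \<epsilon> > 0 \<longrightarrow> (\<exists>g\<in>carrier G. d x (\<phi> g y) < ennreal \<epsilon>))"
proof -
  have "a = 0 \<longleftrightarrow> (\<forall>\<epsilon>::real. \<epsilon> > 0 \<longrightarrow> a < ennreal \<epsilon>)" for a :: ennreal
  proof (cases a)
    case (real r)
    then show ?thesis
      by (metis ennreal_0 ennreal_less_zero_iff less_irrefl not_gr_zero real(2))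
  qed (auto intro: exI[of _ 1])
  then show ?thesis
    using orbit_pseudometric_less_iff[OF assms] by simp
qed

end

section \<open>The local structure of CTR orbit pseudometrics\<close>

lemma sets_equalizer:
  assumes u: "u \<in> M \<rightarrow>\<^sub>M X" and v: "v \<in> M \<rightarrow>\<^sub>M X"
    and \<tau>: "polish_topology \<tau>" "topspace \<tau> = space X" "sets (borel_of \<tau>) = sets X"
  shows "{p \<in> space M. u p = v p} \<in> sets M"
proof -
  obtain B where B: "countable B" "\<forall>V\<in>B. openin \<tau> V"
    "\<forall>U x. openin \<tau> U \<and> x \<in> U \<longrightarrow> (\<exists>V\<in>B. x \<in> V \<and> V \<subseteq> U)"
    using polish_imp_second_countable[OF \<tau>(1)] unfolding second_countable_def by (elim exE conjE)
  have "Hausdorff_space \<tau>"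
    using \<tau>(1) by (simp add: polish_topology_def completely_metrizable_imp_metrizable_space
        metrizable_imp_Hausdorff_space)
  then have t1: "t1_space \<tau>"
    by (rule Hausdorff_imp_t1_space)
  have "space M - {p \<in> space M. u p = v p} =
      (\<Union>V\<in>B. (u -` V \<inter> space M) \<inter> (space M - (v -` V \<inter> space M)))"
  proof (intro equalityI subsetI)
    fix p assume p: "p \<in> space M - {p \<in> space M. u p = v p}"
    then have "u p \<in> topspace \<tau>" "v p \<in> topspace \<tau>" "u p \<noteq> v p"
      using measurable_space[OF u] measurable_space[OF v] \<tau>(2) by auto
    then obtain U where "openin \<tau> U" "u p \<in> U" "v p \<notin> U"
      using t1 unfolding t1_space_def by blast
    then obtain V where "V \<in> B" "u p \<in> V" "v p \<notin> V"
      using B(3) by blast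
    then show "p \<in> (\<Union>V\<in>B. (u -` V \<inter> space M) \<inter> (space M - (v -` V \<inter> space M)))"
      using p by auto
  qed auto
  moreover have "(\<Union>V\<in>B. (u -` V \<inter> space M) \<inter> (space M - (v -` V \<inter> space M))) \<in> sets M"
  proof (rule sets.countable_UN''[OF B(1)])
    fix V assume "V \<in> B"
    then have "V \<in> sets X"
      using B(2) \<tau>(3) openin_sets_borel_of by blast
    then show "(u -` V \<inter> space M) \<inter> (space M - (v -` V \<inter> space M)) \<in> sets M"
      using measurable_sets[OF u] measurable_sets[OF v] by blast
  qed
  ultimately have "space M - {p \<in> space M. u p = v p} \<in> sets M"
    by simp
  then have "space M - (space M - {p \<in> space M. u p = v p}) \<in> sets M"
    by blast
  then show ?thesis
    by (simp add: double_diff)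
qed

text \<open>
  A CTR setting together with a complete metric \<open>m\<close> for the topology of the group. In
  general \<open>m\<close> is not invariant under multiplication.
\<close>

locale CTR_action =
  fixes G :: "('g, 'm) monoid_scheme" (structure) and T :: "'g topology" and X :: "'x measure"
    and \<phi> :: "'g \<Rightarrow> 'x \<Rightarrow> 'x" and d :: "'x \<Rightarrow> 'x \<Rightarrow> ennreal" and \<tau> :: "'x topology"
    and m :: "'g \<Rightarrow> 'g \<Rightarrow> real"
  assumes setting: "orbit_setting G T X \<phi> d"
    and complete: "complete_metric_on (space X) d"
    and polish_\<tau>: "polish_topology \<tau>" and topspace_\<tau>: "topspace \<tau> = space X"
    and sets_\<tau>: "sets (borel_of \<tau>) = sets X"
    and continuous_action: "continuous_map (prod_topology T \<tau>) \<tau> (\<lambda>(g, x). \<phi> g x)"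
    and refines: "\<And>U. openin \<tau> U \<Longrightarrow> openin (emetric_topology (space X) d) U"
    and metric_m: "Metric_space (carrier G) m"
    and complete_m: "Metric_space.mcomplete (carrier G) m"
    and T_eq: "T = Metric_space.mtopology (carrier G) m"
begin

sublocale isometric_action G "space X" \<phi> d
  using setting unfolding orbit_setting_def standard_borel_G_space_def analytic_pseudometric_def
    isometric_action_def isometric_action_axioms_def by blast

sublocale Metric_space "carrier G" m
  by (rule metric_m)

lemma polish_group: "polish_group G T"
  and action_measurable: "(\<lambda>(g, x). \<phi> g x) \<in> borel_of T \<Otimes>\<^sub>M X \<rightarrow>\<^sub>M X"
  and analytic_d: "analytic_pseudometric X d"
  using setting unfolding orbit_setting_def standard_borel_G_space_def by blast+

lemma polish_T: "polish_topology T" and topspace_T: "topspace T = carrier G"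
  and continuous_mult: "continuous_map (prod_topology T T) T (\<lambda>(g, h). g \<otimes> h)"
  using polish_group unfolding polish_group_def by blast+

lemma continuous_right_mult:
  assumes "h \<in> carrier G"
  shows "continuous_map T T (\<lambda>g. g \<otimes> h)"
proof -
  have "continuous_map T (prod_topology T T) (\<lambda>g. (g, h))"
    using assms by (intro continuous_map_pairedI) (auto simp: topspace_T continuous_map_id[unfolded id_def])
  from continuous_map_compose[OF this continuous_mult] show ?thesis
    by (simp add: o_def)
qed

text \<open>
  Within \<open>2\<^sup>-\<^sup>k\<close>, \<open>y\<close> can be reached from \<open>x\<close> by a group element that is within \<open>2\<^sup>-\<^sup>k\<close> of the
  identity. Being in one orbit is a global condition; this is its local counterpart.
\<close>

definition locally_close :: "nat \<Rightarrow> 'x \<Rightarrow> 'x \<Rightarrow> bool" where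
  "locally_close k x y \<longleftrightarrow> (\<exists>g\<in>carrier G. m \<one> g < (1/2) ^ k \<and> d (\<phi> g x) y < ennreal ((1/2) ^ k))"

text \<open>
  The set is the projection of a Borel set: besides the group element \<open>g\<close>, the witness contains a
  point \<open>s\<close> of a standard Borel space that is mapped onto the pairs at \<open>d\<close>-distance less than
  \<open>2\<^sup>-\<^sup>k\<close>. This is where the analyticity of \<open>d\<close> is used.
\<close>

lemma baire_property_locally_close:
  fixes u v :: "'a::{metric_space, second_countable_topology} \<Rightarrow> 'x"
  assumes u: "u \<in> borel \<rightarrow>\<^sub>M X" and v: "v \<in> borel \<rightarrow>\<^sub>M X"
  shows "baire_property {p. locally_close k (u p) (v p)}"
proof -
  let ?r = "(1/2) ^ k :: real"
  have "analytic_in (X \<Otimes>\<^sub>M X) {(x, y). x \<in> space X \<and> y \<in> space X \<and> d x y < ennreal ?r}"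
    using analytic_d unfolding analytic_pseudometric_def by simp
  then obtain S :: "(nat \<Rightarrow> nat) measure" and f where S: "standard_borel S" "f \<in> S \<rightarrow>\<^sub>M X \<Otimes>\<^sub>M X"
    "f ` space S = {(x, y). x \<in> space X \<and> y \<in> space X \<and> d x y < ennreal ?r}"
    unfolding analytic_in_def by blast
  obtain \<sigma> where \<sigma>: "polish_topology \<sigma>" "topspace \<sigma> = space S" "sets (borel_of \<sigma>) = sets S"
    using S(1) unfolding standard_borel_def by blast
  let ?Z = "prod_topology T \<sigma>"
  let ?P = "prod_topology (euclidean :: 'a topology) ?Z"
  let ?M = "borel_of ?P"
  have pr1: "fst \<in> ?M \<rightarrow>\<^sub>M borel"
    using continuous_map_measurable[OF continuous_map_fst, of euclidean ?Z]
    by (simp add: measurable_def borel_of_euclidean)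
  have pr2: "(\<lambda>p. fst (snd p)) \<in> ?M \<rightarrow>\<^sub>M borel_of T"
    by (rule continuous_map_measurable[OF continuous_map_fst_comp[OF continuous_map_snd]])
  have "(\<lambda>p. snd (snd p)) \<in> ?M \<rightarrow>\<^sub>M borel_of \<sigma>"
    by (rule continuous_map_measurable[OF continuous_map_snd_comp[OF continuous_map_snd]])
  then have pr3: "(\<lambda>p. snd (snd p)) \<in> ?M \<rightarrow>\<^sub>M S"
    using measurable_cong_sets[OF refl \<sigma>(3)] by blast
  have fs: "(\<lambda>p. f (snd (snd p))) \<in> ?M \<rightarrow>\<^sub>M X \<Otimes>\<^sub>M X"
    using measurable_compose[OF pr3 S(2)] .
  have act: "(\<lambda>p. \<phi> (fst (snd p)) (u (fst p))) \<in> ?M \<rightarrow>\<^sub>M X"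
    using measurable_compose[OF measurable_Pair[OF pr2 measurable_compose[OF pr1 u]] action_measurable] by simp
  have ball: "{p \<in> space ?M. fst (snd p) \<in> mball \<one> ?r} \<in> sets ?M"
  proof -
    have "mball \<one> ?r \<in> sets (borel_of T)"
      by (rule openin_sets_borel_of) (simp add: T_eq)
    from measurable_sets[OF pr2 this] show ?thesis
      by (simp add: vimage_def Int_def conj_commute)
  qed
  let ?B1 = "{p \<in> space ?M. fst (f (snd (snd p))) = \<phi> (fst (snd p)) (u (fst p))}"
  let ?B2 = "{p \<in> space ?M. snd (f (snd (snd p))) = v (fst p)}"
  have "?B1 \<in> sets ?M"
    by (rule sets_equalizer[OF measurable_compose[OF fs measurable_fst] act polish_\<tau> topspace_\<tau> sets_\<tau>])
  moreover have "?B2 \<in> sets ?M"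
    by (rule sets_equalizer[OF measurable_compose[OF fs measurable_snd] measurable_compose[OF pr1 v]
          polish_\<tau> topspace_\<tau> sets_\<tau>])
  ultimately have B: "{p \<in> space ?M. fst (snd p) \<in> mball \<one> ?r} \<inter> ?B1 \<inter> ?B2 \<in> sets ?M" (is "?B \<in> _")
    using ball by blast
  have "locally_close k (u p) (v p) \<longleftrightarrow> p \<in> fst ` ?B" for p
  proof
    assume "locally_close k (u p) (v p)"
    then obtain g where g: "g \<in> carrier G" "m \<one> g < ?r" "d (\<phi> g (u p)) (v p) < ennreal ?r"
      unfolding locally_close_def by blast
    have "u p \<in> space X" "v p \<in> space X"
      using measurable_space[OF u] measurable_space[OF v] by auto
    then have "(\<phi> g (u p), v p) \<in> f ` space S"
      using g act_closed by (simp add: S(3))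
    then obtain s where s: "s \<in> space S" "f s = (\<phi> g (u p), v p)"
      by (metis imageE)
    then have "(p, g, s) \<in> ?B"
      using g by (auto simp: topspace_T \<sigma>(2) s(2))
    then show "p \<in> fst ` ?B"
      by force
  next
    assume "p \<in> fst ` ?B"
    then obtain g s where gs: "(p, g, s) \<in> ?B"
      by (auto simp del: space_borel_of)
    then have s: "s \<in> space S" "f s = (\<phi> g (u p), v p)" and g: "g \<in> carrier G" "m \<one> g < ?r"
      by (auto simp: \<sigma>(2) prod_eq_iff)
    have "(\<phi> g (u p), v p) \<in> f ` space S"
      using s by force
    then have "d (\<phi> g (u p)) (v p) < ennreal ?r"
      unfolding S(3) by simp
    then show "locally_close k (u p) (v p)"
      unfolding locally_close_def using g by blast
  qed
  then have "{p. locally_close k (u p) (v p)} = fst ` ?B"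
    by blast
  moreover have "baire_property (fst ` ?B)"
    by (rule baire_property_borel_projection[OF polish_prod_topology[OF polish_T \<sigma>(1)] B])
  ultimately show ?thesis
    by simp
qed

text \<open>
  Choose \<open>g z\<close> such that \<open>g z \<cdot> a\<close> is within \<open>2\<^sup>-\<^sup>k / 2\<close> of \<open>q z\<close>. If \<open>g z'\<close> is so near \<open>g z\<close> that
  \<open>g z' \<cdot> (g z)\<^sup>-\<^sup>1\<close> is near the identity, then \<open>q z\<close> and \<open>q z'\<close> are locally close. So if \<open>z\<close>
  is an exception, then \<open>g z\<close> has a basic neighbourhood which only meager many \<open>g z'\<close> share;
  there are only countably many basic open sets of this kind.
\<close>

lemma orbit_pigeonhole:
  fixes q :: "'b::topological_space \<Rightarrow> 'x"
  assumes q: "\<And>z. q z \<in> space X" and a: "a \<in> space X"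
    and orbit: "\<And>z. orbit_pseudometric G \<phi> d (q z) a = 0"
  shows "meager {z \<in> U. meager {z' \<in> U. locally_close k (q z) (q z')}}"
proof -
  let ?r = "(1/2) ^ k :: real"
  have "\<exists>g\<in>carrier G. d (q z) (\<phi> g a) < ennreal (?r / 2)" for z
    using orbit[of z] orbit_pseudometric_eq_0_iff[OF q a] by simp
  then obtain g where g: "\<And>z. g z \<in> carrier G" "\<And>z. d (q z) (\<phi> (g z) a) < ennreal (?r / 2)"
    by metis
  have locally_close: "locally_close k (q z) (q z')" if "m \<one> (g z' \<otimes> inv (g z)) < ?r" for z z'
  proof -
    let ?h = "g z' \<otimes> inv (g z)"
    have h: "?h \<in> carrier G"
      using g by simp
    have eq: "\<phi> ?h (\<phi> (g z) a) = \<phi> (g z') a"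
      using g a by (simp add: composition_rule act_closed act_inv)
    have "d (\<phi> ?h (q z)) (q z') \<le> d (\<phi> ?h (q z)) (\<phi> (g z') a) + d (\<phi> (g z') a) (q z')"
      using g q a h by (intro d_triangle act_closed)
    also have "d (\<phi> ?h (q z)) (\<phi> (g z') a) = d (q z) (\<phi> (g z) a)"
      using isometric[OF h q act_closed[OF g(1) a], of z z] eq by simp
    also have "d (\<phi> (g z') a) (q z') = d (q z') (\<phi> (g z') a)"
      using g q a by (intro d_sym act_closed)
    also have "d (q z) (\<phi> (g z) a) + d (q z') (\<phi> (g z') a) < ennreal (?r / 2) + ennreal (?r / 2)"
      using g(2) by (intro add_strict_mono)
    also have "\<dots> = ennreal ?r"
      by (simp flip: ennreal_plus)
    finally show ?thesis
      unfolding locally_close_def using h that by blast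
  qed
  obtain B where B: "countable B" "\<forall>V\<in>B. openin T V"
    "\<forall>U x. openin T U \<and> x \<in> U \<longrightarrow> (\<exists>V\<in>B. x \<in> V \<and> V \<subseteq> U)"
    using polish_imp_second_countable[OF polish_T] unfolding second_countable_def by (elim exE conjE)
  let ?B = "{V \<in> B. meager {z \<in> U. g z \<in> V}}"
  have "{z \<in> U. meager {z' \<in> U. locally_close k (q z) (q z')}} \<subseteq> (\<Union>V\<in>?B. {z \<in> U. g z \<in> V})"
  proof
    fix z assume z: "z \<in> {z \<in> U. meager {z' \<in> U. locally_close k (q z) (q z')}}"
    let ?O = "{h \<in> topspace T. h \<otimes> inv (g z) \<in> mball \<one> ?r}"
    have "openin T ?O"
      using g by (intro openin_continuous_map_preimage[OF continuous_right_mult]) (auto simp: T_eq)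
    moreover have "g z \<in> ?O"
      using g by (simp add: topspace_T r_inv)
    ultimately obtain V where V: "V \<in> B" "g z \<in> V" "V \<subseteq> ?O"
      using B(3) by blast
    have "{z' \<in> U. g z' \<in> V} \<subseteq> {z' \<in> U. locally_close k (q z) (q z')}"
      using V(3) locally_close by auto
    then have "meager {z' \<in> U. g z' \<in> V}"
      using z meager_subset by blast
    then show "z \<in> (\<Union>V\<in>?B. {z \<in> U. g z \<in> V})"
      using z V by blast
  qed
  moreover have "meager (\<Union>V\<in>?B. {z \<in> U. g z \<in> V})"
    using B(1) by (intro meager_UN) auto
  ultimately show ?thesis
    using meager_subset by blast
qed

lemma d_Cauchy_limit:
  assumes w: "\<And>n. w n \<in> space X" and step: "\<And>n. d (w (Suc n)) (w n) < ennreal ((1/2) ^ n)"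
  obtains w' where "w' \<in> space X" "(\<lambda>n. d (w n) w') \<longlonglongrightarrow> 0"
proof -
  have "\<exists>x\<in>space X. (\<lambda>n. d (w n) x) \<longlonglongrightarrow> 0"
    using complete w pseudometric_on_geometric_Cauchy[OF pseudometric, of w] step d_sym[OF w w]
    unfolding complete_metric_on_def by (simp add: image_subset_iff)
  then show ?thesis
    using that by blast
qed

lemma limitin_d_imp_\<tau>:
  assumes w: "\<And>n. w n \<in> space X" "w' \<in> space X" and lim: "(\<lambda>n. d (w n) w') \<longlonglongrightarrow> 0"
  shows "limitin \<tau> w w' sequentially"
  unfolding limitin_def
proof (intro conjI allI impI)
  show "w' \<in> topspace \<tau>"
    using w by (simp add: topspace_\<tau>)
  fix U assume U: "openin \<tau> U \<and> w' \<in> U"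
  then obtain \<epsilon> :: real where e: "\<epsilon> > 0" "\<forall>y\<in>space X. d w' y < ennreal \<epsilon> \<longrightarrow> y \<in> U"
    using refines[of U] unfolding openin_emetric_topology by blast
  have "\<forall>\<^sub>F n in sequentially. d (w n) w' < ennreal \<epsilon>"
    using lim e(1) by (intro order_tendstoD) auto
  then show "\<forall>\<^sub>F n in sequentially. w n \<in> U"
    by eventually_elim (use e(2) w d_sym in auto)
qed

end

section \<open>No reduction from \<open>E1\<close>\<close>

lemma tendsto_coordinatewise:
  fixes x :: "nat \<Rightarrow> 'i \<Rightarrow> 'b::topological_space"
  assumes "\<And>i. (\<lambda>n. x n i) \<longlonglongrightarrow> y i"
  shows "x \<longlonglongrightarrow> y"
proof -
  have "limitin (product_topology (\<lambda>_. euclidean) UNIV) x y sequentially"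
    using assms by (simp add: limitin_componentwise)
  then show ?thesis
    by (simp add: euclidean_product_topology)
qed

lemma (in Metric_space) MCauchy_geometric:
  assumes "\<And>n. h n \<in> M" and step: "\<And>n. d (h n) (h (Suc n)) < (1/2) ^ n"
  shows "MCauchy h"
proof -
  have "ennreal (d x z) \<le> ennreal (d x y) + ennreal (d y z)" if "x \<in> M" "y \<in> M" "z \<in> M" for x y z
    using triangle[OF that] by (simp flip: ennreal_plus add: ennreal_leI)
  then have "pseudometric_on M (\<lambda>x y. ennreal (d x y))"
    unfolding pseudometric_on_def using commute by simp
  from pseudometric_on_geometric_Cauchy[OF this assms(1)] show ?thesis
    unfolding MCauchy_def using assms by (auto simp: ennreal_less_iff)
qed

context CTR_action
begin

text \<open>
  The fusion argument sketched at the beginning. In stage \<open>n\<close>, the point \<open>x\<^sub>n\<close> is changed at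
  coordinate \<open>n\<close> only. Balls that shrink into the open sets \<open>U n\<close>, on whose intersection \<open>F\<close> is
  continuous, keep the limit in this intersection. The metric \<open>m\<close> need not be invariant, so how near
  to the identity the next group element has to be is only determined after \<open>h\<^sub>n\<close> is known.
\<close>

lemma no_reduction:
  fixes F :: "(nat \<Rightarrow> real) \<Rightarrow> 'x"
  assumes F: "F \<in> borel \<rightarrow>\<^sub>M X"
    and red: "\<And>x y. orbit_pseudometric G \<phi> d (F x) (F y) = 0 \<longleftrightarrow> (\<exists>N. \<forall>n\<ge>N. x n = y n)"
  shows False
proof -
  let ?\<rho> = "orbit_pseudometric G \<phi> d"
  have FX: "F x \<in> space X" for x
    using measurable_space[OF F] by simp
  have line: "?\<rho> (F (x(n := z))) (F (x(n := z'))) = 0" for x n z z'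
    unfolding red by (intro exI[of _ "Suc n"]) auto
  have F\<tau>: "F \<in> borel \<rightarrow>\<^sub>M borel_of \<tau>"
    using F measurable_cong_sets[OF refl sets_\<tau>] by blast
  obtain U where U: "\<And>i::nat. open (U i)" "meager (- (\<Inter>i. U i))"
    "continuous_map (subtopology euclidean (\<Inter>i. U i)) \<tau> F"
    using measurable_continuous_on_comeager[OF F\<tau> polish_imp_second_countable[OF polish_\<tau>]] by metis
  \<comment> \<open>from these points, only meager many small moves along direction \<open>n\<close> keep the value locally close\<close>
  define bad where "bad n k =
    {x. \<exists>V. open V \<and> x n \<in> V \<and> meager {z \<in> V. locally_close k (F x) (F (x(n := z)))}}" for n k
  have bad: "meager (bad n k)" for n k
  proof -
    let ?S = "{p. locally_close k (F (fst p)) (F ((fst p)(n := snd p)))}"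
    have "continuous_on UNIV (\<lambda>p :: (nat \<Rightarrow> real) \<times> real. (fst p)(n := snd p))"
      by (intro continuous_on_fun_upd continuous_on_fst continuous_on_snd continuous_on_id)
    then have "(\<lambda>p :: (nat \<Rightarrow> real) \<times> real. (fst p)(n := snd p)) \<in> borel \<rightarrow>\<^sub>M borel"
      by (rule borel_measurable_continuous_onI)
    moreover have "(fst :: (nat \<Rightarrow> real) \<times> real \<Rightarrow> _) \<in> borel \<rightarrow>\<^sub>M borel"
      by (intro borel_measurable_continuous_onI continuous_on_fst continuous_on_id)
    ultimately have "baire_property ?S"
      using F by (intro baire_property_locally_close) (auto intro: measurable_compose)
    moreover have "meager {z \<in> V. meager {z' \<in> V. (x(n := z), z') \<in> ?S}}" for x V
    proof -
      have "meager {z \<in> V. meager {z' \<in> V. locally_close k (F (x(n := z))) (F (x(n := z')))}}"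
        using line[of x n _ "x n"] by (intro orbit_pigeonhole[of "\<lambda>z. F (x(n := z))" "F x"] FX) simp
      then show ?thesis
        by simp
    qed
    ultimately show ?thesis
      using comeager_directional_density[of ?S n] by (simp add: bad_def)
  qed
  let ?D0 = "(\<Inter>i. U i) - (\<Union>n. \<Union>k. bad n k)"
  have "meager (- ?D0)"
  proof -
    have "- ?D0 = - (\<Inter>i. U i) \<union> (\<Union>n. \<Union>k. bad n k)"
      by auto
    then show ?thesis
      using U(2) bad by (simp add: meager_Un meager_UN_nat)
  qed
  then obtain D where D: "D \<subseteq> ?D0" "meager (- D)" "\<And>x n. x \<in> D \<Longrightarrow> meager {z. x(n := z) \<notin> D}"
    by (rule comeager_hereditary_core) blast
  have "D \<noteq> {}"
    using D(2) nonmeager_open[of "UNIV :: (nat \<Rightarrow> real) set"] by auto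
  have step: "\<exists>z. z \<noteq> x n \<and> x(n := z) \<in> D \<and> x(n := z) \<in> V \<and> locally_close k (F x) (F (x(n := z)))"
    if x: "x \<in> D" and V: "open V" "x \<in> V" for x n k V
  proof (rule ccontr)
    assume no: "\<not> ?thesis"
    let ?I = "{z. x(n := z) \<in> V}"
    have "open ((\<lambda>z. x(n := z)) -` V)"
      using V(1) by (intro open_vimage continuous_on_fun_upd continuous_on_const continuous_on_id)
    then have I: "open ?I" "x n \<in> ?I"
      using V(2) by (simp_all add: vimage_def)
    have "{z \<in> ?I. locally_close k (F x) (F (x(n := z)))} \<subseteq> {x n} \<union> {z. x(n := z) \<notin> D}"
      using no by blast
    then have "meager {z \<in> ?I. locally_close k (F x) (F (x(n := z)))}"
      using meager_Un[OF meager_singleton D(3)[OF x]] meager_subset by blast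
    then have "x \<in> bad n k"
      using I unfolding bad_def by blast
    then show False
      using x D(1) by blast
  qed
  \<comment> \<open>a stage consists of the current point, the product of the group elements so far, and the radius
    of the ball around the point to which all later points are confined\<close>
  let ?P = "\<lambda>(x, h, r :: real). x \<in> D \<and> h \<in> carrier G \<and> r > 0"
  let ?Q = "\<lambda>n (x, h, r) (x', h', r'). (\<exists>z. z \<noteq> x n \<and> x' = x(n := z)) \<and>
      (\<exists>g\<in>carrier G. h' = g \<otimes> h \<and> m h h' < (1/2) ^ n \<and> d (\<phi> g (F x)) (F x') < ennreal ((1/2) ^ n)) \<and>
      cball x' r' \<subseteq> U n \<inter> ball x r"
  have "\<exists>s. \<forall>n. ?P (s n) \<and> ?Q n (s n) (s (Suc n))"
  proof (rule dependent_nat_choice)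
    obtain x where "x \<in> D"
      using \<open>D \<noteq> {}\<close> by blast
    then show "\<exists>s. ?P s"
      by (intro exI[of _ "(x, \<one>, 1)"]) simp
  next
    fix s n assume Ps: "?P s"
    obtain x h r where s: "s = (x, h, r)"
      by (cases s)
    have x: "x \<in> D" and h: "h \<in> carrier G" and r: "r > 0"
      using Ps by (auto simp: s)
    have "openin T {g \<in> topspace T. g \<otimes> h \<in> mball h ((1/2) ^ n)}"
      by (intro openin_continuous_map_preimage[OF continuous_right_mult[OF h]]) (simp add: T_eq)
    moreover have "\<one> \<in> {g \<in> topspace T. g \<otimes> h \<in> mball h ((1/2) ^ n)}"
      using h by (simp add: topspace_T)
    ultimately obtain e where e: "e > 0" "mball \<one> e \<subseteq> {g \<in> topspace T. g \<otimes> h \<in> mball h ((1/2) ^ n)}"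
      unfolding T_eq openin_mtopology by blast
    obtain k0 where k0: "(1/2) ^ k0 < e"
      using real_arch_pow_inv[of e "1/2"] e(1) by auto
    define k where "k = max k0 n"
    have k: "(1/2) ^ k \<le> ((1/2) ^ k0 :: real)" "(1/2) ^ k \<le> ((1/2) ^ n :: real)"
      by (auto simp: k_def intro!: power_decreasing)
    obtain z where z: "z \<noteq> x n" "x(n := z) \<in> D" "x(n := z) \<in> ball x r" "locally_close k (F x) (F (x(n := z)))"
      using step[OF x open_ball, of x r n k] r by auto
    obtain g where g: "g \<in> carrier G" "m \<one> g < (1/2) ^ k" "d (\<phi> g (F x)) (F (x(n := z))) < ennreal ((1/2) ^ k)"
      using z(4) unfolding locally_close_def by blast
    have "g \<in> mball \<one> e"
      using g(1) order_less_le_trans[OF g(2) k(1)] k0 by simp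
    then have "g \<otimes> h \<in> mball h ((1/2) ^ n)"
      using e(2) by blast
    then have mg: "m h (g \<otimes> h) < (1/2) ^ n"
      by simp
    have dg: "d (\<phi> g (F x)) (F (x(n := z))) < ennreal ((1/2) ^ n)"
      using g(3) k(2) ennreal_leI order_less_le_trans by blast
    have "open (U n \<inter> ball x r)" "x(n := z) \<in> U n \<inter> ball x r"
      using U(1) z(2,3) D(1) by auto
    then obtain r' where r': "r' > 0" "cball (x(n := z)) r' \<subseteq> U n \<inter> ball x r"
      unfolding open_contains_cball by blast
    have "?P (x(n := z), g \<otimes> h, r')"
      using z(2) g(1) h r'(1) by simp
    moreover have "?Q n s (x(n := z), g \<otimes> h, r')"
      unfolding s prod.case using z(1) g(1) mg dg r'(2) by blast
    ultimately show "\<exists>s'. ?P s' \<and> ?Q n s s'"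
      by (intro exI[of _ "(x(n := z), g \<otimes> h, r')"] conjI)
  qed
  then obtain s where s0: "\<forall>n. ?P (s n) \<and> ?Q n (s n) (s (Suc n))"
    by (rule exE)
  have s: "?P (s n)" "?Q n (s n) (s (Suc n))" for n
    using spec[OF s0, of n] by (rule conjunct1, rule conjunct2)
  define x where "x n = fst (s n)" for n
  define h where "h n = fst (snd (s n))" for n
  define r where "r n = snd (snd (s n))" for n
  have s_eq: "s n = (x n, h n, r n)" for n
    by (simp add: x_def h_def r_def)
  have xD: "x n \<in> D" and hG: "h n \<in> carrier G" and r0: "r n > 0" for n
    using s(1)[of n] by (auto simp: s_eq)
  have x_Suc: "\<exists>z. z \<noteq> x n n \<and> x (Suc n) = (x n)(n := z)"
    and h_Suc: "\<exists>g\<in>carrier G. h (Suc n) = g \<otimes> h n \<and> m (h n) (h (Suc n)) < (1/2) ^ n \<and>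
        d (\<phi> g (F (x n))) (F (x (Suc n))) < ennreal ((1/2) ^ n)"
    and balls: "cball (x (Suc n)) (r (Suc n)) \<subseteq> U n \<inter> ball (x n) (r n)" for n
    using s(2)[of n] by (auto simp: s_eq)

  have x_other: "x (Suc n) i = x n i" if "i \<noteq> n" for n i
    using x_Suc[of n] that by auto
  have x_before: "x n i = x 0 i" if "n \<le> i" for n i
    using that by (induction n) (auto simp: x_other)
  have x_after: "x n i = x (Suc i) i" if "Suc i \<le> n" for n i
    using that by (induction n rule: dec_induct) (auto simp: x_other)
  define y where "y i = x (Suc i) i" for i
  have y_diff: "y i \<noteq> x 0 i" for i
    using x_Suc[of i] x_before[of i i] by (auto simp: y_def)
  have x_lim: "x \<longlonglongrightarrow> y"
  proof -
    have "(\<lambda>n. x n i) \<longlonglongrightarrow> y i" for i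
      by (rule tendsto_eventually) (auto simp: eventually_sequentially y_def intro!: exI[of _ "Suc i"] x_after)
    then show ?thesis
      by (rule tendsto_coordinatewise)
  qed
  have cball_mono: "cball (x j) (r j) \<subseteq> cball (x i) (r i)" if "i \<le> j" for i j
  proof (rule lift_Suc_antimono_le[of "\<lambda>i. cball (x i) (r i)", OF _ that])
    show "cball (x (Suc n)) (r (Suc n)) \<subseteq> cball (x n) (r n)" for n
      using balls[of n] ball_subset_cball by blast
  qed
  have "y \<in> cball (x i) (r i)" for i
  proof (rule Lim_in_closed_set[OF closed_cball _ _ x_lim])
    have "x j \<in> cball (x i) (r i)" if "i \<le> j" for j
    proof -
      have "x j \<in> cball (x j) (r j)"
        using r0[of j] by simp
      then show ?thesis
        using cball_mono[OF that] by blast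
    qed
    then show "\<forall>\<^sub>F j in sequentially. x j \<in> cball (x i) (r i)"
      using eventually_sequentially by blast
  qed simp
  then have yU: "y \<in> (\<Inter>i. U i)"
    using balls by blast
  have "limitin (subtopology euclidean (\<Inter>i. U i)) x y sequentially"
  proof -
    have "x n \<in> (\<Inter>i. U i)" for n
      using xD D(1) by blast
    then show ?thesis
      unfolding limitin_subtopology using yU x_lim by (simp add: always_eventually)
  qed
  from continuous_map_limit[OF U(3) this]
  have F_lim: "limitin \<tau> (\<lambda>n. F (x n)) (F y) sequentially"
    by (simp add: o_def)

  have "MCauchy h"
  proof (rule MCauchy_geometric[OF hG])
    show "m (h n) (h (Suc n)) < (1/2) ^ n" for n
      using h_Suc[of n] by blast
  qed
  then obtain h' where h': "limitin mtopology h h' sequentially"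
    using complete_m unfolding mcomplete_def by blast
  then have h'G: "h' \<in> carrier G"
    by (simp add: limitin_def)

  \<comment> \<open>the errors made at the different stages, all transported back to \<open>F (x 0)\<close>; they are
    small because the action preserves \<open>d\<close>\<close>
  define w where "w n = \<phi> (inv (h n)) (F (x n))" for n
  have wX: "w n \<in> space X" for n
    using hG FX by (simp add: w_def act_closed)
  have w_step: "d (w (Suc n)) (w n) < ennreal ((1/2) ^ n)" for n
  proof -
    obtain g where g: "g \<in> carrier G" "h (Suc n) = g \<otimes> h n"
        "d (\<phi> g (F (x n))) (F (x (Suc n))) < ennreal ((1/2) ^ n)"
      using h_Suc by blast
    have "d (w (Suc n)) (w n) = d (F (x (Suc n))) (\<phi> (h (Suc n)) (\<phi> (inv (h n)) (F (x n))))"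
      unfolding w_def using hG FX by (subst d_act_left) (auto simp: act_closed)
    also have "\<phi> (h (Suc n)) (\<phi> (inv (h n)) (F (x n))) = \<phi> g (F (x n))"
      unfolding g(2) using hG[of n] g(1) FX by (simp add: composition_rule act_closed act_inv')
    finally show ?thesis
      using g FX d_sym act_closed by metis
  qed
  obtain w' where w': "w' \<in> space X" "(\<lambda>n. d (w n) w') \<longlonglongrightarrow> 0"
    using d_Cauchy_limit[OF wX w_step] by blast
  have "limitin (prod_topology T \<tau>) (\<lambda>n. (h n, w n)) (h', w') sequentially"
    using h' limitin_d_imp_\<tau>[OF wX w'] by (simp add: limitin_pairwise o_def T_eq)
  from continuous_map_limit[OF continuous_action this]
  have "limitin \<tau> (\<lambda>n. F (x n)) (\<phi> h' w') sequentially"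
    using hG FX by (simp add: o_def w_def act_inv')
  moreover have "Hausdorff_space \<tau>"
    using polish_\<tau> by (simp add: polish_topology_def completely_metrizable_imp_metrizable_space
        metrizable_imp_Hausdorff_space)
  ultimately have Fy: "F y = \<phi> h' w'"
    using limitin_Hausdorff_unique[OF F_lim] by simp

  have "?\<rho> (F y) (F (x 0)) = 0"
    unfolding orbit_pseudometric_eq_0_iff[OF FX FX]
  proof (intro allI impI)
    fix \<epsilon> :: real assume e: "\<epsilon> > 0"
    have "\<forall>\<^sub>F n in sequentially. d (w n) w' < ennreal (\<epsilon> / 2)"
      using w'(2) e by (intro order_tendstoD) auto
    then obtain N where N: "d (w N) w' < ennreal (\<epsilon> / 2)"
      by (auto simp: eventually_sequentially)
    \<comment> \<open>\<open>x N\<close> is near enough to the limit and still \<open>E1\<close>-equivalent to \<open>x 0\<close>\<close>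
    have "?\<rho> (F (x N)) (F (x 0)) = 0"
      unfolding red using x_before by blast
    then obtain g where g: "g \<in> carrier G" "d (F (x N)) (\<phi> g (F (x 0))) < ennreal (\<epsilon> / 2)"
      unfolding orbit_pseudometric_eq_0_iff[OF FX FX] using e by (meson half_gt_zero)
    let ?a = "\<phi> (inv (h N)) (\<phi> g (F (x 0)))"
    have a: "?a \<in> space X" "\<phi> h' ?a = \<phi> (h' \<otimes> (inv (h N) \<otimes> g)) (F (x 0))"
      using hG h'G g(1) FX by (simp_all add: act_closed composition_rule)
    have "d (F y) (\<phi> h' ?a) = d w' ?a"
      unfolding Fy using h'G w'(1) a(1) by (rule isometric)
    also have "\<dots> \<le> d w' (w N) + d (w N) ?a"
      using w' wX a by (intro d_triangle)
    also have "d w' (w N) = d (w N) w'"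
      using w' wX by (intro d_sym)
    also have "d (w N) ?a = d (F (x N)) (\<phi> g (F (x 0)))"
      unfolding w_def using hG g(1) FX by (intro isometric) (auto simp: act_closed)
    also have "d (w N) w' + d (F (x N)) (\<phi> g (F (x 0))) < ennreal (\<epsilon> / 2) + ennreal (\<epsilon> / 2)"
      using N g(2) by (rule add_strict_mono)
    also have "\<dots> = ennreal \<epsilon>"
      using e by (simp flip: ennreal_plus)
    finally show "\<exists>g\<in>carrier G. d (F y) (\<phi> g (F (x 0))) < ennreal \<epsilon>"
      using hG h'G g(1) unfolding a(2) by (intro bexI[of _ "h' \<otimes> (inv (h N) \<otimes> g)"]) auto
  qed
  then show False
    unfolding red using y_diff by blast
qed

end

instance bool :: second_countable_topology
proof
  show "\<exists>B :: bool set set. countable B \<and> open = generate_topology B"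
    by (intro exI[of _ "range lessThan \<union> range greaterThan"]) (auto simp: open_bool_def)
qed

text \<open>
  A coordinatewise injective Borel map, which reduces eventual equality of sequences of reals to
  \<open>E1\<close>. Reals are more convenient than points of \<open>2\<^sup>\<nat>\<close>, since they form a metric space
  without isolated points.
\<close>

definition left_cuts :: "(nat \<Rightarrow> real) \<Rightarrow> nat \<Rightarrow> nat \<Rightarrow> bool" where
  "left_cuts x n k \<longleftrightarrow> of_rat (from_nat k) < x n"

lemma left_cuts_eq_iff: "left_cuts x n = left_cuts y n \<longleftrightarrow> x n = y n"
proof
  assume eq: "left_cuts x n = left_cuts y n"
  have "\<not> x n < y n" if "left_cuts x n = left_cuts y n" for x y
  proof
    assume "x n < y n"
    then obtain q :: rat where "x n < of_rat q" "of_rat q < y n"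
      using of_rat_dense by blast
    then have "\<not> left_cuts x n (to_nat q)" "left_cuts y n (to_nat q)"
      by (simp_all add: left_cuts_def)
    then show False
      using that by simp
  qed
  then show "x n = y n"
    using eq eq[symmetric] by (meson linorder_less_linear)
qed (auto simp: left_cuts_def)

lemma sets_E1_space: "sets E1_space = sets borel"
proof -
  have "discrete_topology (UNIV :: bool set) = euclidean"
    by (metis discrete_topology_unique open_discrete open_openin topspace_euclidean)
  then show ?thesis
    by (simp add: E1_space_def euclidean_product_topology borel_of_euclidean)
qed

lemma left_cuts_measurable: "left_cuts \<in> borel \<rightarrow>\<^sub>M E1_space"
proof -
  have "(\<lambda>x. left_cuts x n k) \<in> borel \<rightarrow>\<^sub>M borel" for n k
  proof -
    have "(\<lambda>x. x n) \<in> (borel :: (nat \<Rightarrow> real) measure) \<rightarrow>\<^sub>M borel"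
      by (rule borel_measurable_continuous_onI) simp
    then have "Measurable.pred borel (\<lambda>x. left_cuts x n k)"
      unfolding left_cuts_def by measurable
    then show ?thesis
      by (rule measurable_compose) simp
  qed
  then have "left_cuts \<in> borel \<rightarrow>\<^sub>M borel"
    by (intro measurable_coordinatewise_then_product)
  then show ?thesis
    using measurable_cong_sets[OF refl sets_E1_space] by blast
qed

theorem E1_not_reducible:
  assumes "CTR_setting G T X \<phi> d"
  shows "\<not> borel_reducible E1_space E1 X (zero_relation X (orbit_pseudometric G \<phi> d))"
proof
  assume "borel_reducible E1_space E1 X (zero_relation X (orbit_pseudometric G \<phi> d))"
  then obtain f where f: "f \<in> E1_space \<rightarrow>\<^sub>M X"
    "\<And>x y. x \<in> space E1_space \<Longrightarrow> y \<in> space E1_space \<Longrightarrow>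
      (x, y) \<in> E1 \<longleftrightarrow> (f x, f y) \<in> zero_relation X (orbit_pseudometric G \<phi> d)"
    unfolding borel_reducible_def by blast
  have sp: "x \<in> space E1_space" for x
    using sets_eq_imp_space_eq[OF sets_E1_space] by simp
  obtain \<tau> where \<tau>: "polish_topology \<tau>" "topspace \<tau> = space X" "sets (borel_of \<tau>) = sets X"
      "continuous_map (prod_topology T \<tau>) \<tau> (\<lambda>(g, x). \<phi> g x)"
      "\<And>U. openin \<tau> U \<Longrightarrow> openin (emetric_topology (space X) d) U"
    using assms unfolding CTR_setting_def by blast
  have T: "polish_topology T" "topspace T = carrier G"
    using assms unfolding CTR_setting_def orbit_setting_def standard_borel_G_space_def polish_group_def by blast+
  obtain M m where m: "Metric_space M m" "Metric_space.mcomplete M m" "T = Metric_space.mtopology M m"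
    using T(1) unfolding polish_topology_def completely_metrizable_space_def by blast
  have "M = carrier G"
    using T(2) m by (simp add: Metric_space.topspace_mtopology)
  interpret CTR_action G T X \<phi> d \<tau> m
  proof (rule CTR_action.intro)
    show "orbit_setting G T X \<phi> d" "complete_metric_on (space X) d"
      using assms by (simp_all add: CTR_setting_def)
    show "Metric_space (carrier G) m" "Metric_space.mcomplete (carrier G) m"
        "T = Metric_space.mtopology (carrier G) m"
      using m \<open>M = carrier G\<close> by simp_all
  qed (fact \<tau>)+
  show False
  proof (rule no_reduction)
    show "(\<lambda>x. f (left_cuts x)) \<in> borel \<rightarrow>\<^sub>M X"
      by (rule measurable_compose[OF left_cuts_measurable f(1)])
    show "orbit_pseudometric G \<phi> d (f (left_cuts x)) (f (left_cuts y)) = 0 \<longleftrightarrow> (\<exists>N. \<forall>n\<ge>N. x n = y n)" for x y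
    proof -
      have "(left_cuts x, left_cuts y) \<in> E1 \<longleftrightarrow> (\<exists>N. \<forall>n\<ge>N. x n = y n)"
        by (simp add: E1_def left_cuts_eq_iff)
      then show ?thesis
        using f(2)[OF sp sp, of "left_cuts x" "left_cuts y"] measurable_space[OF f(1) sp] by (simp add: zero_relation_def)
    qed
  qed
qed

section \<open>Polish subspaces and analytic sets\<close>

lemma polish_subtopology_gdelta:
  assumes "polish_topology T" "gdelta_in T S"
  shows "polish_topology (subtopology T S)"
proof -
  have "second_countable (subtopology T S)"
    by (intro second_countable_subtopology polish_imp_second_countable assms(1))
  then show ?thesis
    using assms by (simp add: polish_topology_def completely_metrizable_space_gdelta_in
        second_countable_imp_separable_space)
qed

lemma polish_closed_subtopology:
  assumes "polish_topology T" "closedin T S"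
  shows "polish_topology (subtopology T S)"
proof -
  have "gdelta_in T S"
    using assms by (intro closed_imp_gdelta_in) (auto simp: polish_topology_def
        intro: completely_metrizable_imp_metrizable_space)
  then show ?thesis
    by (rule polish_subtopology_gdelta[OF assms(1)])
qed

lemma gdelta_in_Collect_all:
  fixes P :: "'i::countable \<Rightarrow> 'a::topological_space \<Rightarrow> bool"
  assumes "\<And>i. gdelta_in euclidean {x. P i x}"
  shows "gdelta_in euclidean {x. \<forall>i. P i x}"
proof -
  have "{x. \<forall>i. P i x} = \<Inter>(range (\<lambda>i. {x. P i x}))"
    by auto
  then show ?thesis
    using assms by (auto intro!: gdelta_in_Inter)
qed

text \<open>
  Locally, the discrete parameter is constant.
\<close>

lemma continuous_on_select:
  fixes k :: "'a::topological_space \<Rightarrow> 'b::discrete_topology"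
  assumes k: "continuous_on S k" and f: "\<And>b. continuous_on S (\<lambda>x. f b x)"
  shows "continuous_on S (\<lambda>x. f (k x) x)"
  unfolding continuous_on_def
proof
  fix x assume x: "x \<in> S"
  have "(k \<longlongrightarrow> k x) (at x within S)"
    using k x by (simp add: continuous_on_def)
  then have ev: "\<forall>\<^sub>F y in at x within S. k y \<in> {k x}"
    by (rule topological_tendstoD) (auto simp: open_discrete)
  have "((\<lambda>y. f (k x) y) \<longlongrightarrow> f (k x) x) (at x within S)"
    using f x by (simp add: continuous_on_def)
  then show "((\<lambda>y. f (k y) y) \<longlongrightarrow> f (k x) x) (at x within S)"
    by (rule Lim_transform_eventually) (use ev in \<open>auto elim: eventually_mono\<close>)
qed

text \<open>
  The parameter space of an analytic set may be any Polish space: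
  transport its topology along an injection into the Baire space, which need not be continuous.
\<close>

lemma analytic_in_image:
  fixes e :: "'z \<Rightarrow> nat \<Rightarrow> nat"
  assumes Z: "polish_topology Z" and e: "inj_on e (topspace Z)"
    and f: "f \<in> borel_of Z \<rightarrow>\<^sub>M X"
  shows "analytic_in X (f ` topspace Z)"
proof -
  define h where "h = inv_into (topspace Z) e"
  define Z' where "Z' = pullback_topology (e ` topspace Z) h Z"
  have he: "h (e z) = z" if "z \<in> topspace Z" for z
    using e that by (simp add: h_def)
  have top': "topspace Z' = e ` topspace Z"
    using he by (auto simp: Z'_def topspace_pullback_topology)
  have h_cont: "continuous_map Z' Z h"
    unfolding continuous_map_def
  proof (intro conjI allI impI)
    show "h \<in> topspace Z' \<rightarrow> topspace Z"
      using he by (auto simp: top')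
    show "openin Z' {x \<in> topspace Z'. h x \<in> U}" if "openin Z U" for U
      unfolding top' unfolding Z'_def openin_pullback_topology using that by (intro exI[of _ U]) auto
  qed
  have e_cont: "continuous_map Z Z' e"
    unfolding continuous_map_def
  proof (intro conjI allI impI)
    show "e \<in> topspace Z \<rightarrow> topspace Z'"
      by (auto simp: top')
    fix U assume "openin Z' U"
    then obtain V where V: "openin Z V" "U = h -` V \<inter> e ` topspace Z"
      unfolding Z'_def openin_pullback_topology by blast
    have "e x \<in> U \<longleftrightarrow> x \<in> V" if "x \<in> topspace Z" for x
      using that by (simp add: V(2) he)
    then have "{x \<in> topspace Z. e x \<in> U} = V"
      using openin_subset[OF V(1)] by blast
    then show "openin Z {x \<in> topspace Z. e x \<in> U}"
      using V(1) by simp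
  qed
  have "Z homeomorphic_space Z'"
    unfolding homeomorphic_space_def homeomorphic_maps_def
    using e_cont h_cont he by (intro exI[of _ e] exI[of _ h]) (auto simp: top')
  then have "polish_topology Z'"
    using Z homeomorphic_completely_metrizable_space homeomorphic_separable_space
    unfolding polish_topology_def by blast
  then have "standard_borel (borel_of Z')"
    unfolding standard_borel_def by (intro exI[of _ Z']) simp
  moreover have "(\<lambda>s. f (h s)) \<in> borel_of Z' \<rightarrow>\<^sub>M X"
    by (rule measurable_compose[OF continuous_map_measurable[OF h_cont] f])
  moreover have "(\<lambda>s. f (h s)) ` space (borel_of Z') = f ` topspace Z"
    using he by (force simp: top' image_image)
  ultimately show ?thesis
    unfolding analytic_in_def by blast
qed

lemma inj_real_baire: "\<exists>e :: real \<Rightarrow> nat \<Rightarrow> nat. inj e"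
proof -
  have "x = y" if "(\<lambda>k. of_bool (of_rat (from_nat k) < x) :: nat) = (\<lambda>k. of_bool (of_rat (from_nat k) < y))"
    for x y :: real
  proof -
    have "of_rat q < x \<longleftrightarrow> of_rat q < y" for q
      using fun_cong[OF that, of "to_nat q"] by (simp add: of_bool_eq_iff)
    then show ?thesis
      by (metis linorder_less_linear less_irrefl of_rat_dense order_less_trans)
  qed
  then show ?thesis
    by (intro exI[of _ "\<lambda>x k. of_bool (of_rat (from_nat k) < x)"] injI)
qed

lemma inj_fun_baire:
  assumes "\<exists>e :: 'b \<Rightarrow> nat \<Rightarrow> nat. inj e"
  shows "\<exists>e :: ('a::countable \<Rightarrow> 'b) \<Rightarrow> nat \<Rightarrow> nat. inj e"
proof -
  obtain e :: "'b \<Rightarrow> nat \<Rightarrow> nat" where e: "inj e"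
    using assms by blast
  let ?E = "\<lambda>(f :: 'a \<Rightarrow> 'b) k. e (f (from_nat (fst (prod_decode k)))) (snd (prod_decode k))"
  have "f = g" if "?E f = ?E g" for f g
  proof
    fix a
    have "e (f a) k = e (g a) k" for k
      using fun_cong[OF that, of "prod_encode (to_nat a, k)"] by simp
    then show "f a = g a"
      using e by (metis ext injD)
  qed
  then show ?thesis
    by (intro exI[of _ ?E] injI)
qed

lemma inj_prod_baire:
  assumes "\<exists>e :: 'a \<Rightarrow> nat \<Rightarrow> nat. inj e" "\<exists>e :: 'b \<Rightarrow> nat \<Rightarrow> nat. inj e"
  shows "\<exists>e :: ('a \<times> 'b) \<Rightarrow> nat \<Rightarrow> nat. inj e"
proof -
  obtain e1 :: "'a \<Rightarrow> nat \<Rightarrow> nat" and e2 :: "'b \<Rightarrow> nat \<Rightarrow> nat" where e: "inj e1" "inj e2"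
    using assms by blast
  let ?E = "\<lambda>(a, b) k. prod_encode (e1 a k, e2 b k)"
  have "p = q" if eq: "?E p = ?E q" for p q
  proof -
    have "prod_encode (e1 (fst p) k, e2 (snd p) k) = prod_encode (e1 (fst q) k, e2 (snd q) k)" for k
      using fun_cong[OF eq, of k] by (simp add: case_prod_unfold)
    then have "e1 (fst p) = e1 (fst q)" "e2 (snd p) = e2 (snd q)"
      by (auto simp: fun_eq_iff)
    then show ?thesis
      using e by (metis injD prod_eqI)
  qed
  then show ?thesis
    by (intro exI[of _ ?E] injI)
qed

lemma inj_nat_baire: "\<exists>e :: nat \<Rightarrow> nat \<Rightarrow> nat. inj e"
  by (intro exI[of _ "\<lambda>n _. n"] injI) (simp add: fun_eq_iff)

type_synonym 'i witnessed_pair =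
  "(('i \<Rightarrow> real) \<times> ('i \<Rightarrow> real)) \<times> ((nat \<Rightarrow> nat) \<times> (nat \<Rightarrow> nat)) \<times> (nat \<Rightarrow> nat)"

lemma analytic_in_parametrized:
  fixes A :: "('i::countable \<Rightarrow> real) set"
    and C :: "'i witnessed_pair set"
  defines "X \<equiv> borel_of (subtopology euclidean A)"
  assumes A: "polish_topology (subtopology euclidean A)" and C: "closed C"
  shows "analytic_in (X \<Otimes>\<^sub>M X) {(f, g). f \<in> A \<and> g \<in> A \<and> (\<exists>\<pi> \<sigma> n. ((f, g), (\<pi>, \<sigma>), n) \<in> C)}"
proof -
  let ?A = "subtopology euclidean A"
  let ?B = "euclidean :: (nat \<Rightarrow> nat) topology"
  let ?P = "prod_topology (prod_topology ?A ?A) (prod_topology (prod_topology ?B ?B) ?B)"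
  let ?S = "(A \<times> A) \<times> (UNIV :: (((nat \<Rightarrow> nat) \<times> (nat \<Rightarrow> nat)) \<times> (nat \<Rightarrow> nat)) set)"
  have P: "?P = subtopology euclidean ?S"
    by (metis prod_topology_euclidean prod_topology_subtopology_eu subtopology_UNIV)
  have polish: "polish_topology ?P"
    by (intro polish_prod_topology A polish_baire_space)
  let ?Z = "subtopology ?P (?S \<inter> C)"
  have "closedin ?P (?S \<inter> C)"
    unfolding P using C by (rule closedin_closed_Int)
  then have Z: "polish_topology ?Z"
    using polish polish_closed_subtopology by blast
  have top: "topspace ?Z = ?S \<inter> C"
    by (auto simp: P)
  have "\<exists>e :: 'i witnessed_pair \<Rightarrow> nat \<Rightarrow> nat. inj e"
    by (intro inj_prod_baire inj_fun_baire inj_real_baire inj_nat_baire)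
  then obtain e :: "'i witnessed_pair \<Rightarrow> nat \<Rightarrow> nat"
    where e: "inj_on e (topspace ?Z)"
    using inj_on_subset by blast
  have id: "continuous_map ?Z ?P (\<lambda>z. z)"
    using continuous_map_from_subtopology[OF continuous_map_id[of ?P]] by (simp add: id_def)
  have "fst \<in> borel_of ?Z \<rightarrow>\<^sub>M X \<Otimes>\<^sub>M X"
  proof -
    have "(\<lambda>z. (fst (fst z), snd (fst z))) \<in> borel_of ?Z \<rightarrow>\<^sub>M X \<Otimes>\<^sub>M X"
      unfolding X_def
      by (intro measurable_Pair continuous_map_measurable)
         (rule continuous_map_fst_comp[OF continuous_map_fst_comp[OF id]],
          rule continuous_map_snd_comp[OF continuous_map_fst_comp[OF id]])
    then show ?thesis
      by simp
  qed
  from analytic_in_image[OF Z e this]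
  have "analytic_in (X \<Otimes>\<^sub>M X) (fst ` (?S \<inter> C))"
    unfolding top .
  moreover have "fst ` (?S \<inter> C) = {(f, g). f \<in> A \<and> g \<in> A \<and> (\<exists>\<pi> \<sigma> n. ((f, g), (\<pi>, \<sigma>), n) \<in> C)}"
    by force
  ultimately show ?thesis
    by simp
qed

text \<open>
  An open subset of the product is a countable union of basic rectangles. This yields the
  measurability of an action from its continuity.
\<close>

lemma sets_borel_of_prod_topology:
  assumes S: "second_countable S" and T: "second_countable T"
  shows "sets (borel_of (prod_topology S T)) \<subseteq> sets (borel_of S \<Otimes>\<^sub>M borel_of T)"
proof -
  obtain A where A: "countable A" "\<forall>V\<in>A. openin S V"
    "\<forall>U x. openin S U \<and> x \<in> U \<longrightarrow> (\<exists>V\<in>A. x \<in> V \<and> V \<subseteq> U)"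
    using S unfolding second_countable_def by (elim exE conjE)
  obtain B where B: "countable B" "\<forall>V\<in>B. openin T V"
    "\<forall>U x. openin T U \<and> x \<in> U \<longrightarrow> (\<exists>V\<in>B. x \<in> V \<and> V \<subseteq> U)"
    using T unfolding second_countable_def by (elim exE conjE)
  have "U \<in> sets (borel_of S \<Otimes>\<^sub>M borel_of T)" if U: "openin (prod_topology S T) U" for U
  proof -
    let ?R = "{p \<in> A \<times> B. fst p \<times> snd p \<subseteq> U}"
    have "U = (\<Union>p\<in>?R. fst p \<times> snd p)"
    proof (intro equalityI subsetI)
      fix z assume z: "z \<in> U"
      then obtain V W where "openin S V" "openin T W" "fst z \<in> V" "snd z \<in> W" "V \<times> W \<subseteq> U"
        using U unfolding openin_prod_topology_alt by (metis prod.collapse)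
      moreover from this obtain V' W' where
        "V' \<in> A" "fst z \<in> V'" "V' \<subseteq> V" "W' \<in> B" "snd z \<in> W'" "W' \<subseteq> W"
        using A(3) B(3) by meson
      ultimately have "(V', W') \<in> ?R" "z \<in> V' \<times> W'"
        by (auto simp: mem_Times_iff)
      then show "z \<in> (\<Union>p\<in>?R. fst p \<times> snd p)"
        by force
    qed auto
    moreover have "(\<Union>p\<in>?R. fst p \<times> snd p) \<in> sets (borel_of S \<Otimes>\<^sub>M borel_of T)"
    proof (rule sets.countable_UN'')
      show "countable ?R"
        using A(1) B(1) by (auto intro: countable_subset[of _ "A \<times> B"])
      show "fst p \<times> snd p \<in> sets (borel_of S \<Otimes>\<^sub>M borel_of T)" if "p \<in> ?R" for p
        using that A(2) B(2) by (intro pair_measureI openin_sets_borel_of) auto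
    qed
    ultimately show ?thesis
      by simp
  qed
  then have "sigma_sets (topspace (prod_topology S T)) {U. openin (prod_topology S T) U}
      \<subseteq> sets (borel_of S \<Otimes>\<^sub>M borel_of T)"
    by (intro sets.sigma_sets_subset'[of _ _ "topspace (prod_topology S T)"])
       (auto simp: openin_sets_borel_of intro!: pair_measureI)
  then show ?thesis
    by (simp add: sets_borel_of)
qed

lemma continuous_map_prod_measurable:
  assumes "second_countable S" "second_countable T" "continuous_map (prod_topology S T) Z f"
  shows "f \<in> borel_of S \<Otimes>\<^sub>M borel_of T \<rightarrow>\<^sub>M borel_of Z"
proof (rule measurable_into_borel_of)
  show "f x \<in> topspace Z" if "x \<in> space (borel_of S \<Otimes>\<^sub>M borel_of T)" for x
    using that assms(3) by (auto simp: continuous_map_def space_pair_measure)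
  show "f -` U \<inter> space (borel_of S \<Otimes>\<^sub>M borel_of T) \<in> sets (borel_of S \<Otimes>\<^sub>M borel_of T)"
    if "openin Z U" for U
    using measurable_sets[OF continuous_map_measurable[OF assms(3)] openin_sets_borel_of[OF that]]
      sets_borel_of_prod_topology[OF assms(1,2)]
    by (auto simp: space_pair_measure)
qed

section \<open>The Polish group of permutations\<close>

definition permutation_topology :: "(nat \<Rightarrow> nat) topology" where
  "permutation_topology = subtopology euclidean {\<pi>. bij \<pi>}"

lemma carrier_permutations [simp]: "carrier (BijGroup (UNIV :: 'a set)) = {\<pi>. bij \<pi>}"
  by (simp add: BijGroup_def Bij_def)

lemma mult_permutations: "bij \<pi> \<Longrightarrow> bij \<sigma> \<Longrightarrow> \<pi> \<otimes>\<^bsub>BijGroup UNIV\<^esub> \<sigma> = \<pi> \<circ> \<sigma>"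
  by (auto simp: BijGroup_def Bij_def compose_def)

lemma inv_permutations: "bij \<pi> \<Longrightarrow> inv\<^bsub>BijGroup UNIV\<^esub> \<pi> = inv_into UNIV \<pi>"
  by (subst inv_BijGroup) (auto simp: Bij_def)

text \<open>
  A permutation that agrees with \<open>\<pi>\<close> at \<open>\<pi>\<^sup>-\<^sup>1 n\<close> has the same preimage of \<open>n\<close>.
\<close>

lemma continuous_on_inv_permutation: "continuous_on {\<pi> :: nat \<Rightarrow> nat. bij \<pi>} (\<lambda>\<pi>. inv_into UNIV \<pi> n)"
  unfolding continuous_on_def
proof
  fix \<pi> :: "nat \<Rightarrow> nat" assume "\<pi> \<in> {\<pi>. bij \<pi>}"
  then have \<pi>: "bij \<pi>"
    by simp
  have "((\<lambda>\<sigma> :: nat \<Rightarrow> nat. \<sigma> (inv_into UNIV \<pi> n)) \<longlongrightarrow> \<pi> (inv_into UNIV \<pi> n)) (at \<pi> within {\<pi>. bij \<pi>})"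
  proof -
    have "continuous_on {\<pi>. bij \<pi>} (\<lambda>\<sigma> :: nat \<Rightarrow> nat. \<sigma> (inv_into UNIV \<pi> n))"
      by (rule continuous_on_subset[OF continuous_on_product_coordinates]) simp
    then show ?thesis
      unfolding continuous_on_def using \<pi> by simp
  qed
  then have "\<forall>\<^sub>F \<sigma> in at \<pi> within {\<pi>. bij \<pi>}. \<sigma> (inv_into UNIV \<pi> n) \<in> {n}"
    by (rule topological_tendstoD) (use \<pi> in \<open>auto simp: open_discrete bij_is_surj surj_f_inv_f\<close>)
  moreover have "\<forall>\<^sub>F \<sigma> in at \<pi> within {\<pi>. bij \<pi>}. bij \<sigma>"
    by (auto simp: eventually_at_filter)
  ultimately have "\<forall>\<^sub>F \<sigma> in at \<pi> within {\<pi>. bij \<pi>}. inv_into UNIV \<sigma> n = inv_into UNIV \<pi> n"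
    by eventually_elim (auto simp: bij_is_inj inv_f_eq)
  then show "((\<lambda>\<pi>. inv_into UNIV \<pi> n) \<longlongrightarrow> inv_into UNIV \<pi> n) (at \<pi> within {\<pi>. bij \<pi>})"
    by (rule tendsto_eventually)
qed

text \<open>
  Injectivity and surjectivity are countable intersections of open conditions.
\<close>

lemma polish_permutation_topology: "polish_topology permutation_topology"
proof -
  have "gdelta_in euclidean {\<pi> :: nat \<Rightarrow> nat. \<pi> i = \<pi> j \<longrightarrow> i = j}" for i j
  proof (cases "i = j")
    case False
    have "open {\<pi> :: nat \<Rightarrow> nat. \<pi> i \<noteq> \<pi> j}"
      by (intro open_Collect_neq continuous_on_product_coordinates)
    then show ?thesis
      using False by (simp add: open_imp_gdelta_in)
  qed (use gdelta_in_topspace[of euclidean] in simp)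
  moreover have "gdelta_in euclidean {\<pi> :: nat \<Rightarrow> nat. \<exists>i. \<pi> i = n}" for n
  proof -
    have "open ((\<lambda>\<pi> :: nat \<Rightarrow> nat. \<pi> i) -` {n})" for i
      by (rule open_vimage) (auto simp: open_discrete)
    then have "open {\<pi> :: nat \<Rightarrow> nat. \<exists>i. \<pi> i = n}"
      by (intro open_Collect_ex) (simp add: vimage_def)
    then show ?thesis
      by (simp add: open_imp_gdelta_in)
  qed
  ultimately have "gdelta_in euclidean ({\<pi> :: nat \<Rightarrow> nat. \<forall>i j. \<pi> i = \<pi> j \<longrightarrow> i = j} \<inter> {\<pi>. \<forall>n. \<exists>i. \<pi> i = n})"
    by (intro gdelta_in_Int gdelta_in_Collect_all)
  moreover have "{\<pi> :: nat \<Rightarrow> nat. \<forall>i j. \<pi> i = \<pi> j \<longrightarrow> i = j} \<inter> {\<pi>. \<forall>n. \<exists>i. \<pi> i = n} = {\<pi>. bij \<pi>}"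
    unfolding bij_def inj_def surj_def by (auto; metis)
  ultimately show ?thesis
    unfolding permutation_topology_def by (intro polish_subtopology_gdelta polish_baire_space) simp
qed

lemma polish_group_permutations: "polish_group (BijGroup UNIV) permutation_topology"
  unfolding polish_group_def
proof (intro conjI)
  let ?S = "{\<pi> :: nat \<Rightarrow> nat. bij \<pi>}"
  show "group (BijGroup (UNIV :: nat set))"
    by (rule group_BijGroup)
  show top: "topspace permutation_topology = carrier (BijGroup UNIV)"
    by (simp add: permutation_topology_def)
  show "polish_topology permutation_topology"
    by (rule polish_permutation_topology)
  have "continuous_on (?S \<times> ?S) (\<lambda>p. (\<lambda>n. fst p (snd p n)))"
  proof (rule continuous_on_coordinatewise_then_product)
    show "continuous_on (?S \<times> ?S) (\<lambda>p. fst p (snd p n))" for n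
      by (rule continuous_on_select[of _ "\<lambda>p. snd p n" "\<lambda>k p. fst p k"])
         (rule continuous_on_product_then_coordinatewise[OF continuous_on_snd[OF continuous_on_id]],
          rule continuous_on_product_then_coordinatewise[OF continuous_on_fst[OF continuous_on_id]])
  qed
  moreover have "bij (\<lambda>n. fst p (snd p n))" if "p \<in> ?S \<times> ?S" for p
    using that bij_comp[of "snd p" "fst p"] by (auto simp: o_def)
  ultimately have "continuous_map (prod_topology permutation_topology permutation_topology) permutation_topology
      (\<lambda>p. (\<lambda>n. fst p (snd p n)))"
    unfolding permutation_topology_def prod_topology_subtopology_eu continuous_map_subtopology_eu by blast
  then show "continuous_map (prod_topology permutation_topology permutation_topology) permutation_topology
      (\<lambda>(g, h). g \<otimes>\<^bsub>BijGroup UNIV\<^esub> h)"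
    by (rule continuous_map_eq) (auto simp: top mult_permutations)
  have "continuous_on ?S (\<lambda>\<pi>. inv_into UNIV \<pi>)"
    by (intro continuous_on_coordinatewise_then_product continuous_on_inv_permutation)
  then have "continuous_map permutation_topology permutation_topology (inv_into UNIV)"
    unfolding permutation_topology_def by (auto intro: bij_imp_bij_inv)
  then show "continuous_map permutation_topology permutation_topology (\<lambda>g. inv\<^bsub>BijGroup UNIV\<^esub> g)"
    by (rule continuous_map_eq) (auto simp: top inv_permutations)
qed

section \<open>Pseudometrics on the natural numbers\<close>

definition pseudometrics_on_nat :: "(nat \<times> nat \<Rightarrow> real) set" where
  "pseudometrics_on_nat = {f. (\<forall>i. f (i, i) = 0) \<and> (\<forall>i j. f (i, j) = f (j, i)) \<and>
    (\<forall>i j k. f (i, k) \<le> f (i, j) + f (j, k))}"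

abbreviation "pseudometrics_topology \<equiv> subtopology euclidean pseudometrics_on_nat"

definition sup_distance :: "('i \<Rightarrow> real) \<Rightarrow> ('i \<Rightarrow> real) \<Rightarrow> ennreal" where
  "sup_distance f g = (SUP p. ennreal \<bar>f p - g p\<bar>)"

text \<open>
  Group actions are required to be extensional, hence the restriction to pseudometrics.
\<close>

definition relabel :: "(nat \<Rightarrow> nat) \<Rightarrow> (nat \<times> nat \<Rightarrow> real) \<Rightarrow> nat \<times> nat \<Rightarrow> real" where
  "relabel \<pi> = (\<lambda>f\<in>pseudometrics_on_nat. \<lambda>(i, j). f (inv_into UNIV \<pi> i, inv_into UNIV \<pi> j))"

lemma closed_pseudometrics_on_nat: "closed pseudometrics_on_nat"
  unfolding pseudometrics_on_nat_def
  by (intro closed_Collect_conj closed_Collect_all closed_Collect_eq closed_Collect_le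
      continuous_intros continuous_on_product_coordinates)

lemma polish_pseudometrics_topology: "polish_topology pseudometrics_topology"
  by (rule polish_closed_subtopology[OF polish_euclidean]) (simp add: closed_pseudometrics_on_nat)

lemma sup_distance_le_iff:
  assumes "0 \<le> c"
  shows "sup_distance f g \<le> ennreal c \<longleftrightarrow> (\<forall>p. \<bar>f p - g p\<bar> \<le> c)"
  using assms by (simp add: sup_distance_def SUP_le_iff ennreal_le_iff)

lemma sup_distance_less_iff:
  "sup_distance f g < ennreal r \<longleftrightarrow> (\<exists>c. 0 \<le> c \<and> c < r \<and> (\<forall>p. \<bar>f p - g p\<bar> \<le> c))"
proof
  assume less: "sup_distance f g < ennreal r"
  then obtain c where c: "sup_distance f g = ennreal c" "0 \<le> c"
    by (cases "sup_distance f g") auto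
  then have "\<forall>p. \<bar>f p - g p\<bar> \<le> c"
    using sup_distance_le_iff[of c f g] by simp
  then show "\<exists>c. 0 \<le> c \<and> c < r \<and> (\<forall>p. \<bar>f p - g p\<bar> \<le> c)"
    using c less by (metis ennreal_less_iff)
next
  assume "\<exists>c. 0 \<le> c \<and> c < r \<and> (\<forall>p. \<bar>f p - g p\<bar> \<le> c)"
  then obtain c where c: "0 \<le> c" "c < r" "\<forall>p. \<bar>f p - g p\<bar> \<le> c"
    by blast
  then have "sup_distance f g \<le> ennreal c"
    by (simp add: sup_distance_le_iff)
  also have "\<dots> < ennreal r"
    using c by (simp add: ennreal_less_iff)
  finally show "sup_distance f g < ennreal r" .
qed

lemma pseudometric_on_sup_distance: "pseudometric_on S sup_distance"
  unfolding pseudometric_on_def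
proof (intro conjI ballI)
  show "sup_distance f f = 0" for f :: "'a \<Rightarrow> real"
    by (simp add: sup_distance_def)
  show "sup_distance f g = sup_distance g f" for f g :: "'a \<Rightarrow> real"
    by (simp add: sup_distance_def abs_minus_commute)
  show "sup_distance f h \<le> sup_distance f g + sup_distance g h" for f g h :: "'a \<Rightarrow> real"
    unfolding sup_distance_def[of f h]
  proof (rule SUP_least)
    fix p
    have "ennreal \<bar>f p - h p\<bar> \<le> ennreal (\<bar>f p - g p\<bar> + \<bar>g p - h p\<bar>)"
      by (intro ennreal_leI) simp
    also have "\<dots> = ennreal \<bar>f p - g p\<bar> + ennreal \<bar>g p - h p\<bar>"
      by (simp add: ennreal_plus)
    also have "\<dots> \<le> sup_distance f g + sup_distance g h"
      unfolding sup_distance_def by (intro add_mono SUP_upper) auto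
    finally show "ennreal \<bar>f p - h p\<bar> \<le> sup_distance f g + sup_distance g h" .
  qed
qed

lemma tendsto_sup_distanceI:
  assumes "\<And>\<epsilon>. \<epsilon> > 0 \<Longrightarrow> \<exists>N. \<forall>n\<ge>N. \<forall>p. \<bar>s n p - f p\<bar> \<le> \<epsilon>"
  shows "(\<lambda>n. sup_distance (s n) f) \<longlonglongrightarrow> 0"
proof (rule order_tendstoI)
  fix a :: ennreal assume "0 < a"
  then obtain b where "0 < b" "b < a"
    using dense by blast
  then obtain \<epsilon> where e: "\<epsilon> > 0" "ennreal \<epsilon> < a"
    by (cases b) auto
  obtain N where N: "\<And>n p. n \<ge> N \<Longrightarrow> \<bar>s n p - f p\<bar> \<le> \<epsilon>"
    using assms[OF e(1)] by blast
  have "sup_distance (s n) f < a" if "n \<ge> N" for n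
    using sup_distance_le_iff[of \<epsilon> "s n" f] e N[OF that] by (auto intro: order_le_less_trans)
  then show "\<forall>\<^sub>F n in sequentially. sup_distance (s n) f < a"
    using eventually_sequentially by blast
qed simp

lemma complete_sup_distance:
  assumes S: "closed (S :: ('i \<Rightarrow> real) set)"
  shows "complete_metric_on S sup_distance"
  unfolding complete_metric_on_def
proof (intro conjI ballI allI impI)
  show "pseudometric_on S sup_distance"
    by (rule pseudometric_on_sup_distance)
  show "f = g" if "sup_distance f g = 0" for f g :: "'i \<Rightarrow> real"
    using sup_distance_le_iff[of 0 f g] that by auto
  fix s :: "nat \<Rightarrow> 'i \<Rightarrow> real"
  assume s: "range s \<subseteq> S \<and> (\<forall>\<epsilon>::real. \<epsilon> > 0 \<longrightarrow> (\<exists>N. \<forall>m\<ge>N. \<forall>n\<ge>N. sup_distance (s m) (s n) < ennreal \<epsilon>))"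
  have cauchy: "\<exists>N. \<forall>m\<ge>N. \<forall>n\<ge>N. \<forall>p. \<bar>s m p - s n p\<bar> \<le> \<epsilon>" if "\<epsilon> > 0" for \<epsilon> :: real
  proof -
    have "\<exists>N. \<forall>m\<ge>N. \<forall>n\<ge>N. sup_distance (s m) (s n) < ennreal \<epsilon>"
      using s that by simp
    then obtain N where N: "\<forall>m\<ge>N. \<forall>n\<ge>N. sup_distance (s m) (s n) < ennreal \<epsilon>"
      by (rule exE)
    have "\<forall>p. \<bar>s m p - s n p\<bar> \<le> \<epsilon>" if "m \<ge> N" "n \<ge> N" for m n
      using N that sup_distance_le_iff[of \<epsilon> "s m" "s n"] \<open>\<epsilon> > 0\<close> by (simp add: less_imp_le)
    then show ?thesis
      by blast
  qed
  have "Cauchy (\<lambda>n. s n p)" for p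
  proof (rule metric_CauchyI)
    fix e :: real assume "e > 0"
    then obtain N where N: "\<And>m n p. m \<ge> N \<Longrightarrow> n \<ge> N \<Longrightarrow> \<bar>s m p - s n p\<bar> \<le> e / 2"
      using cauchy[of "e / 2"] by auto
    have "dist (s m p) (s n p) < e" if "m \<ge> N" "n \<ge> N" for m n
      using N[OF that, of p] \<open>e > 0\<close> by (simp add: dist_real_def)
    then have "\<forall>m\<ge>N. \<forall>n\<ge>N. dist (s m p) (s n p) < e"
      by blast
    then show "\<exists>M. \<forall>m\<ge>M. \<forall>n\<ge>M. dist (s m p) (s n p) < e"
      by blast
  qed
  then obtain f where f: "\<And>p. (\<lambda>n. s n p) \<longlonglongrightarrow> f p"
    unfolding Cauchy_convergent_iff convergent_def by metis
  have "f \<in> S"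
    by (rule closed_sequentially[OF S _ tendsto_coordinatewise[OF f]]) (use s in auto)
  moreover have "(\<lambda>n. sup_distance (s n) f) \<longlonglongrightarrow> 0"
  proof (rule tendsto_sup_distanceI)
    fix \<epsilon> :: real assume "\<epsilon> > 0"
    then obtain N where N: "\<And>m n p. m \<ge> N \<Longrightarrow> n \<ge> N \<Longrightarrow> \<bar>s m p - s n p\<bar> \<le> \<epsilon>"
      using cauchy by blast
    have "\<bar>s n p - f p\<bar> \<le> \<epsilon>" if "n \<ge> N" for n p
    proof (rule LIMSEQ_le_const2)
      show "(\<lambda>m. \<bar>s n p - s m p\<bar>) \<longlonglongrightarrow> \<bar>s n p - f p\<bar>"
        by (intro tendsto_intros f)
      show "\<exists>M. \<forall>m\<ge>M. \<bar>s n p - s m p\<bar> \<le> \<epsilon>"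
        using N[OF that] by blast
    qed
    then show "\<exists>N. \<forall>n\<ge>N. \<forall>p. \<bar>s n p - f p\<bar> \<le> \<epsilon>"
      by blast
  qed
  ultimately show "\<exists>x\<in>S. (\<lambda>n. sup_distance (s n) x) \<longlonglongrightarrow> 0"
    by blast
qed

lemma sup_distance_refines:
  assumes "openin (subtopology euclidean S) U"
  shows "openin (emetric_topology S sup_distance) U"
  unfolding openin_emetric_topology
proof (intro conjI ballI)
  obtain V where V: "open V" "U = S \<inter> V"
    using assms unfolding openin_open by blast
  then show "U \<subseteq> S"
    by blast
  fix f assume f: "f \<in> U"
  show "\<exists>\<epsilon>::real. \<epsilon> > 0 \<and> (\<forall>g\<in>S. sup_distance f g < ennreal \<epsilon> \<longrightarrow> g \<in> U)"
  proof (rule ccontr)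
    assume "\<not> ?thesis"
    then have "\<exists>g. g \<in> S \<and> sup_distance f g < ennreal (1 / Suc n) \<and> g \<notin> U" for n
      by (metis divide_pos_pos of_nat_0_less_iff zero_less_Suc zero_less_one)
    then obtain g where g: "\<And>n. g n \<in> S" "\<And>n. sup_distance f (g n) < ennreal (1 / Suc n)" "\<And>n. g n \<notin> U"
      by metis
    have "(\<lambda>n. g n p) \<longlonglongrightarrow> f p" for p
    proof (rule metric_LIMSEQ_I)
      fix e :: real assume "e > 0"
      then obtain N where N: "1 / Suc N < e"
        using nat_approx_posE by blast
      have "dist (g n p) (f p) < e" if "n \<ge> N" for n
      proof -
        have "\<bar>f p - g n p\<bar> \<le> 1 / Suc n"
          using less_imp_le[OF g(2)[of n]] sup_distance_le_iff[of "1 / Suc n" f "g n"] by simp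
        also have "\<dots> \<le> 1 / Suc N"
          using that by (simp add: frac_le)
        finally show ?thesis
          using N by (simp add: dist_real_def abs_minus_commute)
      qed
      then show "\<exists>N. \<forall>n\<ge>N. dist (g n p) (f p) < e"
        by blast
    qed
    then have "g \<longlonglongrightarrow> f"
      by (rule tendsto_coordinatewise)
    then have "\<forall>\<^sub>F n in sequentially. g n \<in> V"
      by (rule topological_tendstoD) (use V f in auto)
    then show False
      using g(1,3) V(2) by (auto simp: eventually_sequentially)
  qed
qed

section \<open>Relabelling pseudometrics by permutations\<close>

abbreviation "permutations \<equiv> BijGroup (UNIV :: nat set)"

abbreviation "pseudometrics_space \<equiv> borel_of pseudometrics_topology"

abbreviation "relabel_distance \<equiv> orbit_pseudometric permutations relabel sup_distance"

lemma relabel_apply: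
  "f \<in> pseudometrics_on_nat \<Longrightarrow> relabel \<pi> f = (\<lambda>(i, j). f (inv_into UNIV \<pi> i, inv_into UNIV \<pi> j))"
  by (simp add: relabel_def)

lemma relabel_closed: "f \<in> pseudometrics_on_nat \<Longrightarrow> relabel \<pi> f \<in> pseudometrics_on_nat"
  by (auto simp: relabel_apply pseudometrics_on_nat_def)

lemma relabel_comp:
  assumes "bij \<pi>" "bij \<sigma>" "f \<in> pseudometrics_on_nat"
  shows "relabel (\<pi> \<circ> \<sigma>) f = relabel \<pi> (relabel \<sigma> f)"
  unfolding relabel_apply[OF relabel_closed[OF assms(3)]]
  using assms by (simp add: relabel_apply o_inv_distrib fun_eq_iff)

lemma relabel_id: "f \<in> pseudometrics_on_nat \<Longrightarrow> relabel id f = f"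
  by (auto simp: relabel_apply)

lemma relabel_Bij:
  assumes "bij \<pi>"
  shows "relabel \<pi> \<in> Bij pseudometrics_on_nat"
proof -
  have inv: "bij (inv_into UNIV \<pi>)" "inv_into UNIV \<pi> \<circ> \<pi> = id" "\<pi> \<circ> inv_into UNIV \<pi> = id"
    using assms by (auto simp: bij_imp_bij_inv bij_is_inj fun_eq_iff bij_is_surj surj_f_inv_f)
  have "bij_betw (relabel \<pi>) pseudometrics_on_nat pseudometrics_on_nat"
  proof (rule bij_betwI[of _ _ _ "relabel (inv_into UNIV \<pi>)"])
    show "relabel (inv_into UNIV \<pi>) (relabel \<pi> f) = f" if "f \<in> pseudometrics_on_nat" for f
      using relabel_comp[OF inv(1) assms that] inv(2) relabel_id[OF that] by simp
    show "relabel \<pi> (relabel (inv_into UNIV \<pi>) f) = f" if "f \<in> pseudometrics_on_nat" for f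
      using relabel_comp[OF assms inv(1) that] inv(3) relabel_id[OF that] by simp
  qed (auto simp: relabel_closed)
  then show ?thesis
    by (simp add: Bij_def relabel_def)
qed

lemma group_action_relabel: "group_action permutations pseudometrics_on_nat relabel"
proof (rule group_action.intro, rule group_hom.intro[OF group_BijGroup group_BijGroup], unfold_locales)
  show "relabel \<in> hom permutations (BijGroup pseudometrics_on_nat)"
  proof (rule homI)
    show "relabel \<pi> \<in> carrier (BijGroup pseudometrics_on_nat)" if "\<pi> \<in> carrier permutations" for \<pi>
      using relabel_Bij that by (simp add: BijGroup_def Bij_def)
    show "relabel (\<pi> \<otimes>\<^bsub>permutations\<^esub> \<sigma>) = relabel \<pi> \<otimes>\<^bsub>BijGroup pseudometrics_on_nat\<^esub> relabel \<sigma>"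
      if "\<pi> \<in> carrier permutations" "\<sigma> \<in> carrier permutations" for \<pi> \<sigma>
    proof -
      have "relabel (\<pi> \<circ> \<sigma>) = compose pseudometrics_on_nat (relabel \<pi>) (relabel \<sigma>)"
      proof
        fix f show "relabel (\<pi> \<circ> \<sigma>) f = compose pseudometrics_on_nat (relabel \<pi>) (relabel \<sigma>) f"
        proof (cases "f \<in> pseudometrics_on_nat")
          case True
          then show ?thesis
            using relabel_comp that by (simp add: compose_def)
        next
          case False
          then show ?thesis
            by (simp add: relabel_def compose_def)
        qed
      qed
      then show ?thesis
        using that relabel_Bij by (simp add: mult_permutations) (simp add: BijGroup_def)
    qed
  qed
qed

lemma isometric_relabel:
  assumes "bij \<pi>" "f \<in> pseudometrics_on_nat" "g \<in> pseudometrics_on_nat"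
  shows "sup_distance (relabel \<pi> f) (relabel \<pi> g) = sup_distance f g"
proof -
  let ?h = "\<lambda>(i, j). (inv_into UNIV \<pi> i, inv_into UNIV \<pi> j)"
  have "surj ?h"
    by (rule surjI[of _ "\<lambda>(i, j). (\<pi> i, \<pi> j)"]) (use assms(1) in \<open>auto simp: bij_is_inj\<close>)
  then have "sup_distance f g = (SUP p\<in>range ?h. ennreal \<bar>f p - g p\<bar>)"
    by (simp add: sup_distance_def)
  also have "\<dots> = sup_distance (relabel \<pi> f) (relabel \<pi> g)"
    unfolding sup_distance_def image_image using assms(2,3) by (simp add: relabel_apply case_prod_unfold)
  finally show ?thesis
    by simp
qed

interpretation relabel: isometric_action permutations pseudometrics_on_nat relabel sup_distance
  using group_action_relabel pseudometric_on_sup_distance isometric_relabel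
  by (auto simp: isometric_action_def isometric_action_axioms_def)

lemma relabel_distance_less_iff:
  assumes "f \<in> pseudometrics_on_nat" "g \<in> pseudometrics_on_nat"
  shows "relabel_distance f g < ennreal r \<longleftrightarrow>
    (\<exists>h c. bij h \<and> 0 \<le> c \<and> c < r \<and> (\<forall>i j. \<bar>f (i, j) - g (h i, h j)\<bar> \<le> c))"
proof -
  have "relabel_distance f g < ennreal r \<longleftrightarrow> (\<exists>\<pi>. bij \<pi> \<and> sup_distance f (relabel \<pi> g) < ennreal r)"
    using relabel.orbit_pseudometric_less_iff[OF assms] by auto
  also have "\<dots> \<longleftrightarrow> (\<exists>\<pi> c. bij \<pi> \<and> 0 \<le> c \<and> c < r \<and>
      (\<forall>i j. \<bar>f (i, j) - g (inv_into UNIV \<pi> i, inv_into UNIV \<pi> j)\<bar> \<le> c))"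
    unfolding sup_distance_less_iff using assms by (simp add: relabel_apply)
  also have "\<dots> \<longleftrightarrow> (\<exists>h c. bij h \<and> 0 \<le> c \<and> c < r \<and> (\<forall>i j. \<bar>f (i, j) - g (h i, h j)\<bar> \<le> c))" (is "?L \<longleftrightarrow> ?R")
  proof
    assume ?L
    then show ?R
      using bij_imp_bij_inv by blast
  next
    assume ?R
    then obtain h c where hc: "bij h" "0 \<le> c" "c < r" "\<forall>i j. \<bar>f (i, j) - g (h i, h j)\<bar> \<le> c"
      by blast
    show ?L
      by (rule exI[of _ "inv_into UNIV h"], rule exI[of _ c])
         (use hc in \<open>simp add: bij_imp_bij_inv inv_inv_eq\<close>)
  qed
  finally show ?thesis .
qed

lemma continuous_relabel:
  "continuous_map (prod_topology permutation_topology pseudometrics_topology) pseudometrics_topology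
     (\<lambda>(\<pi>, f). relabel \<pi> f)"
proof -
  let ?S = "{\<pi> :: nat \<Rightarrow> nat. bij \<pi>} \<times> pseudometrics_on_nat"
  have inv: "continuous_on ?S (\<lambda>z. inv_into UNIV (fst z) n)" for n
    by (rule continuous_on_compose2[OF continuous_on_inv_permutation continuous_on_fst[OF continuous_on_id]]) auto
  have "continuous_on ?S (\<lambda>z. snd z (inv_into UNIV (fst z) (fst p), inv_into UNIV (fst z) (snd p)))"
    for p :: "nat \<times> nat"
  proof (rule continuous_on_select[of _ "\<lambda>z. inv_into UNIV (fst z) (fst p)"
        "\<lambda>a z. snd z (a, inv_into UNIV (fst z) (snd p))", OF inv])
    fix a
    show "continuous_on ?S (\<lambda>z. snd z (a, inv_into UNIV (fst z) (snd p)))"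
      by (rule continuous_on_select[of _ "\<lambda>z. inv_into UNIV (fst z) (snd p)" "\<lambda>b z. snd z (a, b)", OF inv])
         (rule continuous_on_product_then_coordinatewise[OF continuous_on_snd[OF continuous_on_id]])
  qed
  then have "continuous_on ?S (\<lambda>z p. snd z (inv_into UNIV (fst z) (fst p), inv_into UNIV (fst z) (snd p)))"
    by (rule continuous_on_coordinatewise_then_product)
  moreover have eq: "relabel (fst z) (snd z) =
      (\<lambda>p. snd z (inv_into UNIV (fst z) (fst p), inv_into UNIV (fst z) (snd p)))" if "z \<in> ?S" for z
    using that by (auto simp: relabel_apply case_prod_unfold)
  ultimately have "continuous_on ?S (\<lambda>z. relabel (fst z) (snd z))"
    using continuous_on_cong[OF refl eq] by simp
  then show ?thesis
    unfolding permutation_topology_def prod_topology_subtopology_eu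
    by (auto simp: case_prod_unfold relabel_closed)
qed

lemma standard_borel_pseudometrics: "standard_borel pseudometrics_space"
  unfolding standard_borel_def
  by (intro exI[of _ pseudometrics_topology]) (simp add: polish_pseudometrics_topology)

lemma space_pseudometrics: "space pseudometrics_space = pseudometrics_on_nat"
  by simp

text \<open>
  Countably many bounds cofinal in the interval from \<open>0\<close> to \<open>r\<close>; they turn the strict inequality
  with \<open>r\<close> into a countable union of closed conditions.
\<close>

definition level :: "real \<Rightarrow> nat \<Rightarrow> real" where
  "level r n = r * (n / (n + 1))"

lemma ex_less_iff_level:
  assumes r: "r > 0" and mono: "\<And>c c'. c \<le> c' \<Longrightarrow> P c \<Longrightarrow> P c'"
  shows "(\<exists>c. 0 \<le> c \<and> c < r \<and> P c) \<longleftrightarrow> (\<exists>n. P (level r n))"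
proof
  assume "\<exists>c. 0 \<le> c \<and> c < r \<and> P c"
  then obtain c where c: "0 \<le> c" "c < r" "P c"
    by blast
  have "c / r < 1"
    using c r by simp
  then obtain n where n: "1 / Suc n < 1 - c / r"
    using nat_approx_posE[of "1 - c / r"] by auto
  have "1 - 1 / Suc n = real n / (real n + 1)"
    by (simp add: field_simps)
  then have "c / r \<le> real n / (real n + 1)"
    using n by linarith
  then have "c \<le> level r n"
    unfolding level_def using r by (simp add: divide_le_eq mult.commute)
  then show "\<exists>n. P (level r n)"
    using mono c(3) by blast
next
  assume "\<exists>n. P (level r n)"
  then obtain n where "P (level r n)"
    by blast
  moreover have "0 \<le> level r n"
    using r by (simp add: level_def)
  moreover have "r * (real n / (real n + 1)) < r * 1"
    using r by (intro mult_strict_left_mono) auto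
  then have "level r n < r"
    by (simp add: level_def)
  ultimately show "\<exists>c. 0 \<le> c \<and> c < r \<and> P c"
    by blast
qed

lemma ex_nat_iff_ex_seq: "(\<exists>n. P n) \<longleftrightarrow> (\<exists>n :: nat \<Rightarrow> nat. P (n 0))"
proof
  assume "\<exists>n. P n"
  then obtain n where "P n"
    by blast
  then show "\<exists>n :: nat \<Rightarrow> nat. P (n 0)"
    by (intro exI[of _ "\<lambda>_. n"])
qed blast

lemma bij_iff_inverse: "bij h \<longleftrightarrow> (\<exists>k. (\<forall>i. h (k i) = i) \<and> (\<forall>i. k (h i) = i))"
proof
  assume "bij h"
  then show "\<exists>k. (\<forall>i. h (k i) = i) \<and> (\<forall>i. k (h i) = i)"
    by (intro exI[of _ "inv_into UNIV h"]) (auto simp: bij_is_inj bij_is_surj surj_f_inv_f)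
next
  assume "\<exists>k. (\<forall>i. h (k i) = i) \<and> (\<forall>i. k (h i) = i)"
  then show "bij h"
    by (metis bijI' )
qed

lemma continuous_coordinates:
  "continuous_on UNIV (\<lambda>z :: (('i \<Rightarrow> real) \<times> ('i \<Rightarrow> real)) \<times> 'c::topological_space. fst (fst z) p)"
  "continuous_on UNIV (\<lambda>z :: (('i \<Rightarrow> real) \<times> ('i \<Rightarrow> real)) \<times> 'c. snd (fst z) p)"
  "continuous_on UNIV (\<lambda>z :: 'c \<times> ((nat \<Rightarrow> nat) \<times> (nat \<Rightarrow> nat)) \<times> (nat \<Rightarrow> nat). fst (fst (snd z)) i)"
  "continuous_on UNIV (\<lambda>z :: 'c \<times> ((nat \<Rightarrow> nat) \<times> (nat \<Rightarrow> nat)) \<times> (nat \<Rightarrow> nat). snd (fst (snd z)) i)"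
  "continuous_on UNIV (\<lambda>z :: 'c \<times> ((nat \<Rightarrow> nat) \<times> (nat \<Rightarrow> nat)) \<times> (nat \<Rightarrow> nat). snd (snd z) i)"
  by (rule continuous_on_product_then_coordinatewise,
      intro continuous_on_fst continuous_on_snd continuous_on_id)+

lemma continuous_level:
  fixes k :: "'a::topological_space \<Rightarrow> nat"
  assumes "continuous_on S k"
  shows "continuous_on S (\<lambda>z. level r (k z))"
  by (rule continuous_on_select[OF assms, of "\<lambda>n z. level r n"]) simp

lemma continuous_entry:
  fixes f :: "'a::topological_space \<Rightarrow> 'i::discrete_topology \<times> 'j::discrete_topology \<Rightarrow> 'b::topological_space"
  assumes "\<And>p. continuous_on S (\<lambda>z. f z p)" "continuous_on S a" "continuous_on S b"
  shows "continuous_on S (\<lambda>z. f z (a z, b z))"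
  by (rule continuous_on_select[OF assms(2), of "\<lambda>i z. f z (i, b z)"],
      rule continuous_on_select[OF assms(3), of "\<lambda>j z. f z (_, j)"], rule assms(1))

text \<open>
  All distances below are analytic for the same reason: they are less than \<open>r\<close> iff, for some
  \<open>c < r\<close>, there are maps \<open>s\<close> and \<open>t\<close> of \<open>\<nat>\<close> to itself that satisfy a closed condition.
\<close>

lemma analytic_pseudometric_of_closed:
  fixes A :: "('i::countable \<Rightarrow> real) set"
  assumes A: "polish_topology (subtopology euclidean A)" and pm: "pseudometric_on A \<rho>"
    and less: "\<And>f g r. f \<in> A \<Longrightarrow> g \<in> A \<Longrightarrow>
      \<rho> f g < ennreal r \<longleftrightarrow> (\<exists>s t c. 0 \<le> c \<and> c < r \<and> P f g s t c)"
    and mono: "\<And>f g s t c c'. c \<le> c' \<Longrightarrow> P f g s t c \<Longrightarrow> P f g s t c'"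
    and closed: "\<And>r. closed {z :: 'i witnessed_pair. P (fst (fst z)) (snd (fst z))
      (fst (fst (snd z))) (snd (fst (snd z))) (level r (snd (snd z) 0))}"
  shows "analytic_pseudometric (borel_of (subtopology euclidean A)) \<rho>"
  unfolding analytic_pseudometric_def
proof (intro conjI allI impI)
  let ?X = "borel_of (subtopology euclidean A)"
  have space: "space ?X = A"
    by simp
  show "standard_borel ?X"
    unfolding standard_borel_def by (intro exI[of _ "subtopology euclidean A"]) (simp add: A)
  show "pseudometric_on (space ?X) \<rho>"
    using pm by simp
  fix r :: real assume r: "r > 0"
  have "\<rho> f g < ennreal r \<longleftrightarrow> (\<exists>s t (n :: nat \<Rightarrow> nat). P f g s t (level r (n 0)))"
    if fg: "f \<in> A" "g \<in> A" for f g
  proof -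
    have "\<rho> f g < ennreal r \<longleftrightarrow> (\<exists>s t. \<exists>c. 0 \<le> c \<and> c < r \<and> P f g s t c)"
      by (rule less[OF fg])
    also have "\<dots> \<longleftrightarrow> (\<exists>s t. \<exists>n. P f g s t (level r n))"
      using ex_less_iff_level[OF r, of "P f g _ _", OF mono] by simp
    also have "\<dots> \<longleftrightarrow> (\<exists>s t (n :: nat \<Rightarrow> nat). P f g s t (level r (n 0)))"
      unfolding ex_nat_iff_ex_seq[of "\<lambda>n. P f g _ _ (level r n)"] ..
    finally show ?thesis .
  qed
  then have "{(f, g). f \<in> space ?X \<and> g \<in> space ?X \<and> \<rho> f g < ennreal r} =
      {(f, g). f \<in> A \<and> g \<in> A \<and> (\<exists>s t n. ((f, g), (s, t), n) \<in> {z :: 'i witnessed_pair. P (fst (fst z)) (snd (fst z))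
        (fst (fst (snd z))) (snd (fst (snd z))) (level r (snd (snd z) 0))})}"
    unfolding space by (simp cong: conj_cong)
  then show "analytic_in (?X \<Otimes>\<^sub>M ?X) {(f, g). f \<in> space ?X \<and> g \<in> space ?X \<and> \<rho> f g < ennreal r}"
    using analytic_in_parametrized[OF A closed] by simp
qed

lemma analytic_pseudometric_sup_distance: "analytic_pseudometric pseudometrics_space sup_distance"
proof (rule analytic_pseudometric_of_closed[where P = "\<lambda>f g s t c. \<forall>p. \<bar>f p - g p\<bar> \<le> c"])
  show "closed {z :: (nat \<times> nat) witnessed_pair.
      \<forall>p. \<bar>fst (fst z) p - snd (fst z) p\<bar> \<le> level r (snd (snd z) 0)}" for r
    by (intro closed_Collect_all closed_Collect_le continuous_intros continuous_level continuous_coordinates)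
qed (auto simp: polish_pseudometrics_topology pseudometric_on_sup_distance sup_distance_less_iff
    intro: order_trans)

lemma CTR_setting_relabel:
  "CTR_setting permutations permutation_topology pseudometrics_space relabel sup_distance"
proof -
  have "(\<lambda>(\<pi>, f). relabel \<pi> f) \<in>
      borel_of permutation_topology \<Otimes>\<^sub>M pseudometrics_space \<rightarrow>\<^sub>M pseudometrics_space"
    by (intro continuous_map_prod_measurable continuous_relabel polish_imp_second_countable
        polish_permutation_topology polish_pseudometrics_topology)
  then have "orbit_setting permutations permutation_topology pseudometrics_space relabel sup_distance"
    unfolding orbit_setting_def standard_borel_G_space_def
    using polish_group_permutations standard_borel_pseudometrics group_action_relabel
      analytic_pseudometric_sup_distance isometric_relabel by simp
  moreover have "complete_metric_on (space pseudometrics_space) sup_distance"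
    by (simp add: complete_sup_distance closed_pseudometrics_on_nat)
  ultimately show ?thesis
    unfolding CTR_setting_def using polish_pseudometrics_topology continuous_relabel sup_distance_refines
    by (intro conjI exI[of _ pseudometrics_topology]) auto
qed

text \<open>
  A permutation is witnessed by a pair of maps that are inverse to each other, which is a closed
  condition.
\<close>

lemma analytic_pseudometric_relabel_distance:
  "analytic_pseudometric pseudometrics_space relabel_distance"
proof (rule analytic_pseudometric_of_closed[where P = "\<lambda>f g s t c.
    (\<forall>i. s (t i) = i) \<and> (\<forall>i. t (s i) = i) \<and> (\<forall>i j. \<bar>f (i, j) - g (s i, s j)\<bar> \<le> c)"])
  show "relabel_distance f g < ennreal r \<longleftrightarrow> (\<exists>s t c. 0 \<le> c \<and> c < r \<and>
      (\<forall>i. s (t i) = i) \<and> (\<forall>i. t (s i) = i) \<and> (\<forall>i j. \<bar>f (i, j) - g (s i, s j)\<bar> \<le> c))"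
    if "f \<in> pseudometrics_on_nat" "g \<in> pseudometrics_on_nat" for f g r
    unfolding relabel_distance_less_iff[OF that] bij_iff_inverse by blast
  show "closed {z :: (nat \<times> nat) witnessed_pair.
      (\<forall>i. fst (fst (snd z)) (snd (fst (snd z)) i) = i) \<and> (\<forall>i. snd (fst (snd z)) (fst (fst (snd z)) i) = i) \<and>
      (\<forall>i j. \<bar>fst (fst z) (i, j) - snd (fst z) (fst (fst (snd z)) i, fst (fst (snd z)) j)\<bar> \<le> level r (snd (snd z) 0))}" for r
    by (intro closed_Collect_conj closed_Collect_all closed_Collect_le closed_Collect_eq continuous_on_const
        continuous_on_rabs continuous_on_diff continuous_level continuous_coordinates
        continuous_on_select[OF continuous_coordinates(3), of "\<lambda>i z. snd (fst (snd z)) i"]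
        continuous_on_select[OF continuous_coordinates(4), of "\<lambda>i z. fst (fst (snd z)) i"]
        continuous_entry[of _ "\<lambda>z. snd (fst z)"])
qed (simp_all add: polish_pseudometrics_topology relabel.pseudometric_on_orbit_pseudometric, meson order_trans)

section \<open>The Gromov-Hausdorff distance and correspondences\<close>

definition correspondence :: "('a \<Rightarrow> 'b \<Rightarrow> bool) \<Rightarrow> bool" where
  "correspondence R \<longleftrightarrow> (\<forall>x. \<exists>y. R x y) \<and> (\<forall>y. \<exists>x. R x y)"

definition distortion_le ::
  "('a \<Rightarrow> 'a \<Rightarrow> real) \<Rightarrow> ('b \<Rightarrow> 'b \<Rightarrow> real) \<Rightarrow> ('a \<Rightarrow> 'b \<Rightarrow> bool) \<Rightarrow> real \<Rightarrow> bool" where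
  "distortion_le dM dN R c \<longleftrightarrow>
    (\<forall>x y x' y'. R x y \<and> R x' y' \<longrightarrow> \<bar>dM x x' - dN y y'\<bar> \<le> c)"

text \<open>
  In a common space, relate the points whose images have distance less than \<open>q\<close>.
\<close>

lemma correspondence_of_Hausdorff_distance:
  assumes Z: "Metric_space Z D"
    and i: "isometric_embedding UNIV dM Z D i" and j: "isometric_embedding UNIV dN Z D j"
    and less: "Hausdorff_distance D (range i) (range j) < ennreal r"
  obtains R q where "0 \<le> q" "q < r" "correspondence R" "distortion_le dM dN R (2 * q)"
proof -
  interpret Metric_space Z D
    by (rule Z)
  have iZ: "i x \<in> Z" and jZ: "j y \<in> Z" for x y
    using i j unfolding isometric_embedding_def by blast+
  have iD: "D (i x) (i x') = dM x x'" and jD: "D (j y) (j y') = dN y y'" for x x' y y'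
    using i j unfolding isometric_embedding_def by simp_all
  obtain c where c: "Hausdorff_distance D (range i) (range j) < c" "c < ennreal r"
    using dense[OF less] by blast
  then obtain q where q: "c = ennreal q" "0 \<le> q"
    by (cases c) auto
  have "q < r"
    using c(2) q by (metis ennreal_less_iff)
  define R where "R x y \<longleftrightarrow> D (i x) (j y) < q" for x y
  have "\<exists>y. R x y" for x
  proof -
    have "(INF b\<in>range j. ennreal (D (i x) b)) \<le> (SUP a\<in>range i. INF b\<in>range j. ennreal (D a b))"
      by (intro SUP_upper) auto
    also have "\<dots> < c"
      using c(1) unfolding Hausdorff_distance_def by simp
    finally show ?thesis
      unfolding INF_less_iff q(1) R_def using nonneg by (auto simp: ennreal_less_iff)
  qed
  moreover have "\<exists>x. R x y" for y
  proof -
    have "(INF a\<in>range i. ennreal (D a (j y))) \<le> (SUP b\<in>range j. INF a\<in>range i. ennreal (D a b))"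
      by (intro SUP_upper) auto
    also have "\<dots> < c"
      using c(1) unfolding Hausdorff_distance_def by simp
    finally show ?thesis
      unfolding INF_less_iff q(1) R_def using nonneg by (auto simp: ennreal_less_iff)
  qed
  ultimately have "correspondence R"
    by (simp add: correspondence_def)
  moreover have "distortion_le dM dN R (2 * q)"
    unfolding distortion_le_def
  proof (intro allI impI)
    fix x y x' y' assume "R x y \<and> R x' y'"
    then have "D (i x) (j y) < q" "D (i x') (j y') < q"
      by (simp_all add: R_def)
    moreover have "D (i x) (i x') \<le> D (i x) (j y) + (D (j y) (j y') + D (j y') (i x'))"
      using triangle[OF iZ[of x] jZ[of y] iZ[of x']] triangle[OF jZ[of y] jZ[of y'] iZ[of x']] by linarith
    moreover have "D (j y) (j y') \<le> D (j y) (i x) + (D (i x) (i x') + D (i x') (j y'))"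
      using triangle[OF jZ[of y] iZ[of x] jZ[of y']] triangle[OF iZ[of x] iZ[of x'] jZ[of y']] by linarith
    ultimately show "\<bar>dM x x' - dN y y'\<bar> \<le> 2 * q"
      using commute[of "i x" "j y"] commute[of "i x'" "j y'"] iD jD by (simp add: abs_le_iff)
  qed
  ultimately show ?thesis
    using that q(2) \<open>q < r\<close> by blast
qed

text \<open>
  Conversely, a correspondence of distortion at most \<open>2 * q\<close> allows one to glue the two spaces
  together: related points are joined by a bridge of length \<open>q\<close>, and other points take the shortest
  way over a bridge. The bound on the distortion is what prevents such a way from being a
  shortcut between two points of one space.
\<close>

context
  fixes dM :: "'a \<Rightarrow> 'a \<Rightarrow> real" and dN :: "'b \<Rightarrow> 'b \<Rightarrow> real" and R :: "'a \<Rightarrow> 'b \<Rightarrow> bool" and q :: real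
  assumes M: "Metric_space UNIV dM" and N: "Metric_space UNIV dN"
    and R: "correspondence R" "distortion_le dM dN R (2 * q)" and q: "q > 0"
begin

interpretation M: Metric_space UNIV dM
  by (rule M)

interpretation N: Metric_space UNIV dN
  by (rule N)

definition bridge :: "'a \<Rightarrow> 'b \<Rightarrow> real" where
  "bridge x y = (INF (x', y')\<in>{(x', y'). R x' y'}. dM x x' + q + dN y' y)"

fun glued :: "'a + 'b \<Rightarrow> 'a + 'b \<Rightarrow> real" where
  "glued (Inl x) (Inl x') = dM x x'"
| "glued (Inr y) (Inr y') = dN y y'"
| "glued (Inl x) (Inr y) = bridge x y"
| "glued (Inr y) (Inl x) = bridge x y"

lemma bridge_le: "R x' y' \<Longrightarrow> bridge x y \<le> dM x x' + q + dN y' y"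
  unfolding bridge_def
  by (rule cINF_lower2[of _ _ "(x', y')"])
     (auto intro!: bdd_belowI[of _ 0] add_nonneg_nonneg less_imp_le[OF q])

lemma le_bridge:
  assumes "\<And>x' y'. R x' y' \<Longrightarrow> c \<le> dM x x' + q + dN y' y"
  shows "c \<le> bridge x y"
proof -
  have "{(x', y'). R x' y'} \<noteq> {}"
    using R(1) unfolding correspondence_def by auto
  then show ?thesis
    unfolding bridge_def by (rule cINF_greatest) (use assms in auto)
qed

lemma bridge_pos: "bridge x y > 0"
  using le_bridge[of q x y] q by (auto intro: order_less_le_trans)

lemma distortion: "R x y \<Longrightarrow> R x' y' \<Longrightarrow> dM x x' \<le> dN y y' + 2 * q \<and> dN y y' \<le> dM x x' + 2 * q"
  using R(2) unfolding distortion_le_def abs_le_iff by (smt (verit))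

lemma bridge_triangle_left: "bridge x y \<le> dM x z + bridge z y"
proof -
  have "bridge x y - dM x z \<le> bridge z y"
  proof (rule le_bridge)
    show "bridge x y - dM x z \<le> dM z x' + q + dN y' y" if "R x' y'" for x' y'
      using bridge_le[OF that, of x y] M.triangle[of x z x'] by simp
  qed
  then show ?thesis
    by simp
qed

lemma bridge_triangle_right: "bridge x y \<le> bridge x z + dN z y"
proof -
  have "bridge x y - dN z y \<le> bridge x z"
  proof (rule le_bridge)
    show "bridge x y - dN z y \<le> dM x x' + q + dN y' z" if "R x' y'" for x' y'
      using bridge_le[OF that, of x y] N.triangle[of y' z y] by simp
  qed
  then show ?thesis
    by simp
qed

text \<open>
  Two bridges \<open>(a, a')\<close> and \<open>(b, b')\<close> have total length \<open>2 * q\<close>, and this makes up for the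
  difference between the distances of \<open>a, b\<close> and of \<open>a', b'\<close>.
\<close>

lemma bridge_triangle_M: "dM x x' \<le> bridge x y + bridge x' y"
proof -
  have "dM x x' - bridge x y \<le> bridge x' y"
  proof (rule le_bridge)
    fix b b' assume b: "R b b'"
    have "dM x x' - (dM x' b + q + dN b' y) \<le> bridge x y"
    proof (rule le_bridge)
      fix a a' assume a: "R a a'"
      have "dM x x' \<le> dM x a + dM a b + dM b x'"
        using M.triangle[of x a x'] M.triangle[of a b x'] by simp
      moreover have "dM a b \<le> dN a' y + dN y b' + 2 * q"
        using distortion[OF a b] N.triangle[of a' y b'] by simp
      ultimately show "dM x x' - (dM x' b + q + dN b' y) \<le> dM x a + q + dN a' y"
        using M.commute[of b x'] N.commute[of y b'] by simp
    qed
    then show "dM x x' - bridge x y \<le> dM x' b + q + dN b' y"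
      by simp
  qed
  then show ?thesis
    by simp
qed

lemma bridge_triangle_N: "dN y y' \<le> bridge x y + bridge x y'"
proof -
  have "dN y y' - bridge x y \<le> bridge x y'"
  proof (rule le_bridge)
    fix b b' assume b: "R b b'"
    have "dN y y' - (dM x b + q + dN b' y') \<le> bridge x y"
    proof (rule le_bridge)
      fix a a' assume a: "R a a'"
      have "dN y y' \<le> dN y a' + dN a' b' + dN b' y'"
        using N.triangle[of y a' y'] N.triangle[of a' b' y'] by simp
      moreover have "dN a' b' \<le> dM a x + dM x b + 2 * q"
        using distortion[OF a b] M.triangle[of a x b] by simp
      ultimately show "dN y y' - (dM x b + q + dN b' y') \<le> dM x a + q + dN a' y"
        using M.commute[of a x] N.commute[of y a'] by simp
    qed
    then show "dN y y' - bridge x y \<le> dM x b + q + dN b' y'"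
      by simp
  qed
  then show ?thesis
    by simp
qed

lemma Metric_space_glued: "Metric_space UNIV glued"
proof
  show "0 \<le> glued s t" for s t
    by (cases s; cases t) (auto simp: less_imp_le[OF bridge_pos])
  show "glued s t = glued t s" for s t
    by (cases s; cases t) (auto simp: M.commute N.commute)
  show "glued s t = 0 \<longleftrightarrow> s = t" for s t
    by (cases s; cases t) (auto simp: less_imp_neq[OF bridge_pos, symmetric])
  show "glued s u \<le> glued s t + glued t u" for s t u
  proof (cases s; cases t; cases u)
    fix x z y assume "s = Inr x" "t = Inl z" "u = Inl y"
    then show ?thesis
      using bridge_triangle_left[of y x z] M.commute[of y z] by simp
  next
    fix x z y assume "s = Inr x" "t = Inr z" "u = Inl y"
    then show ?thesis
      using bridge_triangle_right[of y x z] N.commute[of z x] by simp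
  qed (auto simp: M.triangle N.triangle bridge_triangle_left bridge_triangle_right bridge_triangle_M bridge_triangle_N)
qed

lemma Gromov_Hausdorff_distance_le_of_correspondence:
  "Gromov_Hausdorff_distance UNIV dM UNIV dN \<le> ennreal q"
proof -
  have bridge_q: "bridge x y \<le> q" if "R x y" for x y
    using bridge_le[OF that, of x y] by simp
  have "Hausdorff_distance glued (range Inl) (range Inr) \<le> ennreal q"
    unfolding Hausdorff_distance_def
  proof (intro max.boundedI SUP_least)
    fix a :: "'a + 'b" assume "a \<in> range Inl"
    then obtain x where x: "a = Inl x"
      by blast
    obtain y where "R x y"
      using R(1) unfolding correspondence_def by blast
    then show "(INF b\<in>range Inr. ennreal (glued a b)) \<le> ennreal q"
      by (intro INF_lower2[of "Inr y"]) (auto simp: x bridge_q ennreal_leI)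
  next
    fix b :: "'a + 'b" assume "b \<in> range Inr"
    then obtain y where y: "b = Inr y"
      by blast
    obtain x where "R x y"
      using R(1) unfolding correspondence_def by blast
    then show "(INF a\<in>range Inl. ennreal (glued a b)) \<le> ennreal q"
      by (intro INF_lower2[of "Inl x"]) (auto simp: y bridge_q ennreal_leI)
  qed
  moreover have "isometric_embedding UNIV dM UNIV glued Inl" "isometric_embedding UNIV dN UNIV glued Inr"
    by (auto simp: isometric_embedding_def)
  ultimately show ?thesis
    unfolding Gromov_Hausdorff_distance_def using Metric_space_glued
    by (intro Inf_lower2[of "Hausdorff_distance glued (range Inl) (range Inr)"]) blast+
qed

end

theorem Gromov_Hausdorff_distance_less_iff:
  assumes M: "Metric_space UNIV dM" and N: "Metric_space UNIV dN"
  shows "Gromov_Hausdorff_distance UNIV dM UNIV dN < ennreal r \<longleftrightarrow>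
    (\<exists>R q. 0 \<le> q \<and> q < r \<and> correspondence R \<and> distortion_le dM dN R (2 * q))"
proof
  assume "Gromov_Hausdorff_distance UNIV dM UNIV dN < ennreal r"
  then show "\<exists>R q. 0 \<le> q \<and> q < r \<and> correspondence R \<and> distortion_le dM dN R (2 * q)"
    unfolding Gromov_Hausdorff_distance_def Inf_less_iff
    using correspondence_of_Hausdorff_distance by blast
next
  assume "\<exists>R q. 0 \<le> q \<and> q < r \<and> correspondence R \<and> distortion_le dM dN R (2 * q)"
  then obtain R q where R: "0 \<le> q" "q < r" "correspondence R" "distortion_le dM dN R (2 * q)"
    by blast
  obtain q' where q': "q < q'" "q' < r"
    using dense[OF R(2)] by blast
  have "distortion_le dM dN R (2 * q')"
    using R(4) q'(1) unfolding distortion_le_def by fastforce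
  then have "Gromov_Hausdorff_distance UNIV dM UNIV dN \<le> ennreal q'"
    using R(1,3) q' by (intro Gromov_Hausdorff_distance_le_of_correspondence[OF M N]) auto
  also have "\<dots> < ennreal r"
    using R(1) q' by (simp add: ennreal_less_iff)
  finally show "Gromov_Hausdorff_distance UNIV dM UNIV dN < ennreal r" .
qed

lemma correspondence_converse: "correspondence R \<Longrightarrow> correspondence (\<lambda>x y. R y x)"
  by (simp add: correspondence_def)

lemma correspondence_comp: "correspondence R \<Longrightarrow> correspondence S \<Longrightarrow> correspondence (R OO S)"
  unfolding correspondence_def by blast

lemma distortion_le_comp:
  "distortion_le dL dM R a \<Longrightarrow> distortion_le dM dN S b \<Longrightarrow> distortion_le dL dN (R OO S) (a + b)"
  unfolding distortion_le_def by (smt (verit) relcomppE)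

lemma metrics_on_nat_eq:
  "metrics_on_nat = pseudometrics_on_nat \<inter> {f. \<forall>i j. i \<noteq> j \<longrightarrow> 0 < f (i, j)}"
proof (intro equalityI subsetI)
  fix f assume "f \<in> metrics_on_nat"
  then interpret Metric_space UNIV "curry f"
    by (simp add: metrics_on_nat_def)
  show "f \<in> pseudometrics_on_nat \<inter> {f. \<forall>i j. i \<noteq> j \<longrightarrow> 0 < f (i, j)}"
    using mdist_zero commute triangle mdist_pos_less by (auto simp: pseudometrics_on_nat_def)
next
  fix f assume f: "f \<in> pseudometrics_on_nat \<inter> {f. \<forall>i j. i \<noteq> j \<longrightarrow> 0 < f (i, j)}"
  have "Metric_space UNIV (curry f)"
  proof
    fix i j k :: nat
    show "0 \<le> curry f i j"
      using f by (cases "i = j") (auto simp: pseudometrics_on_nat_def less_imp_le)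
    show "curry f i j = curry f j i" "curry f i k \<le> curry f i j + curry f j k"
      using f by (auto simp: pseudometrics_on_nat_def)
    show "curry f i j = 0 \<longleftrightarrow> i = j"
      using f by (cases "i = j") (auto simp: pseudometrics_on_nat_def less_imp_neq[symmetric])
  qed
  then show "f \<in> metrics_on_nat"
    by (simp add: metrics_on_nat_def)
qed

abbreviation "metrics_topology \<equiv> subtopology euclidean metrics_on_nat"

lemma metrics_space_eq: "metrics_space = borel_of metrics_topology"
  by (simp add: metrics_space_def euclidean_product_topology)

lemma polish_metrics_topology: "polish_topology metrics_topology"
proof -
  have "gdelta_in euclidean {f :: nat \<times> nat \<Rightarrow> real. i \<noteq> j \<longrightarrow> 0 < f (i, j)}" for i j
  proof -
    have "open {f :: nat \<times> nat \<Rightarrow> real. 0 < f (i, j)}"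
      by (intro open_Collect_less continuous_on_const continuous_on_product_coordinates)
    then have "open {f :: nat \<times> nat \<Rightarrow> real. i \<noteq> j \<longrightarrow> 0 < f (i, j)}"
      by (cases "i = j") auto
    then show ?thesis
      by (simp add: open_imp_gdelta_in)
  qed
  then have "gdelta_in euclidean {f :: nat \<times> nat \<Rightarrow> real. \<forall>i j. i \<noteq> j \<longrightarrow> 0 < f (i, j)}"
    by (intro gdelta_in_Collect_all)
  moreover have "gdelta_in euclidean pseudometrics_on_nat"
    using closed_pseudometrics_on_nat by (intro closed_imp_gdelta_in) (auto simp: metrizable_space_euclidean)
  ultimately have "gdelta_in euclidean metrics_on_nat"
    unfolding metrics_on_nat_eq by (intro gdelta_in_Int)
  then show ?thesis
    by (rule polish_subtopology_gdelta[OF polish_euclidean])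
qed

lemma space_metrics_space: "space metrics_space = metrics_on_nat"
  by (simp add: metrics_space_eq)

lemma \<rho>GH_less_iff:
  assumes "f \<in> metrics_on_nat" "g \<in> metrics_on_nat"
  shows "\<rho>GH f g < ennreal r \<longleftrightarrow>
    (\<exists>R c. 0 \<le> c \<and> c < r \<and> correspondence R \<and> distortion_le (curry f) (curry g) R (2 * c))"
  using assms unfolding \<rho>GH_def metrics_on_nat_def by (intro Gromov_Hausdorff_distance_less_iff) auto

lemma pseudometric_on_\<rho>GH: "pseudometric_on metrics_on_nat \<rho>GH"
proof (rule pseudometric_onI)
  fix f and r :: real assume f: "f \<in> metrics_on_nat" and r: "0 < r"
  have "distortion_le (curry f) (curry f) (=) (2 * 0)"
    by (auto simp: distortion_le_def)
  then show "\<rho>GH f f < ennreal r"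
    unfolding \<rho>GH_less_iff[OF f f] using r by (intro exI[of _ "(=)"] exI[of _ 0]) (simp add: correspondence_def)
next
  fix f g and r :: real assume fg: "f \<in> metrics_on_nat" "g \<in> metrics_on_nat" and "\<rho>GH f g < ennreal r"
  then obtain R q where R: "0 \<le> q" "q < r" "correspondence R" "distortion_le (curry f) (curry g) R (2 * q)"
    using \<rho>GH_less_iff by blast
  then have "distortion_le (curry g) (curry f) (\<lambda>x y. R y x) (2 * q)"
    unfolding distortion_le_def by (metis abs_minus_commute)
  then show "\<rho>GH g f < ennreal r"
    unfolding \<rho>GH_less_iff[OF fg(2,1)] using R correspondence_converse by blast
next
  fix f g h and a b :: real
  assume fgh: "f \<in> metrics_on_nat" "g \<in> metrics_on_nat" "h \<in> metrics_on_nat"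
    and less: "\<rho>GH f g < ennreal a" "\<rho>GH g h < ennreal b"
  obtain R p where R: "0 \<le> p" "p < a" "correspondence R" "distortion_le (curry f) (curry g) R (2 * p)"
    using less(1) unfolding \<rho>GH_less_iff[OF fgh(1,2)] by blast
  obtain S q where S: "0 \<le> q" "q < b" "correspondence S" "distortion_le (curry g) (curry h) S (2 * q)"
    using less(2) unfolding \<rho>GH_less_iff[OF fgh(2,3)] by blast
  have "distortion_le (curry f) (curry h) (R OO S) (2 * (p + q))"
    using distortion_le_comp[OF R(4) S(4)] by (simp add: algebra_simps)
  moreover have "correspondence (R OO S)" "0 \<le> p + q" "p + q < a + b"
    using R S by (auto intro: correspondence_comp)
  ultimately show "\<rho>GH f h < ennreal (a + b)"
    unfolding \<rho>GH_less_iff[OF fgh(1,3)] by blast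
qed

text \<open>
  Replacing correspondences by pairs of choice functions, one in each direction, makes the condition
  on the distortion closed.
\<close>

lemma ex_correspondence_iff:
  assumes f: "f \<in> pseudometrics_on_nat" and g: "g \<in> pseudometrics_on_nat"
  shows "(\<exists>R. correspondence R \<and> distortion_le (curry f) (curry g) R c) \<longleftrightarrow>
    (\<exists>s t. \<forall>i j. \<bar>f (i, j) - g (s i, s j)\<bar> \<le> c \<and> \<bar>f (t i, t j) - g (i, j)\<bar> \<le> c \<and>
      \<bar>f (i, t j) - g (s i, j)\<bar> \<le> c)" (is "?L \<longleftrightarrow> ?R")
proof
  assume ?L
  then obtain R where R: "correspondence R" "distortion_le (curry f) (curry g) R c"
    by blast
  obtain s t where st: "\<And>x. R x (s x)" "\<And>y. R (t y) y"
    using R(1) unfolding correspondence_def by metis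
  show ?R
    by (rule exI[of _ s], rule exI[of _ t])
       (use R(2) st in \<open>unfold distortion_le_def curry_def, blast\<close>)
next
  assume ?R
  then obtain s t where st: "\<And>i j. \<bar>f (i, j) - g (s i, s j)\<bar> \<le> c"
    "\<And>i j. \<bar>f (t i, t j) - g (i, j)\<bar> \<le> c" "\<And>i j. \<bar>f (i, t j) - g (s i, j)\<bar> \<le> c"
    by blast
  have sym: "\<bar>f (t j, i) - g (j, s i)\<bar> \<le> c" for i j
    using st(3)[of i j] f g unfolding pseudometrics_on_nat_def by simp
  have "correspondence (\<lambda>x y. y = s x \<or> x = t y)"
    unfolding correspondence_def by blast
  moreover have "distortion_le (curry f) (curry g) (\<lambda>x y. y = s x \<or> x = t y) c"
    unfolding distortion_le_def using st sym by auto
  ultimately show ?L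
    by blast
qed

lemma analytic_pseudometric_\<rho>GH: "analytic_pseudometric metrics_space \<rho>GH"
  unfolding metrics_space_eq
proof (rule analytic_pseudometric_of_closed[where P = "\<lambda>f g s t c. \<forall>i j. \<bar>f (i, j) - g (s i, s j)\<bar> \<le> 2 * c \<and>
    \<bar>f (t i, t j) - g (i, j)\<bar> \<le> 2 * c \<and> \<bar>f (i, t j) - g (s i, j)\<bar> \<le> 2 * c"])
  show "\<rho>GH f g < ennreal r \<longleftrightarrow> (\<exists>s t c. 0 \<le> c \<and> c < r \<and> (\<forall>i j. \<bar>f (i, j) - g (s i, s j)\<bar> \<le> 2 * c \<and>
      \<bar>f (t i, t j) - g (i, j)\<bar> \<le> 2 * c \<and> \<bar>f (i, t j) - g (s i, j)\<bar> \<le> 2 * c))"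
    if fg: "f \<in> metrics_on_nat" "g \<in> metrics_on_nat" for f g r
  proof -
    have fg': "f \<in> pseudometrics_on_nat" "g \<in> pseudometrics_on_nat"
      using fg by (auto simp: metrics_on_nat_eq)
    have "\<rho>GH f g < ennreal r \<longleftrightarrow>
        (\<exists>c. 0 \<le> c \<and> c < r \<and> (\<exists>R. correspondence R \<and> distortion_le (curry f) (curry g) R (2 * c)))"
      unfolding \<rho>GH_less_iff[OF fg] by blast
    then show ?thesis
      unfolding ex_correspondence_iff[OF fg'] by blast
  qed
  fix f g :: "nat \<times> nat \<Rightarrow> real" and s t :: "nat \<Rightarrow> nat" and c c' :: real
  assume "c \<le> c'"
  then have "2 * c \<le> 2 * c'"
    by simp
  then show "\<forall>i j. \<bar>f (i, j) - g (s i, s j)\<bar> \<le> 2 * c' \<and> \<bar>f (t i, t j) - g (i, j)\<bar> \<le> 2 * c' \<and>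
      \<bar>f (i, t j) - g (s i, j)\<bar> \<le> 2 * c'"
    if "\<forall>i j. \<bar>f (i, j) - g (s i, s j)\<bar> \<le> 2 * c \<and> \<bar>f (t i, t j) - g (i, j)\<bar> \<le> 2 * c \<and>
      \<bar>f (i, t j) - g (s i, j)\<bar> \<le> 2 * c"
    using that order_trans by blast
next
  show "closed {z :: (nat \<times> nat) witnessed_pair. \<forall>i j.
      \<bar>fst (fst z) (i, j) - snd (fst z) (fst (fst (snd z)) i, fst (fst (snd z)) j)\<bar> \<le> 2 * level r (snd (snd z) 0) \<and>
      \<bar>fst (fst z) (snd (fst (snd z)) i, snd (fst (snd z)) j) - snd (fst z) (i, j)\<bar> \<le> 2 * level r (snd (snd z) 0) \<and>
      \<bar>fst (fst z) (i, snd (fst (snd z)) j) - snd (fst z) (fst (fst (snd z)) i, j)\<bar> \<le> 2 * level r (snd (snd z) 0)}" for r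
    by (intro closed_Collect_conj closed_Collect_all closed_Collect_le continuous_on_const
        continuous_on_rabs continuous_on_diff continuous_on_mult continuous_level continuous_coordinates
        continuous_entry[of _ "\<lambda>z. snd (fst z)"] continuous_entry[of _ "\<lambda>z. fst (fst z)"])
qed (auto simp: polish_metrics_topology pseudometric_on_\<rho>GH)

section \<open>Reductions between the two distances\<close>

lemma Bu_reducibleI:
  assumes "analytic_pseudometric X \<rho>" "analytic_pseudometric Y \<sigma>" "f \<in> X \<rightarrow>\<^sub>M Y"
    and pos: "\<And>\<epsilon>::real. 0 < \<epsilon> \<Longrightarrow> 0 < a \<epsilon> \<and> 0 < b \<epsilon>"
    and forward: "\<And>\<epsilon> x y. 0 < \<epsilon> \<Longrightarrow> x \<in> space X \<Longrightarrow> y \<in> space X \<Longrightarrow>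
      \<rho> x y < ennreal (a \<epsilon>) \<Longrightarrow> \<sigma> (f x) (f y) < ennreal \<epsilon>"
    and backward: "\<And>\<epsilon> x y. 0 < \<epsilon> \<Longrightarrow> x \<in> space X \<Longrightarrow> y \<in> space X \<Longrightarrow>
      \<sigma> (f x) (f y) < ennreal (b \<epsilon>) \<Longrightarrow> \<rho> x y < ennreal \<epsilon>"
  shows "Bu_reducible X \<rho> Y \<sigma>"
  unfolding Bu_reducible_def
proof (intro conjI bexI[of _ f] allI impI)
  fix \<epsilon> :: real assume e: "0 < \<epsilon>"
  show "\<exists>\<delta>X \<delta>Y. 0 < \<delta>X \<and> 0 < \<delta>Y \<and> (\<forall>x\<in>space X. \<forall>y\<in>space X.
      (\<rho> x y < ennreal \<delta>X \<longrightarrow> \<sigma> (f x) (f y) < ennreal \<epsilon>) \<and> (\<sigma> (f x) (f y) < ennreal \<delta>Y \<longrightarrow> \<rho> x y < ennreal \<epsilon>))"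
    by (rule exI[of _ "a \<epsilon>"], rule exI[of _ "b \<epsilon>"]) (use pos[OF e] forward[OF e] backward[OF e] in simp)
qed (fact assms)+

lemma Bu_reducibleE:
  assumes "Bu_reducible X \<rho> Y \<sigma>"
  obtains f and a b :: "real \<Rightarrow> real" where "f \<in> X \<rightarrow>\<^sub>M Y" "\<And>\<epsilon>. 0 < \<epsilon> \<Longrightarrow> 0 < a \<epsilon> \<and> 0 < b \<epsilon>"
    "\<And>\<epsilon> x y. 0 < \<epsilon> \<Longrightarrow> x \<in> space X \<Longrightarrow> y \<in> space X \<Longrightarrow>
      \<rho> x y < ennreal (a \<epsilon>) \<Longrightarrow> \<sigma> (f x) (f y) < ennreal \<epsilon>"
    "\<And>\<epsilon> x y. 0 < \<epsilon> \<Longrightarrow> x \<in> space X \<Longrightarrow> y \<in> space X \<Longrightarrow>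
      \<sigma> (f x) (f y) < ennreal (b \<epsilon>) \<Longrightarrow> \<rho> x y < ennreal \<epsilon>"
proof -
  define P where "P f \<epsilon> a b \<longleftrightarrow> a > 0 \<and> b > 0 \<and> (\<forall>x\<in>space X. \<forall>y\<in>space X.
      (\<rho> x y < ennreal a \<longrightarrow> \<sigma> (f x) (f y) < ennreal \<epsilon>) \<and> (\<sigma> (f x) (f y) < ennreal b \<longrightarrow> \<rho> x y < ennreal \<epsilon>))"
    for f and \<epsilon> a b :: real
  obtain f where f: "f \<in> X \<rightarrow>\<^sub>M Y" "\<forall>\<epsilon>>0. \<exists>a b. P f \<epsilon> a b"
    using assms unfolding Bu_reducible_def P_def by blast
  then obtain a b where P: "\<And>\<epsilon>. 0 < \<epsilon> \<Longrightarrow> P f \<epsilon> (a \<epsilon>) (b \<epsilon>)"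
    by metis
  show ?thesis
    by (rule that[OF f(1), of a b]; drule P) (simp_all add: P_def)
qed

lemma Bu_reducible_trans:
  assumes "Bu_reducible X \<rho> Y \<sigma>" "Bu_reducible Y \<sigma> Z \<tau>"
  shows "Bu_reducible X \<rho> Z \<tau>"
proof -
  obtain f a b where f: "f \<in> X \<rightarrow>\<^sub>M Y" "\<And>\<epsilon>. 0 < \<epsilon> \<Longrightarrow> 0 < a \<epsilon> \<and> 0 < b \<epsilon>"
    "\<And>\<epsilon> x y. 0 < \<epsilon> \<Longrightarrow> x \<in> space X \<Longrightarrow> y \<in> space X \<Longrightarrow>
      \<rho> x y < ennreal (a \<epsilon>) \<Longrightarrow> \<sigma> (f x) (f y) < ennreal \<epsilon>"
    "\<And>\<epsilon> x y. 0 < \<epsilon> \<Longrightarrow> x \<in> space X \<Longrightarrow> y \<in> space X \<Longrightarrow>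
      \<sigma> (f x) (f y) < ennreal (b \<epsilon>) \<Longrightarrow> \<rho> x y < ennreal \<epsilon>"
    by (rule Bu_reducibleE[OF assms(1)]) blast
  obtain g a' b' where g: "g \<in> Y \<rightarrow>\<^sub>M Z" "\<And>\<epsilon>. 0 < \<epsilon> \<Longrightarrow> 0 < a' \<epsilon> \<and> 0 < b' \<epsilon>"
    "\<And>\<epsilon> x y. 0 < \<epsilon> \<Longrightarrow> x \<in> space Y \<Longrightarrow> y \<in> space Y \<Longrightarrow>
      \<sigma> x y < ennreal (a' \<epsilon>) \<Longrightarrow> \<tau> (g x) (g y) < ennreal \<epsilon>"
    "\<And>\<epsilon> x y. 0 < \<epsilon> \<Longrightarrow> x \<in> space Y \<Longrightarrow> y \<in> space Y \<Longrightarrow>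
      \<tau> (g x) (g y) < ennreal (b' \<epsilon>) \<Longrightarrow> \<sigma> x y < ennreal \<epsilon>"
    by (rule Bu_reducibleE[OF assms(2)]) blast
  show ?thesis
  proof (rule Bu_reducibleI[of X \<rho> Z \<tau> "\<lambda>x. g (f x)" "\<lambda>\<epsilon>. a (a' \<epsilon>)" "\<lambda>\<epsilon>. b' (b \<epsilon>)"])
    show "analytic_pseudometric X \<rho>" "analytic_pseudometric Z \<tau>"
      using assms unfolding Bu_reducible_def by blast+
    show "(\<lambda>x. g (f x)) \<in> X \<rightarrow>\<^sub>M Z"
      by (rule measurable_compose[OF f(1) g(1)])
    show "0 < a (a' \<epsilon>) \<and> 0 < b' (b \<epsilon>)" if "0 < \<epsilon>" for \<epsilon> :: real
      using f(2) g(2) that by blast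
    fix \<epsilon> :: real and x y assume e: "0 < \<epsilon>" and xy: "x \<in> space X" "y \<in> space X"
    note fxy = xy[THEN measurable_space[OF f(1)]]
    show "\<tau> (g (f x)) (g (f y)) < ennreal \<epsilon>" if "\<rho> x y < ennreal (a (a' \<epsilon>))"
      using g(3)[OF e fxy f(3)[OF _ xy that]] g(2)[OF e] by blast
    show "\<rho> x y < ennreal \<epsilon>" if "\<tau> (g (f x)) (g (f y)) < ennreal (b' (b \<epsilon>))"
      using f(4)[OF e xy g(4)[OF _ fxy that]] f(2)[OF e] by blast
  qed
qed

lemma \<rho>GH_less_of_correspondence:
  assumes "f \<in> metrics_on_nat" "g \<in> metrics_on_nat" "correspondence R"
    and "distortion_le (curry f) (curry g) R c" "0 \<le> c" "c < \<epsilon>"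
  shows "\<rho>GH f g < ennreal \<epsilon>"
  unfolding \<rho>GH_less_iff[OF assms(1,2)]
  by (rule exI[of _ R], rule exI[of _ "c / 2"]) (use assms in auto)

text \<open>
  The numbers with \<open>block m = i\<close> serve as infinitely many copies of the point \<open>i\<close>.
\<close>

definition block :: "nat \<Rightarrow> nat" where
  "block m = fst (prod_decode m)"

text \<open>
  The Cantor-Bernstein construction. The injection \<open>a\<close> goes from left to right along the
  correspondence, and \<open>b\<close> from right to left; both can be made injective because the second component
  of the coded pair is free. The resulting bijection is \<open>a\<close> on \<open>S\<close> and the inverse of \<open>b\<close> outside of
  \<open>S\<close>, so it stays inside the correspondence.
\<close>

lemma bij_in_correspondence:
  assumes R: "correspondence R"
  obtains h where "bij h" "\<And>m. R (block m) (block (h m))"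
proof -
  obtain s t where st: "\<And>x. R x (s x)" "\<And>y. R (t y) y"
    using R unfolding correspondence_def by metis
  define a where "a m = prod_encode (s (block m), m)" for m
  define b where "b m = prod_encode (t (block m), m)" for m
  have inj: "inj a" "inj b"
    by (auto simp: a_def b_def inj_def)
  have R: "R (block m) (block (a m))" "R (block (b m)) (block m)" for m
    using st by (simp_all add: a_def b_def block_def)
  let ?F = "\<lambda>S. - b ` (- a ` S)"
  have "mono ?F"
    by (rule monoI) blast
  then have S: "lfp ?F = ?F (lfp ?F)"
    by (rule lfp_unfold)
  define S where "S = lfp ?F"
  have S: "- S = b ` (- a ` S)"
    using S unfolding S_def by blast
  define h where "h m = (if m \<in> S then a m else inv_into UNIV b m)" for m
  have hb: "h (b n) = n" if "n \<notin> a ` S" for n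
  proof -
    have "b n \<notin> S"
      using S that by blast
    then show ?thesis
      using inj(2) by (simp add: h_def)
  qed
  have not_S: "\<exists>n. n \<notin> a ` S \<and> m = b n" if "m \<notin> S" for m
    using S that by blast
  have "R (block m) (block (h m))" for m
  proof (cases "m \<in> S")
    case False
    then obtain n where "n \<notin> a ` S" "m = b n"
      using not_S by blast
    then show ?thesis
      using hb R(2) by simp
  qed (simp add: h_def R(1))
  moreover have "bij h"
  proof (rule bijI)
    show "surj h"
      unfolding surj_def
    proof
      fix n show "\<exists>m. n = h m"
      proof (cases "n \<in> a ` S")
        case True
        then show ?thesis
          by (auto simp: h_def)
      next
        case False
        then show ?thesis
          using hb[OF False] by (intro exI[of _ "b n"]) simp
      qed
    qed
    show "inj h"
    proof (rule injI)
      fix m m' assume eq: "h m = h m'"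
      have out: "h m \<notin> a ` S" if "m \<notin> S" for m
        using not_S[OF that] hb by auto
      have ins: "h m \<in> a ` S" if "m \<in> S" for m
        using that by (simp add: h_def)
      show "m = m'"
      proof (cases "m \<in> S")
        case True
        then have "m' \<in> S"
          using eq ins out by metis
        then show ?thesis
          using eq True inj(1) by (simp add: h_def inj_eq)
      next
        case False
        then have "m' \<notin> S"
          using eq ins out by metis
        then show ?thesis
          using eq not_S[OF False] not_S[of m'] hb by auto
      qed
    qed
  qed
  ultimately show ?thesis
    using that by blast
qed

text \<open>
  The reduction repeats each point infinitely often. A bijection between the copies projects to a
  correspondence of the same distortion, and each correspondence arises from a bijection.
\<close>

lemma \<rho>GH_reducible_to_relabel_distance:
  "Bu_reducible metrics_space \<rho>GH pseudometrics_space relabel_distance"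
proof -
  define F where "F f = (\<lambda>(m, n). f (block m, block n))" for f :: "nat \<times> nat \<Rightarrow> real"
  have F_closed: "F f \<in> pseudometrics_on_nat" if "f \<in> metrics_on_nat" for f
    using that by (auto simp: metrics_on_nat_eq pseudometrics_on_nat_def F_def)
  have surj_block: "\<exists>m. block m = i" for i
    by (rule exI[of _ "prod_encode (i, 0)"]) (simp add: block_def)
  have "continuous_on UNIV F"
    unfolding F_def
    by (intro continuous_on_coordinatewise_then_product) (auto simp: case_prod_unfold)
  then have F_meas: "F \<in> metrics_space \<rightarrow>\<^sub>M pseudometrics_space"
    unfolding metrics_space_eq
    by (intro continuous_map_measurable) (auto intro: F_closed continuous_on_subset)
  have forward: "relabel_distance (F f) (F g) < ennreal \<epsilon>"
    if e: "\<epsilon> > 0" and fg: "f \<in> metrics_on_nat" "g \<in> metrics_on_nat" and less: "\<rho>GH f g < ennreal (\<epsilon> / 2)"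
    for f g \<epsilon>
  proof -
    obtain R c where R: "0 \<le> c" "c < \<epsilon> / 2" "correspondence R" "distortion_le (curry f) (curry g) R (2 * c)"
      using less unfolding \<rho>GH_less_iff[OF fg] by blast
    obtain h where h: "bij h" "\<And>m. R (block m) (block (h m))"
      by (rule bij_in_correspondence[OF R(3)]) blast
    have "\<bar>F f (m, n) - F g (h m, h n)\<bar> \<le> 2 * c" for m n
      using R(4) h(2)[of m] h(2)[of n] unfolding distortion_le_def by (simp add: F_def)
    then show ?thesis
      unfolding relabel_distance_less_iff[OF fg[THEN F_closed]] using h(1) R(1,2)
      by (intro exI[of _ h], intro exI[of _ "2 * c"]) auto
  qed
  have backward: "\<rho>GH f g < ennreal \<epsilon>"
    if e: "\<epsilon> > 0" and fg: "f \<in> metrics_on_nat" "g \<in> metrics_on_nat"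
      and less: "relabel_distance (F f) (F g) < ennreal \<epsilon>" for f g \<epsilon>
  proof -
    obtain h c where h: "bij h" "0 \<le> c" "c < \<epsilon>" "\<And>m n. \<bar>F f (m, n) - F g (h m, h n)\<bar> \<le> c"
      using less unfolding relabel_distance_less_iff[OF fg[THEN F_closed]] by blast
    let ?R = "\<lambda>x y. \<exists>m. block m = x \<and> block (h m) = y"
    have "correspondence ?R"
      unfolding correspondence_def using surj_block h(1) by (metis bij_pointE)
    moreover have "distortion_le (curry f) (curry g) ?R c"
      unfolding distortion_le_def using h(4) by (auto simp: F_def)
    ultimately show ?thesis
      using h(2,3) fg by (intro \<rho>GH_less_of_correspondence)
  qed
  show ?thesis
    by (rule Bu_reducibleI[OF analytic_pseudometric_\<rho>GH analytic_pseudometric_relabel_distance F_meas,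
          of "\<lambda>\<epsilon>. \<epsilon> / 2" "\<lambda>\<epsilon>. \<epsilon>"])
       (auto simp: space_metrics_space intro: forward backward)
qed

text \<open>
  Two partners of one point would have distance at least \<open>1\<close>, while the point has distance \<open>0\<close> from
  itself.
\<close>

lemma bij_of_separated_correspondence:
  assumes R: "correspondence R" "distortion_le dM dN R c" and c: "c < 1"
    and M: "\<And>x. dM x x = 0" "\<And>x y. x \<noteq> y \<Longrightarrow> 1 \<le> dM x y"
    and N: "\<And>x. dN x x = 0" "\<And>x y. x \<noteq> y \<Longrightarrow> 1 \<le> dN x y"
  obtains h where "bij h" "\<And>x. R x (h x)"
proof -
  obtain h where h: "\<And>x. R x (h x)"
    using R(1) unfolding correspondence_def by metis
  have dis: "\<bar>dM x x' - dN y y'\<bar> < 1" if "R x y" "R x' y'" for x y x' y'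
    using R(2) that c unfolding distortion_le_def by (meson order_le_less_trans)
  have right: "y = y'" if "R x y" "R x y'" for x y y'
    using dis[OF that] M(1)[of x] N(2)[of y y'] by fastforce
  have left: "x = x'" if "R x y" "R x' y" for x x' y
    using dis[OF that] N(1)[of y] M(2)[of x x'] by fastforce
  have "bij h"
    unfolding bij_def inj_def surj_def using h right left R(1) unfolding correspondence_def by metis
  then show ?thesis
    using that h by blast
qed

text \<open>
  The reduction adds \<open>1\<close> to all distances between different points. Relabelling does not see this,
  and correspondences of small distortion are bijections afterwards.
\<close>

lemma relabel_distance_reducible_to_\<rho>GH:
  "Bu_reducible pseudometrics_space relabel_distance metrics_space \<rho>GH"
proof -
  define F where "F f = (\<lambda>(m, n). f (m, n) + of_bool (m \<noteq> n))" for f :: "nat \<times> nat \<Rightarrow> real"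
  have nonneg: "0 \<le> f (i, j)" if "f \<in> pseudometrics_on_nat" for f i j
  proof -
    have "f (i, i) = 0" "f (i, i) \<le> f (i, j) + f (j, i)" "f (j, i) = f (i, j)"
      using that unfolding pseudometrics_on_nat_def by blast+
    then show ?thesis
      by simp
  qed
  have F_closed: "F f \<in> metrics_on_nat" if f: "f \<in> pseudometrics_on_nat" for f
  proof -
    have pm: "f (i, i) = 0" "f (i, j) = f (j, i)" "f (i, k) \<le> f (i, j) + f (j, k)" for i j k
      using f unfolding pseudometrics_on_nat_def by blast+
    have "F f (i, i) = 0" "F f (i, j) = F f (j, i)" for i j
      using pm(1)[of i] pm(2)[of i j] by (auto simp: F_def)
    moreover have "F f (i, k) \<le> F f (i, j) + F f (j, k)" for i j k
      using pm(3)[of i k j] by (auto simp: F_def)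
    moreover have "0 < F f (i, j)" if "i \<noteq> j" for i j
      using nonneg[OF f, of i j] that by (simp add: F_def)
    ultimately show ?thesis
      unfolding metrics_on_nat_eq pseudometrics_on_nat_def by blast
  qed
  have F_sep: "curry (F f) x x = 0" "x \<noteq> y \<Longrightarrow> 1 \<le> curry (F f) x y" if f: "f \<in> pseudometrics_on_nat" for f x y
    using f nonneg[OF f] by (auto simp: F_def pseudometrics_on_nat_def)
  have F_diff: "F f (i, j) - F g (h i, h j) = f (i, j) - g (h i, h j)" if "bij h" for f g h i j
    using that by (simp add: F_def bij_is_inj inj_eq)
  have "continuous_on UNIV F"
    unfolding F_def
    by (intro continuous_on_coordinatewise_then_product)
       (auto simp: case_prod_unfold intro!: continuous_on_add)
  then have F_meas: "F \<in> pseudometrics_space \<rightarrow>\<^sub>M metrics_space"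
    unfolding metrics_space_eq
    by (intro continuous_map_measurable) (auto intro: F_closed continuous_on_subset)
  have forward: "\<rho>GH (F f) (F g) < ennreal \<epsilon>"
    if e: "\<epsilon> > 0" and fg: "f \<in> pseudometrics_on_nat" "g \<in> pseudometrics_on_nat"
      and less: "relabel_distance f g < ennreal \<epsilon>" for f g \<epsilon>
  proof -
    obtain h c where h: "bij h" "0 \<le> c" "c < \<epsilon>" "\<And>m n. \<bar>f (m, n) - g (h m, h n)\<bar> \<le> c"
      using less unfolding relabel_distance_less_iff[OF fg] by blast
    let ?R = "\<lambda>x y. y = h x"
    have "correspondence ?R"
      unfolding correspondence_def using h(1) by (metis bij_pointE)
    moreover have "distortion_le (curry (F f)) (curry (F g)) ?R c"
      unfolding distortion_le_def using h(4) F_diff[OF h(1)] by simp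
    ultimately show ?thesis
      using h(2,3) F_closed fg by (intro \<rho>GH_less_of_correspondence)
  qed
  have backward: "relabel_distance f g < ennreal \<epsilon>"
    if e: "\<epsilon> > 0" and fg: "f \<in> pseudometrics_on_nat" "g \<in> pseudometrics_on_nat"
      and less: "\<rho>GH (F f) (F g) < ennreal (min \<epsilon> 1 / 2)" for f g \<epsilon>
  proof -
    obtain R c where R: "0 \<le> c" "c < min \<epsilon> 1 / 2" "correspondence R"
        "distortion_le (curry (F f)) (curry (F g)) R (2 * c)"
      using less unfolding \<rho>GH_less_iff[OF fg[THEN F_closed]] by blast
    obtain h where h: "bij h" "\<And>m. R m (h m)"
      using bij_of_separated_correspondence[OF R(3,4) _ F_sep[OF fg(1)] F_sep[OF fg(2)]] R(2) by auto
    have "\<bar>F f (m, n) - F g (h m, h n)\<bar> \<le> 2 * c" for m n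
      using R(4) h(2) unfolding distortion_le_def curry_def by blast
    then have "\<bar>f (m, n) - g (h m, h n)\<bar> \<le> 2 * c" for m n
      unfolding F_diff[OF h(1)] .
    then show ?thesis
      unfolding relabel_distance_less_iff[OF fg] using h(1) R(1,2)
      by (intro exI[of _ h], intro exI[of _ "2 * c"]) auto
  qed
  show ?thesis
    by (rule Bu_reducibleI[OF analytic_pseudometric_relabel_distance analytic_pseudometric_\<rho>GH F_meas,
          of "\<lambda>\<epsilon>. \<epsilon>" "\<lambda>\<epsilon>. min \<epsilon> 1 / 2"])
       (auto simp: space_pseudometrics intro: forward backward)
qed

theorem \<rho>GH_bireducible_with_CTR: "bireducible_with_CTR_orbit_pseudometric metrics_space \<rho>GH"
  unfolding bireducible_with_CTR_orbit_pseudometric_def Bu_bireducible_def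
  using CTR_setting_relabel \<rho>GH_reducible_to_relabel_distance relabel_distance_reducible_to_\<rho>GH by blast

lemma bireducible_with_CTR_orbit_pseudometric_transfer:
  assumes "Bu_bireducible Y \<sigma> Z \<rho>" "bireducible_with_CTR_orbit_pseudometric Z \<rho>"
  shows "bireducible_with_CTR_orbit_pseudometric Y \<sigma>"
  using assms Bu_reducible_trans
  unfolding bireducible_with_CTR_orbit_pseudometric_def Bu_bireducible_def by meson

theorem theorem2:
  shows "(bireducible_with_CTR_orbit_pseudometric metrics_space \<rho>GH \<and>
      (\<forall>(Y :: 'y measure) \<sigma>.
        analytic_pseudometric Y \<sigma> \<and> Bu_bireducible Y \<sigma> metrics_space \<rho>GH \<longrightarrow>
        bireducible_with_CTR_orbit_pseudometric Y \<sigma>)) \<and>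
    (\<forall>(G :: 'g monoid) T (X :: 'x measure) \<phi> d.
        CTR_setting G T X \<phi> d \<longrightarrow>
        \<not> borel_reducible E1_space E1 X (zero_relation X (orbit_pseudometric G \<phi> d)))"
proof (intro conjI allI impI)
  show "bireducible_with_CTR_orbit_pseudometric metrics_space \<rho>GH"
    by (rule \<rho>GH_bireducible_with_CTR)
  show "bireducible_with_CTR_orbit_pseudometric Y \<sigma>"
    if "analytic_pseudometric Y \<sigma> \<and> Bu_bireducible Y \<sigma> metrics_space \<rho>GH"
    for Y :: "'y measure" and \<sigma>
    using that \<rho>GH_bireducible_with_CTR bireducible_with_CTR_orbit_pseudometric_transfer by blast
  show "\<not> borel_reducible E1_space E1 X (zero_relation X (orbit_pseudometric G \<phi> d))"
    if "CTR_setting G T X \<phi> d"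
    for G :: "'g monoid" and T and X :: "'x measure" and \<phi> d
    using that by (rule E1_not_reducible)
qed

end
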